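(* Let $\mu,\nu\in\mathcal M$ with $\mu(\mathbb R)=\nu(\mathbb R)$ and $\min\{p_{\mu,\nu},c_{\mu,\nu}\}>0$. Suppose $h:\mathbb R\to[0,\infty)$ is convex with $h(0)=0$. Then $$V_h(\mu,\nu)=V_h(\eta^-,\chi^-)+V_h(\eta^+,\chi^+)$$ $$=\inf_{\pi\in\Pi_{Sub}(\eta^-,\chi^-)}\int_{\mathbb R}h\Big(x-\int y\,\pi_x(dy)\Big)\eta^-(dx)+\inf_{\pi\in\Pi_{Sup}(\eta^+,\chi^+)}\int_{\mathbb R}h\Big(x-\int y\,\pi_x(dy)\Big)\eta^+(dx).$$
   Context: $\mathcal M$ is the set of Borel measures $\eta$ on $\mathbb R$ with $\eta(\mathbb R)<\infty$ and $\int|x|\,\eta(dx)<\infty$. For $\eta\in\mathcal M$: $P_\eta(k)=\int(k-x)^+\eta(dx)$, $C_\eta(k)=\int(x-k)^+\eta(dx)$. For $\eta,\chi\in\mathcal M$ of equal mass, $\Pi(\eta,\chi)$ is the set of measures on $\mathbb R^2$ with first marginal $\eta$ and second marginal $\chi$; $\pi(dx,dy)=\pi_x(dy)\eta(dx)$ denotes disintegration with $\pi_x$ probability measures. $\Pi_{Sub}(\eta,\chi)$ (resp. $\Pi_{Sup}(\eta,\chi)$) is the set of $\pi\in\Pi(\eta,\chi)$ with $\int y\,\pi_x(dy)\ge x$ (resp. $\le x$) for $\eta$-a.e. $x$. For $h$ as in the claim, $$V_h(\eta,\chi)=\inf_{\pi\in\Pi(\eta,\chi)}\int_{\mathbb R}h\Big(x-\int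 y\,\pi_x(dy)\Big)\eta(dx).$$ Fix $\mu,\nu\in\mathcal M$ of equal mass. Let $p_{\mu,\nu}=\sup_k\{P_\mu(k)-P_\nu(k)\}$, $c_{\mu,\nu}=\sup_k\{C_\mu(k)-C_\nu(k)\}$. If both are $>0$, put $\tilde P=P_\nu+p_{\mu,\nu}$, $$x^-=\inf\{k:\tilde P(k)=P_\mu(k)\},\qquad x^+=\sup\{k:\tilde P(k)=P_\mu(k)\}$$ (real numbers with $x^-\le x^+$), $\Delta^-=P_\mu'(x^--)$ (left derivative), $\Delta^+=P_\mu'(x^++)$ (right derivative), and $$\eta^-=\mu|_{(-\infty,x^-)},\quad \eta^+=\mu|_{(x^+,\infty)},$$ $$\chi^-=\nu|_{(-\infty,x^-)}+\big(\Delta^--\tilde P'(x^--)\big)\delta_{x^-},\quad \chi^+=\nu|_{(x^+,\infty)}+\big(\tilde P'(x^++)-\Delta^+\big)\delta_{x^+}.$$ Then $\chi^\pm(\mathbb R)=\eta^\pm(\mathbb R)$. *)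

theory Defs
  imports "HOL-Probability.Probability"
begin

definition finite_first_moment :: "real measure set" where
  "finite_first_moment =
     {\<eta>. sets \<eta> = sets borel \<and> finite_measure \<eta> \<and> integrable \<eta> (\<lambda>x. x)}"

definition put_pot :: "real measure \<Rightarrow> real \<Rightarrow> real" where
  "put_pot \<eta> k = (\<integral>x. max (k - x) 0 \<partial>\<eta>)"

definition call_pot :: "real measure \<Rightarrow> real \<Rightarrow> real" where
  "call_pot \<eta> k = (\<integral>x. max (x - k) 0 \<partial>\<eta>)"

definition couplings :: "real measure \<Rightarrow> real measure \<Rightarrow> (real \<times> real) measure set" where
  "couplings \<eta> \<theta> = {\<pi>. sets \<pi> = sets borel \<and> distr \<pi> borel fst = \<eta> \<and> distr \<pi> borel snd = \<theta>}"

text \<open>The versions \<open>x \<mapsto> \<pi>\<^sub>x\<close> of the disintegration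
  \<open>\<pi>(dx, dy) = \<pi>\<^sub>x(dy) \<eta>(dx)\<close>. For a finite Borel measure \<open>\<pi>\<close> with first marginal
  \<open>\<eta>\<close> such a kernel exists and is unique up to an \<open>\<eta>\<close>-null set.\<close>

definition disintegrations ::
    "real measure \<Rightarrow> (real \<times> real) measure \<Rightarrow> (real \<Rightarrow> real measure) set" where
  "disintegrations \<eta> \<pi> =
     {K \<in> borel \<rightarrow>\<^sub>M prob_algebra borel.
        \<forall>S \<in> sets borel. emeasure \<pi> S = (\<integral>\<^sup>+x. (\<integral>\<^sup>+y. indicator S (x, y) \<partial>K x) \<partial>\<eta>)}"

text \<open>When the second marginal of \<open>\<pi>\<close> has finite first moment, \<open>y\<close> is \<open>K x\<close>-integrable for
  \<open>\<eta>\<close>-almost every \<open>x\<close>.\<close>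

definition barycenter :: "(real \<Rightarrow> real measure) \<Rightarrow> real \<Rightarrow> real" where
  "barycenter K x = (\<integral>y. y \<partial>K x)"

definition couplings_sub :: "real measure \<Rightarrow> real measure \<Rightarrow> (real \<times> real) measure set" where
  "couplings_sub \<eta> \<theta> =
     {\<pi> \<in> couplings \<eta> \<theta>. \<exists>K \<in> disintegrations \<eta> \<pi>. AE x in \<eta>. barycenter K x \<ge> x}"

definition couplings_sup :: "real measure \<Rightarrow> real measure \<Rightarrow> (real \<times> real) measure set" where
  "couplings_sup \<eta> \<theta> =
     {\<pi> \<in> couplings \<eta> \<theta>. \<exists>K \<in> disintegrations \<eta> \<pi>. AE x in \<eta>. barycenter K x \<le> x}"

text \<open>The integral is the same for all versions of the disintegration; the infimum over \<open>K\<close>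
  only serves to pick this common value, which may be infinite.\<close>

definition weak_cost ::
    "(real \<Rightarrow> real) \<Rightarrow> real measure \<Rightarrow> (real \<times> real) measure \<Rightarrow> ennreal" where
  "weak_cost h \<eta> \<pi> =
     (INF K \<in> disintegrations \<eta> \<pi>. \<integral>\<^sup>+x. ennreal (h (x - barycenter K x)) \<partial>\<eta>)"

definition weak_transport ::
    "(real \<Rightarrow> real) \<Rightarrow> real measure \<Rightarrow> real measure \<Rightarrow> ennreal" where
  "weak_transport h \<eta> \<theta> = (INF \<pi> \<in> couplings \<eta> \<theta>. weak_cost h \<eta> \<pi>)"

text \<open>\<open>\<mu>|\<^sub>A\<close> as a measure on the whole line (unlike \<^const>\<open>restrict_space\<close>, whose space is
  \<open>A\<close>).\<close>

definition restr :: "real measure \<Rightarrow> real set \<Rightarrow> real measure" where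
  "restr \<mu> A = density \<mu> (indicator A)"

definition add_measure :: "'a measure \<Rightarrow> 'a measure \<Rightarrow> 'a measure" where
  "add_measure M N = measure_of (space M) (sets M) (\<lambda>A. emeasure M A + emeasure N A)"

lemma sets_add_measure [simp]: "sets (add_measure M N) = sets M"
  and space_add_measure [simp]: "space (add_measure M N) = space M"
  by (simp_all add: add_measure_def)

lemma emeasure_add_measure:
  assumes "sets N = sets M" "A \<in> sets M"
  shows "emeasure (add_measure M N) A = emeasure M A + emeasure N A"
  unfolding add_measure_def
proof (rule emeasure_measure_of_sigma)
  show "countably_additive (sets M) (\<lambda>A. emeasure M A + emeasure N A)"
  proof (rule countably_additiveI)
    fix F :: "nat \<Rightarrow> _"
    assume F: "range F \<subseteq> sets M" "disjoint_family F"
    have "(\<Sum>i. emeasure M (F i) + emeasure N (F i)) =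
        (\<Sum>i. emeasure M (F i)) + (\<Sum>i. emeasure N (F i))"
      by (rule suminf_add [symmetric]) auto
    also have "\<dots> = emeasure M (\<Union>i. F i) + emeasure N (\<Union>i. F i)"
      using F assms(1) by (simp add: suminf_emeasure)
    finally show "(\<Sum>i. emeasure M (F i) + emeasure N (F i)) =
        emeasure M (\<Union>i. F i) + emeasure N (\<Union>i. F i)" .
  qed
qed (use assms in \<open>auto simp: positive_def sets.sigma_algebra_axioms\<close>)

definition add_atom :: "real measure \<Rightarrow> real \<Rightarrow> real \<Rightarrow> real measure" where
  "add_atom M c a = add_measure M (scale_measure (ennreal c) (return borel a))"

definition left_deriv :: "(real \<Rightarrow> real) \<Rightarrow> real \<Rightarrow> real" where
  "left_deriv f x = vector_derivative f (at_left x)"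

definition right_deriv :: "(real \<Rightarrow> real) \<Rightarrow> real \<Rightarrow> real" where
  "right_deriv f x = vector_derivative f (at_right x)"

definition p_gap :: "real measure \<Rightarrow> real measure \<Rightarrow> real" where
  "p_gap \<mu> \<nu> = (SUP k. put_pot \<mu> k - put_pot \<nu> k)"

definition c_gap :: "real measure \<Rightarrow> real measure \<Rightarrow> real" where
  "c_gap \<mu> \<nu> = (SUP k. call_pot \<mu> k - call_pot \<nu> k)"

definition shifted_put :: "real measure \<Rightarrow> real measure \<Rightarrow> real \<Rightarrow> real" where
  "shifted_put \<mu> \<nu> k = put_pot \<nu> k + p_gap \<mu> \<nu>"

definition x_minus :: "real measure \<Rightarrow> real measure \<Rightarrow> real" where
  "x_minus \<mu> \<nu> = Inf {k. shifted_put \<mu> \<nu> k = put_pot \<mu> k}"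

definition x_plus :: "real measure \<Rightarrow> real measure \<Rightarrow> real" where
  "x_plus \<mu> \<nu> = Sup {k. shifted_put \<mu> \<nu> k = put_pot \<mu> k}"

definition Delta_minus :: "real measure \<Rightarrow> real measure \<Rightarrow> real" where
  "Delta_minus \<mu> \<nu> = left_deriv (put_pot \<mu>) (x_minus \<mu> \<nu>)"

definition Delta_plus :: "real measure \<Rightarrow> real measure \<Rightarrow> real" where
  "Delta_plus \<mu> \<nu> = right_deriv (put_pot \<mu>) (x_plus \<mu> \<nu>)"

definition eta_minus :: "real measure \<Rightarrow> real measure \<Rightarrow> real measure" where
  "eta_minus \<mu> \<nu> = restr \<mu> {..<x_minus \<mu> \<nu>}"

definition eta_plus :: "real measure \<Rightarrow> real measure \<Rightarrow> real measure" where
  "eta_plus \<mu> \<nu> = restr \<mu> {x_plus \<mu> \<nu><..}"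

text \<open>The weights of the atoms are nonnegative: \<open>shifted_put \<mu> \<nu> - put_pot \<mu>\<close> is nonnegative
  and vanishes at \<open>x_minus \<mu> \<nu>\<close> and \<open>x_plus \<mu> \<nu>\<close>. So the truncation in \<^const>\<open>ennreal\<close>
  has no effect.\<close>

definition chi_minus :: "real measure \<Rightarrow> real measure \<Rightarrow> real measure" where
  "chi_minus \<mu> \<nu> =
     add_atom (restr \<nu> {..<x_minus \<mu> \<nu>})
       (Delta_minus \<mu> \<nu> - left_deriv (shifted_put \<mu> \<nu>) (x_minus \<mu> \<nu>)) (x_minus \<mu> \<nu>)"

definition chi_plus :: "real measure \<Rightarrow> real measure \<Rightarrow> real measure" where
  "chi_plus \<mu> \<nu> =
     add_atom (restr \<nu> {x_plus \<mu> \<nu><..})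
       (right_deriv (shifted_put \<mu> \<nu>) (x_plus \<mu> \<nu>) - Delta_plus \<mu> \<nu>) (x_plus \<mu> \<nu>)"

end

theory Submission
  imports Defs
begin

text \<open>Write \<open>P\<^sub>\<mu>\<close> for the put potential of \<open>\<mu>\<close>. Since both gaps are positive, \<open>P\<^sub>\<mu> \<le> P\<^sub>\<nu> + p\<close> holds with
equality on a nonempty compact set, whose extreme points are \<open>x\<^sup>-\<close> and \<open>x\<^sup>+\<close>. The one-sided slopes
of a put potential are masses of half-lines, so the comparison of slopes at the points of
contact shows that \<open>\<chi>\<^sup>- + \<chi>\<^sup>+ \<le> \<nu>\<close>, and that \<open>\<chi>\<^sup>-\<close> and \<open>\<chi>\<^sup>+\<close> have the masses of \<open>\<eta>\<^sup>-\<close> and \<open>\<eta>\<^sup>+\<close>.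
The theorem is a cycle of three inequalities
\<open>V (\<mu>, \<nu>) \<le> V (\<eta>\<^sup>-, \<chi>\<^sup>-) + V (\<eta>\<^sup>+, \<chi>\<^sup>+) \<le> inf Sub + inf Sup \<le> V (\<mu>, \<nu>)\<close>; the one in the middle holds
because fewer couplings compete.

For the first (\<open>upper_bound\<close>), what is left of \<open>\<mu>\<close> and \<open>\<nu>\<close> between the points of contact is in convex
order, because \<open>P\<^sub>\<nu> + p - P\<^sub>\<mu>\<close> is nonnegative and vanishes at both of them. By Strassen's theorem
it is coupled by a martingale, at cost \<open>h 0 = 0\<close>, and this coupling is glued with couplings of the
outer parts.

For the last (\<open>lower_bound\<close>), let \<open>T x\<close> be the barycenter of \<open>\<pi>\<^sub>x\<close> for a coupling \<open>\<pi>\<close> of \<open>\<mu>\<close> and \<open>\<nu>\<close>. To the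
left of \<open>x\<^sup>-\<close> replace \<open>T x\<close> by \<open>T' x = max x (min (T x) c)\<close>. This lies between \<open>x\<close> and \<open>T x\<close>, or is
\<open>x\<close>, so it is no more expensive for a convex \<open>h \<ge> 0\<close> with \<open>h 0 = 0\<close>, and \<open>T' x \<ge> x\<close>. If the level \<open>c\<close> is
such that \<open>T'\<close> moves \<open>\<eta>\<^sup>-\<close> upwards by \<open>p\<close> in total, then the put potential of the law of \<open>T'\<close> is
below the one of \<open>\<nu>\<close> on both sides of \<open>c\<close>: on the left because it is below the one of the law of
\<open>T\<close>, on the right because it is \<open>P\<^sub>\<mu> - p\<close>. Equality holds at \<open>x\<^sup>-\<close>. So the law of \<open>T'\<close> precedes \<open>\<chi>\<^sup>-\<close> in
convex order (\<open>squeeze_level\<close>), and Strassen's theorem turns \<open>T'\<close> into the barycenters of a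
coupling of \<open>\<eta>\<^sup>-\<close> and \<open>\<chi>\<^sup>-\<close> (\<open>one_sided_kernel\<close>). The right half is the mirror image.

Strassen's theorem on the line (\<open>strassen_kernel\<close>) is obtained from an explicit coupling: the
monotone coupling, corrected by exchanging targets between mass that moves down and mass that
moves up (\<open>martingale_coupling_prob\<close>), and then disintegrated (\<open>disintegration_exists\<close>).\<close>

section \<open>Sums, restrictions and comparison of measures\<close>

text \<open>Over the set where \<open>g < f\<close> the integral of \<open>f - g\<close> is 0; it is the difference of the integrals since
the one of \<open>g\<close> is finite.\<close>

lemma AE_le_of_set_nn_integral_le:
  assumes [measurable]: "f \<in> borel_measurable M" "g \<in> borel_measurable M"
    and le: "\<And>A. A \<in> sets M \<Longrightarrow> (\<integral>\<^sup>+x. f x * indicator A x \<partial>M) \<le> (\<integral>\<^sup>+x. g x * indicator A x \<partial>M)"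
    and fin: "(\<integral>\<^sup>+x. g x \<partial>M) < \<infinity>"
  shows "AE x in M. f x \<le> (g x :: ennreal)"
proof -
  define A where "A = {x \<in> space M. g x < f x}"
  have [measurable]: "A \<in> sets M" unfolding A_def by measurable
  have gA: "(\<integral>\<^sup>+x. g x * indicator A x \<partial>M) \<noteq> \<infinity>"
    using fin nn_integral_mono[of M "\<lambda>x. g x * indicator A x" g]
    by (fastforce simp: indicator_def less_top[symmetric] top_unique split: if_splits)
  have "(\<integral>\<^sup>+x. f x * indicator A x - g x * indicator A x \<partial>M) =
      (\<integral>\<^sup>+x. f x * indicator A x \<partial>M) - (\<integral>\<^sup>+x. g x * indicator A x \<partial>M)"
    using gA by (intro nn_integral_diff) (auto simp: A_def indicator_def)
  also have "\<dots> = 0" using le[of A] gA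
    by (auto simp: diff_eq_0_iff_ennreal less_top[symmetric] top_unique)
  finally have "AE x in M. f x * indicator A x - g x * indicator A x = 0"
    by (subst (asm) nn_integral_0_iff_AE) auto
  then show ?thesis using AE_space
  proof eventually_elim
    case (elim x)
    then show ?case
      by (cases "x \<in> A") (auto simp: diff_eq_0_iff_ennreal A_def indicator_def)
  qed
qed

lemma nn_integral_add_measure:
  assumes sets_eq [simp, measurable_cong]: "sets N = sets M" and f: "f \<in> borel_measurable M"
  shows "(\<integral>\<^sup>+x. f x \<partial>add_measure M N) = (\<integral>\<^sup>+x. f x \<partial>M) + (\<integral>\<^sup>+x. f x \<partial>N)"
proof -
  have [simp]: "space N = space M" by (rule sets_eq_imp_space_eq) simp
  have meas: "g \<in> borel_measurable N" "g \<in> borel_measurable (add_measure M N)"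
    if "g \<in> borel_measurable M" for g :: "'a \<Rightarrow> ennreal"
    using that by (simp_all cong: measurable_cong_sets)
  from f show ?thesis
  proof induct
    case (cong f g)
    have "integral\<^sup>N L f = integral\<^sup>N L g" if "space L = space M" for L
      using cong(3) that by (intro nn_integral_cong) simp
    with cong(4) show ?case by simp
  next
    case (set A)
    then show ?case by (simp add: emeasure_add_measure)
  next
    case (mult u c)
    then show ?case using meas[OF mult(2)] by (simp add: nn_integral_cmult distrib_left)
  next
    case (add u v)
    then show ?case using meas[OF add(1)] meas[OF add(4)] by (simp add: nn_integral_add ac_simps)
  next
    case (seq U)
    have "(SUP i. (\<integral>\<^sup>+x. U i x \<partial>M) + (\<integral>\<^sup>+x. U i x \<partial>N)) =
        (SUP i. \<integral>\<^sup>+x. U i x \<partial>M) + (SUP i. \<integral>\<^sup>+x. U i x \<partial>N)"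
      using seq(4) by (intro ennreal_SUP_add) (auto simp: incseq_def le_fun_def intro!: nn_integral_mono)
    then show ?case
      using seq meas[OF seq(1)] by (simp add: nn_integral_monotone_convergence_SUP image_comp)
  qed
qed

lemma
  fixes f :: "'a \<Rightarrow> real"
  assumes sets_eq [simp, measurable_cong]: "sets N = sets M"
    and "integrable M f" "integrable N f"
  shows integrable_add_measure: "integrable (add_measure M N) f"
    and integral_add_measure: "(\<integral>x. f x \<partial>add_measure M N) = (\<integral>x. f x \<partial>M) + (\<integral>x. f x \<partial>N)"
proof -
  have [measurable_cong]: "sets (add_measure M N) = sets M" by simp
  have [measurable]: "f \<in> borel_measurable M" using assms by measurable
  have *: "(\<integral>\<^sup>+x. g x \<partial>add_measure M N) = (\<integral>\<^sup>+x. g x \<partial>M) + (\<integral>\<^sup>+x. g x \<partial>N)"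
    if "g \<in> borel_measurable M" for g
    using that by (intro nn_integral_add_measure) auto
  show int: "integrable (add_measure M N) f"
    using assms(2,3) unfolding integrable_iff_bounded by (subst *) auto
  have fin: "(\<integral>\<^sup>+x. ennreal (f x) \<partial>L) < \<top>" "(\<integral>\<^sup>+x. ennreal (- f x) \<partial>L) < \<top>" if "integrable L f" for L
    using that[THEN integrableD(2)] that[THEN integrableD(3)] by (auto simp: less_top)
  show "(\<integral>x. f x \<partial>add_measure M N) = (\<integral>x. f x \<partial>M) + (\<integral>x. f x \<partial>N)"
    using assms(2,3) int fin[OF assms(2)] fin[OF assms(3)]
    by (simp add: real_lebesgue_integral_def * enn2real_plus)
qed

lemma finite_first_momentD:
  assumes "\<mu> \<in> finite_first_moment"
  shows "sets \<mu> = sets borel" "space \<mu> = UNIV" "finite_measure \<mu>" "integrable \<mu> (\<lambda>x. x)"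
    "finite_borel_measure \<mu>"
  using assms sets_eq_imp_space_eq[of \<mu> borel]
  by (auto simp: finite_first_moment_def finite_borel_measure_def finite_borel_measure_axioms_def)

text \<open>Every piece cut out of \<open>\<mu>\<close> or \<open>\<nu>\<close> is dominated by the measure it is cut from; this puts all
of them into the class at once.\<close>

lemma finite_first_moment_mono:
  assumes mu: "\<mu> \<in> finite_first_moment" and sets_N: "sets N = sets borel"
    and le: "\<And>B. B \<in> sets borel \<Longrightarrow> emeasure N B \<le> emeasure \<mu> B"
  shows "N \<in> finite_first_moment"
proof -
  note m = finite_first_momentD[OF mu]
  have sp: "space N = UNIV" using sets_eq_imp_space_eq[OF sets_N] by simp
  have "finite_measure N"
    using le[of UNIV] finite_measure.emeasure_finite[OF m(3), of UNIV] sp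
    by (intro finite_measureI) (auto simp: top_unique)
  moreover have "integrable N (\<lambda>x. x)"
  proof -
    have "(\<integral>\<^sup>+x. ennreal \<bar>x\<bar> \<partial>N) \<le> (\<integral>\<^sup>+x. ennreal \<bar>x\<bar> \<partial>\<mu>)"
      using le m(1) sets_N by (intro nn_integral_mono_measure) (auto simp: le_measure)
    also have "\<dots> < \<infinity>" using m(4) by (simp add: integrable_iff_bounded)
    finally show ?thesis
      using sets_N by (simp add: integrable_iff_bounded cong: measurable_cong_sets)
  qed
  ultimately show ?thesis using sets_N unfolding finite_first_moment_def by blast
qed

lemma AE_le_of_emeasure_zero:
  fixes z :: real
  assumes "sets N = sets borel"
  shows "emeasure N {z<..} = 0 \<Longrightarrow> AE x in N. x \<le> z" "emeasure N {..<z} = 0 \<Longrightarrow> AE x in N. z \<le> x"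
  using AE_not_in[of "{z<..}" N] AE_not_in[of "{..<z}" N] assms by (auto simp: null_sets_def not_less)

lemma sets_restr [simp]: "sets (restr \<mu> A) = sets \<mu>" by (simp add: restr_def)

context
  fixes \<mu> :: "real measure"
  assumes sets_mu: "sets \<mu> = sets borel"
begin

lemma emeasure_restr: "A \<in> sets borel \<Longrightarrow> B \<in> sets borel \<Longrightarrow> emeasure (restr \<mu> A) B = emeasure \<mu> (A \<inter> B)"
proof -
  assume "A \<in> sets borel" "B \<in> sets borel"
  then have "A \<in> sets \<mu>" "B \<in> sets \<mu>" using sets_mu by simp_all
  then show ?thesis by (simp add: restr_def emeasure_density indicator_inter_arith[symmetric])
qed

lemma nn_integral_restr:
  assumes "A \<in> sets borel" "f \<in> borel_measurable borel"
  shows "(\<integral>\<^sup>+x. f x \<partial>restr \<mu> A) = (\<integral>\<^sup>+x. f x * indicator A x \<partial>\<mu>)"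
proof -
  have "f \<in> borel_measurable \<mu>" "A \<in> sets \<mu>" using assms sets_mu by (simp_all cong: measurable_cong_sets)
  then show ?thesis unfolding restr_def by (subst nn_integral_density) (auto simp: mult.commute)
qed

lemma AE_restr: "A \<in> sets borel \<Longrightarrow> (AE x in restr \<mu> A. P x) \<longleftrightarrow> (AE x in \<mu>. x \<in> A \<longrightarrow> P x)"
proof -
  assume "A \<in> sets borel"
  then have "A \<in> sets \<mu>" using sets_mu by simp
  then show ?thesis unfolding restr_def by (subst AE_density) (auto simp: indicator_def)
qed

end

lemma emeasure_Un3:
  assumes "A \<in> sets M" "B \<in> sets M" "C \<in> sets M" "A \<inter> B = {}" "(A \<union> B) \<inter> C = {}"
  shows "emeasure M A + emeasure M B + emeasure M C = emeasure M (A \<union> B \<union> C)"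
  using assms by (simp add: plus_emeasure)

lemma emeasure_add_atom:
  assumes "sets M = sets borel" "B \<in> sets borel"
  shows "emeasure (add_atom M w z) B = emeasure M B + ennreal w * indicator B z"
  using assms unfolding add_atom_def by (subst emeasure_add_measure) simp_all

lemma
  fixes f :: "real \<Rightarrow> real"
  assumes N: "sets N = sets borel" and A: "A \<in> sets borel" and f: "f \<in> borel_measurable borel" "integrable N f"
  shows integrable_restr: "integrable (restr N A) f"
    and integral_restr_le: "(\<And>x. 0 \<le> f x) \<Longrightarrow> (\<integral>x. f x \<partial>restr N A) \<le> (\<integral>x. f x \<partial>N)"
proof -
  have le: "(\<integral>\<^sup>+x. ennreal (g x) \<partial>restr N A) \<le> (\<integral>\<^sup>+x. ennreal (g x) \<partial>N)" if "g \<in> borel_measurable borel" for g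
    using that A by (subst nn_integral_restr[OF N]) (auto intro!: nn_integral_mono simp: indicator_def)
  have m: "f \<in> borel_measurable (restr N A)" using f(1) N by (simp cong: measurable_cong_sets)
  have "(\<integral>\<^sup>+x. ennreal \<bar>f x\<bar> \<partial>restr N A) < \<infinity>"
    using f(2) le[of "\<lambda>x. \<bar>f x\<bar>"] f(1) by (auto simp: integrable_iff_bounded intro: le_less_trans)
  then show int: "integrable (restr N A) f" using m by (simp add: integrable_iff_bounded)
  assume nn: "\<And>x. 0 \<le> f x"
  have "ennreal (\<integral>x. f x \<partial>restr N A) = (\<integral>\<^sup>+x. ennreal (f x) \<partial>restr N A)"
    using int nn by (intro nn_integral_eq_integral[symmetric]) auto
  also have "\<dots> \<le> (\<integral>\<^sup>+x. ennreal (f x) \<partial>N)" by (rule le[OF f(1)])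
  also have "\<dots> = ennreal (\<integral>x. f x \<partial>N)" using f(2) nn by (intro nn_integral_eq_integral) auto
  finally show "(\<integral>x. f x \<partial>restr N A) \<le> (\<integral>x. f x \<partial>N)"
    using nn by (simp add: ennreal_le_iff Bochner_Integration.integral_nonneg)
qed

section \<open>Uniform levels and quantile functions\<close>

text \<open>A measure on the whole line with mass on the open unit interval: unlike
\<^const>\<open>restrict_space\<close>, it has the Borel sets of \<open>\<real>\<close>, so that Borel functions on \<open>\<real>\<close> are
random variables. The interval is open since a quantile function can be infinite at the
levels 0 and 1.\<close>

definition unif :: "real measure" where
  "unif = density lborel (indicator {0<..<1})"

lemma sets_unif [simp, measurable_cong]: "sets unif = sets borel"
  and space_unif [simp]: "space unif = UNIV"
  by (simp_all add: unif_def)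

lemma emeasure_unif: "B \<in> sets borel \<Longrightarrow> emeasure unif B = emeasure lborel ({0<..<1} \<inter> B)"
  by (simp add: unif_def emeasure_density indicator_inter_arith[symmetric])

lemma prob_space_unif: "prob_space unif"
  by (rule prob_spaceI) (simp add: emeasure_unif)

lemma AE_unif: "AE s in unif. 0 < s \<and> s < 1"
  unfolding unif_def by (subst AE_density) (auto simp: indicator_def)

lemma emeasure_unif_Iic:
  assumes "0 \<le> c" "c \<le> 1"
  shows "emeasure unif {..c} = ennreal c"
proof -
  have "emeasure unif {..c} = emeasure lborel ({0<..<1} \<inter> {..c})" by (simp add: emeasure_unif)
  also have "\<dots> = emeasure lborel {0<..c}"
  proof (rule emeasure_eq_AE)
    show "AE x in lborel. (x \<in> {0<..<1} \<inter> {..c}) = (x \<in> {0<..c})"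
      using AE_lborel_singleton[of "1::real"] by eventually_elim (use assms in auto)
  qed auto
  finally show ?thesis using assms by simp
qed

lemma emeasure_unif_Iic_ennreal:
  assumes "c \<le> 1"
  shows "emeasure unif {s. ennreal s \<le> c} = c"
proof -
  obtain r where r: "c = ennreal r" "0 \<le> r" "r \<le> 1"
    using assms by (cases c) (auto simp: top_unique)
  have "{s. ennreal s \<le> c} = {..r}" using r by (auto simp: ennreal_le_iff)
  with r show ?thesis by (simp add: emeasure_unif_Iic)
qed

text \<open>The Galois connection between quantiles and levels holds for levels strictly between 0 and 1,
and characterizes the law of the quantile function.\<close>

lemma quantile_function:
  assumes "real_distribution M"
  obtains Q where "Q \<in> borel_measurable borel" "distr unif borel Q = M"
    "\<And>w y. 0 < w \<Longrightarrow> w < 1 \<Longrightarrow> Q w \<le> y \<longleftrightarrow> w \<le> cdf M y"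
proof -
  interpret cdf_distribution M unfolding cdf_distribution_def by (rule assms)
  define Q where "Q = (\<lambda>w. indicator {0<..<1} w *\<^sub>R I w)"
  have [measurable]: "Q \<in> borel_measurable borel"
    using measurable_CI unfolding Q_def by (subst borel_measurable_restrict_space_iff[symmetric]) auto
  have iff: "Q w \<le> y \<longleftrightarrow> w \<le> cdf M y" if "0 < w" "w < 1" for w y
    using pseudoinverse[OF that, of y] that by (simp add: Q_def)
  interpret U: prob_space unif by (rule prob_space_unif)
  have "distr unif borel Q = M"
  proof (rule cdf_unique)
    show "real_distribution (distr unif borel Q)" by (rule U.real_distribution_distr) simp
    show "cdf (distr unif borel Q) = cdf M"
    proof
      fix y
      have "emeasure unif {w. Q w \<le> y} = emeasure unif {..cdf M y}"
        by (rule emeasure_eq_AE) (use AE_unif in \<open>eventually_elim, simp add: iff\<close>, measurable)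
      then have "emeasure unif {w. Q w \<le> y} = ennreal (cdf M y)"
        by (simp add: emeasure_unif_Iic cdf_nonneg cdf_bounded_prob)
      then show "cdf (distr unif borel Q) y = cdf M y"
        by (simp add: cdf_def measure_distr vimage_def) (simp add: measure_def)
    qed
  qed (rule assms)
  then show thesis using iff by (intro that[of Q]) auto
qed

text \<open>If a mean-zero \<open>f\<close> has nonnegative partial integrals, its positive part sits to the left of
its negative part: the distribution function of the measure with density proportional to
\<open>max (f t) 0\<close> dominates the one for \<open>max (- f t) 0\<close>, so the quantile functions \<open>u\<close> and \<open>v\<close> of the two
measures are ordered. They pair each unit of the positive part with a unit of the negative
part further to the right.\<close>

lemma ordered_pairing:
  fixes f :: "real \<Rightarrow> real"
  assumes f: "integrable unif f" "(\<integral>t. f t \<partial>unif) = 0"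
    and partial: "\<And>u. 0 < u \<Longrightarrow> u < 1 \<Longrightarrow> 0 \<le> (\<integral>t. f t * indicator {..u} t \<partial>unif)"
    and M: "M = (\<integral>t. max (f t) 0 \<partial>unif)" "0 < M"
  obtains u v :: "real \<Rightarrow> real" where "u \<in> borel_measurable borel" "v \<in> borel_measurable borel"
    "distr unif borel u = density unif (\<lambda>t. ennreal (max (f t) 0 / M))"
    "distr unif borel v = density unif (\<lambda>t. ennreal (max (- f t) 0 / M))"
    "AE w in unif. u w \<le> v w"
proof -
  have [measurable]: "f \<in> borel_measurable borel" using f(1) by measurable
  have int: "integrable unif (\<lambda>t. max (f t) 0)" "integrable unif (\<lambda>t. max (- f t) 0)"
    using f(1) by auto
  have "(\<integral>t. max (- f t) 0 \<partial>unif) = (\<integral>t. max (f t) 0 - f t \<partial>unif)"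
    by (intro Bochner_Integration.integral_cong) auto
  also have "\<dots> = M" using int f by (simp add: M(1))
  finally have M': "(\<integral>t. max (- f t) 0 \<partial>unif) = M" .
  have em: "emeasure (density unif (\<lambda>t. ennreal (g t / M))) A = ennreal ((\<integral>t. g t * indicator A t \<partial>unif) / M)"
    if "integrable unif g" "\<And>t. 0 \<le> g t" and [measurable]: "A \<in> sets borel" for g A
  proof -
    have [measurable]: "g \<in> borel_measurable borel" using that(1) by measurable
    have "integrable unif (\<lambda>t. g t * indicator A t)"
      using that by (intro integrable_real_mult_indicator) auto
    then have "integrable unif (\<lambda>t. g t * indicator A t / M)" by simp
    then have "(\<integral>\<^sup>+t. ennreal (g t * indicator A t / M) \<partial>unif) = ennreal (\<integral>t. g t * indicator A t / M \<partial>unif)"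
      using that M(2) by (intro nn_integral_eq_integral) auto
    moreover have "(\<integral>\<^sup>+t. ennreal (g t * indicator A t / M) \<partial>unif) = (\<integral>\<^sup>+t. ennreal (g t / M) * indicator A t \<partial>unif)"
      by (intro nn_integral_cong) (auto simp: indicator_def)
    ultimately show ?thesis by (simp add: emeasure_density)
  qed
  define \<alpha> where "\<alpha> = density unif (\<lambda>t. ennreal (max (f t) 0 / M))"
  define \<beta> where "\<beta> = density unif (\<lambda>t. ennreal (max (- f t) 0 / M))"
  have "real_distribution \<alpha>" "real_distribution \<beta>"
    unfolding real_distribution_def real_distribution_axioms_def
    using em[OF int(1), of UNIV] em[OF int(2), of UNIV] M M'
    by (auto intro!: prob_spaceI simp: \<alpha>_def \<beta>_def)
  obtain u where u: "u \<in> borel_measurable borel" "distr unif borel u = \<alpha>"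
    "\<And>w y. 0 < w \<Longrightarrow> w < 1 \<Longrightarrow> u w \<le> y \<longleftrightarrow> w \<le> cdf \<alpha> y"
    using quantile_function[OF \<open>real_distribution \<alpha>\<close>] by blast
  obtain v where v: "v \<in> borel_measurable borel" "distr unif borel v = \<beta>"
    "\<And>w y. 0 < w \<Longrightarrow> w < 1 \<Longrightarrow> v w \<le> y \<longleftrightarrow> w \<le> cdf \<beta> y"
    using quantile_function[OF \<open>real_distribution \<beta>\<close>] by blast
  \<comment> \<open>outside the unit interval the partial integrals are 0\<close>
  have partial': "0 \<le> (\<integral>t. f t * indicator {..y} t \<partial>unif)" for y
  proof -
    consider "y \<le> 0" | "0 < y" "y < 1" | "1 \<le> y" by linarith
    then show ?thesis
    proof cases
      case 1
      have "(\<integral>t. f t * indicator {..y} t \<partial>unif) = (\<integral>t. 0 \<partial>unif)"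
      proof (rule integral_cong_AE)
        show "AE t in unif. f t * indicator {..y} t = 0"
          using AE_unif by eventually_elim (use 1 in \<open>auto simp: indicator_def\<close>)
      qed measurable
      then show ?thesis by simp
    next
      case 3
      have "(\<integral>t. f t * indicator {..y} t \<partial>unif) = (\<integral>t. f t \<partial>unif)"
      proof (rule integral_cong_AE)
        show "AE t in unif. f t * indicator {..y} t = f t"
          using AE_unif by eventually_elim (use 3 in \<open>auto simp: indicator_def\<close>)
      qed measurable
      then show ?thesis by (simp add: f)
    qed (rule partial)
  qed
  have cdf_le: "cdf \<beta> y \<le> cdf \<alpha> y" for y
  proof -
    have "(\<integral>t. max (f t) 0 * indicator {..y} t \<partial>unif) - (\<integral>t. max (- f t) 0 * indicator {..y} t \<partial>unif)
        = (\<integral>t. max (f t) 0 * indicator {..y} t - max (- f t) 0 * indicator {..y} t \<partial>unif)"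
      using int by (intro Bochner_Integration.integral_diff[symmetric] integrable_real_mult_indicator) auto
    also have "\<dots> = (\<integral>t. f t * indicator {..y} t \<partial>unif)"
      by (intro Bochner_Integration.integral_cong) (auto simp: indicator_def)
    finally have "(\<integral>t. max (- f t) 0 * indicator {..y} t \<partial>unif) \<le> (\<integral>t. max (f t) 0 * indicator {..y} t \<partial>unif)"
      using partial'[of y] by simp
    moreover have "0 \<le> (\<integral>t. max (- f t) 0 * indicator {..y} t \<partial>unif)"
      by (intro Bochner_Integration.integral_nonneg) auto
    ultimately show ?thesis
      using em[OF int(1), of "{..y}"] em[OF int(2), of "{..y}"] M(2)
      by (simp add: cdf_def measure_def \<alpha>_def \<beta>_def divide_right_mono)
  qed
  have "AE w in unif. u w \<le> v w"
    using AE_unif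
  proof eventually_elim
    case (elim w)
    have "w \<le> cdf \<beta> (v w)" using v(3)[of w "v w"] elim by simp
    also have "\<dots> \<le> cdf \<alpha> (v w)" by (rule cdf_le)
    finally show ?case using u(3)[of w "v w"] elim by simp
  qed
  with u v show thesis unfolding \<alpha>_def \<beta>_def by (intro that) auto
qed

section \<open>Kernels and disintegration\<close>

lemma sets_borel_Times [measurable (raw)]:
  "A \<in> sets borel \<Longrightarrow> B \<in> sets borel \<Longrightarrow> A \<times> B \<in> sets (borel :: (real \<times> real) measure)"
  by (simp add: borel_prod[symmetric])

lemma emeasure_distr_density_indicator:
  assumes [measurable]: "f \<in> M \<rightarrow>\<^sub>M N" "A \<in> sets M" "B \<in> sets N"
  shows "emeasure (distr (density M (indicator A)) N f) B = emeasure M (A \<inter> (f -` B \<inter> space M))"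
  by (simp add: emeasure_distr emeasure_density indicator_inter_arith[symmetric])

text \<open>For fixed \<open>A\<close> the two measures \<open>B \<mapsto> M (A \<times> B)\<close> and \<open>B \<mapsto> N (A \<times> B)\<close> agree on half-lines, hence on
Borel sets; so \<open>M\<close> and \<open>N\<close> agree on rectangles.\<close>

lemma finite_measure_pair_eqI:
  fixes M N :: "(real \<times> real) measure"
  assumes [simp]: "sets M = sets borel" "sets N = sets borel" and "finite_measure M"
    and eq: "\<And>A y. A \<in> sets borel \<Longrightarrow> emeasure M (A \<times> {..<y}) = emeasure N (A \<times> {..<y})"
  shows "M = N"
proof -
  interpret M: finite_measure M by fact
  have spM: "space M = UNIV" "space N = UNIV" using assms(1,2)[THEN sets_eq_imp_space_eq] by auto
  have rect: "emeasure M (A \<times> B) = emeasure N (A \<times> B)"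
    if [measurable]: "A \<in> sets borel" "B \<in> sets borel" for A B :: "real set"
  proof -
    define M' where "M' = distr (density M (indicator (A \<times> UNIV))) borel snd"
    define N' where "N' = distr (density N (indicator (A \<times> UNIV))) borel snd"
    have [measurable_cong]: "sets M = sets (borel \<Otimes>\<^sub>M borel)" "sets N = sets (borel \<Otimes>\<^sub>M borel)"
      using assms(1,2) unfolding borel_prod by simp_all
    have M': "emeasure M' B = emeasure M (A \<times> B)" if [measurable]: "B \<in> sets borel" for B
      unfolding M'_def by (subst emeasure_distr_density_indicator)
        (auto simp: spM intro!: arg_cong[where f="emeasure M"])
    have N': "emeasure N' B = emeasure N (A \<times> B)" if [measurable]: "B \<in> sets borel" for B
      unfolding N'_def by (subst emeasure_distr_density_indicator)
        (auto simp: spM intro!: arg_cong[where f="emeasure N"])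
    have "M' = N'"
    proof (rule measure_eqI_generator_eq[where E="range lessThan" and \<Omega>=UNIV and A="\<lambda>i::nat. {..<real i}"])
      show "Int_stable (range (lessThan :: real \<Rightarrow> _))"
      proof (clarsimp simp: Int_stable_def)
        show "{..<a} \<inter> {..<b} \<in> range lessThan" for a b :: real
          by (rule image_eqI[of _ _ "min a b"]) auto
      qed
      have "sets borel = sigma_sets UNIV (range (lessThan :: real \<Rightarrow> _))"
        by (subst borel_Iio) simp
      then show "sets M' = sigma_sets UNIV (range lessThan)" "sets N' = sigma_sets UNIV (range lessThan)"
        by (simp_all add: M'_def N'_def)
      show "(\<Union>i. {..<real i}) = UNIV" using reals_Archimedean2 by auto
      show "emeasure M' X = emeasure N' X" if "X \<in> range lessThan" for X
        using that eq[of A] by (auto simp: M' N')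
    qed (auto simp: M')
    then show ?thesis using M'[OF that(2)] N'[OF that(2)] by simp
  qed
  show ?thesis
  proof (rule measure_eqI_generator_eq[where E="{a \<times> b |a b. a \<in> sets borel \<and> b \<in> sets borel}"
        and \<Omega>=UNIV and A="\<lambda>i::nat. UNIV"])
    show "Int_stable {a \<times> b |a b. a \<in> sets (borel::real measure) \<and> b \<in> sets (borel::real measure)}"
      by (rule Int_stable_pair_measure_generator)
    have "sets (borel :: (real \<times> real) measure) = sigma_sets UNIV {a \<times> b |a b. a \<in> sets borel \<and> b \<in> sets borel}"
      by (subst borel_prod[symmetric]) (simp add: sets_pair_measure)
    then show "sets M = sigma_sets UNIV {a \<times> b |a b. a \<in> sets borel \<and> b \<in> sets borel}"
      "sets N = sigma_sets UNIV {a \<times> b |a b. a \<in> sets borel \<and> b \<in> sets borel}" by simp_all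
    show "range (\<lambda>i::nat. UNIV) \<subseteq> {a \<times> b |a b. a \<in> sets (borel::real measure) \<and> b \<in> sets (borel::real measure)}"
      by (auto intro!: exI[of _ UNIV])
  qed (auto simp: rect)
qed

lemma strict_approx_rat:
  obtains r :: "nat \<Rightarrow> rat" where "incseq r" "\<And>n. of_rat (r n) < (y::real)"
    "\<And>z. z < y \<Longrightarrow> \<exists>n. z \<le> of_rat (r n)"
proof -
  obtain u :: "nat \<Rightarrow> real" where u: "\<And>n. u n < y" "incseq u" "u \<longlonglongrightarrow> y" "\<And>n. u n < u (Suc n)"
  proof -
    show thesis
      using LIMSEQ_inverse_real_of_nat_add_minus[of y]
      by (intro that[of "\<lambda>n. y + - inverse (real (Suc n))"])
        (auto intro!: incseq_SucI simp: field_simps)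
  qed
  have "\<exists>r. u n < of_rat r \<and> of_rat r < u (Suc n)" for n
    by (rule of_rat_dense[OF u(4)])
  then obtain r where r: "\<And>n. u n < of_rat (r n)" "\<And>n. of_rat (r n) < u (Suc n)" by metis
  show thesis
  proof
    show "incseq r"
      by (rule incseq_SucI) (metis r less_trans less_imp_le of_rat_less)
    show "of_rat (r n) < y" for n using r(2)[of n] u(1)[of "Suc n"] by simp
    fix z assume "z < y"
    then have "eventually (\<lambda>n. z < u n) sequentially" using u(3) by (rule order_tendstoD(1)[rotated])
    then obtain n where "z < u n" by (auto simp: eventually_sequentially)
    then show "\<exists>n. z \<le> of_rat (r n)" using r(1)[of n] by (intro exI[of _ n]) simp
  qed
qed

text \<open>The measure \<open>\<eta>(dx) K x (dy)\<close>.\<close>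

definition kernel_product :: "real measure \<Rightarrow> (real \<Rightarrow> real measure) \<Rightarrow> (real \<times> real) measure" where
  "kernel_product \<eta> K = \<eta> \<bind> (\<lambda>x. distr (K x) borel (\<lambda>y. (x, y)))"

context
  fixes \<eta> :: "real measure" and K :: "real \<Rightarrow> real measure"
  assumes K: "K \<in> borel \<rightarrow>\<^sub>M prob_algebra borel" and sets_eta [simp, measurable_cong]: "sets \<eta> = sets borel"
begin

lemma kernel_product_measurable: "(\<lambda>x. distr (K x) borel (\<lambda>y. (x, y))) \<in> \<eta> \<rightarrow>\<^sub>M subprob_algebra borel"
  using measurable_prob_algebraD[OF K]
  by (intro measurable_distr2[where M=borel]) (auto simp: borel_prod[symmetric])

lemma sets_kernel_product: "sets (kernel_product \<eta> K) = sets borel"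
  unfolding kernel_product_def using kernel_product_measurable sets_eta[THEN sets_eq_imp_space_eq]
  by (subst sets_bind[where N=borel]) (auto dest: subprob_measurableD)

lemma emeasure_kernel_product:
  assumes "S \<in> sets borel"
  shows "emeasure (kernel_product \<eta> K) S = (\<integral>\<^sup>+x. (\<integral>\<^sup>+y. indicator S (x, y) \<partial>K x) \<partial>\<eta>)"
proof -
  have [measurable]: "S \<in> sets (borel \<Otimes>\<^sub>M borel)" unfolding borel_prod by fact
  have "emeasure (kernel_product \<eta> K) S = (\<integral>\<^sup>+x. emeasure (distr (K x) borel (\<lambda>y. (x, y))) S \<partial>\<eta>)"
    unfolding kernel_product_def
    using kernel_product_measurable sets_eta[THEN sets_eq_imp_space_eq] assms by (subst emeasure_bind[where N=borel]) auto
  also have "\<dots> = (\<integral>\<^sup>+x. (\<integral>\<^sup>+y. indicator S (x, y) \<partial>K x) \<partial>\<eta>)"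
  proof (rule nn_integral_cong)
    fix x
    have [measurable_cong, simp]: "sets (K x) = sets borel"
      using measurable_space[OF K, of x] by (simp add: space_prob_algebra)
    have [simp]: "space (K x) = UNIV" using sets_eq_imp_space_eq[of "K x" borel] by simp
    have "emeasure (distr (K x) borel (\<lambda>y. (x, y))) S = emeasure (K x) ((\<lambda>y. (x, y)) -` S \<inter> space (K x))"
      using assms by (intro emeasure_distr) (auto simp: borel_prod[symmetric])
    also have "\<dots> = (\<integral>\<^sup>+y. indicator ((\<lambda>y. (x, y)) -` S \<inter> space (K x)) y \<partial>K x)"
      by (rule nn_integral_indicator[symmetric]) measurable
    finally show "emeasure (distr (K x) borel (\<lambda>y. (x, y))) S = (\<integral>\<^sup>+y. indicator S (x, y) \<partial>K x)"
      by (simp add: indicator_def)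
  qed
  finally show ?thesis .
qed

end

text \<open>For rational \<open>r\<close> let \<open>G r\<close> be the density of \<open>A \<mapsto> \<pi> (A \<times> {..r})\<close> with respect to the first marginal.
For almost every \<open>x\<close> the function \<open>r \<mapsto> G r x\<close> is monotone with limits 0 and 1, that is, a
distribution function restricted to the rationals. The kernel is the law of its quantile
function at a uniform level, which produces the measure together with its measurability in
\<open>x\<close>. On \<open>A \<times> {..<y}\<close> the kernel integrates to the limit of \<open>\<pi> (A \<times> {..r})\<close> as \<open>r\<close> increases to \<open>y\<close>.\<close>

theorem disintegration_exists:
  fixes \<pi> :: "(real \<times> real) measure"
  assumes sets_pi [simp]: "sets \<pi> = sets borel" and fin: "finite_measure \<pi>"
    and eta: "\<eta> = distr \<pi> borel fst"
  shows "disintegrations \<eta> \<pi> \<noteq> {}"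
proof -
  interpret finite_measure \<pi> by fact
  have sp [simp]: "space \<pi> = UNIV" using sets_pi[THEN sets_eq_imp_space_eq] by simp
  have [measurable_cong]: "sets \<pi> = sets (borel \<Otimes>\<^sub>M borel)" using sets_pi unfolding borel_prod .
  have sets_eta [simp, measurable_cong]: "sets \<eta> = sets borel" and sp_eta [simp]: "space \<eta> = UNIV"
    by (simp_all add: eta)
  interpret eta: finite_measure \<eta> unfolding eta by (rule finite_measure_distr) measurable
  have eta_eq: "emeasure \<eta> A = emeasure \<pi> (A \<times> UNIV)" if "A \<in> sets borel" for A
    using that by (simp add: eta emeasure_distr vimage_fst)
  define N where "N r = distr (density \<pi> (indicator (UNIV \<times> {..of_rat r}))) borel fst" for r :: rat
  have sets_N [simp]: "sets (N r) = sets borel" for r by (simp add: N_def)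
  have N: "emeasure (N r) A = emeasure \<pi> (A \<times> {..of_rat r})" if [measurable]: "A \<in> sets borel" for r A
    unfolding N_def by (subst emeasure_distr_density_indicator)
      (auto intro!: arg_cong[where f="emeasure \<pi>"])
  have N_le: "emeasure (N r) A \<le> emeasure \<eta> A" if "A \<in> sets borel" for r A
    using that by (auto simp: N eta_eq intro!: emeasure_mono)
  define G where "G r = RN_deriv \<eta> (N r)" for r
  have [measurable]: "G r \<in> borel_measurable borel" for r
    using borel_measurable_RN_deriv[of \<eta> "N r"] unfolding G_def by (simp cong: measurable_cong_sets)
  have dens: "density \<eta> (G r) = N r" for r
    unfolding G_def
  proof (rule eta.density_RN_deriv)
    show "absolutely_continuous \<eta> (N r)"
      using N_le[of _ r] by (force simp: absolutely_continuous_def null_sets_def)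
  qed simp
  have G: "(\<integral>\<^sup>+x. G r x * indicator A x \<partial>\<eta>) = emeasure \<pi> (A \<times> {..of_rat r})"
    if "A \<in> sets borel" for r A
    using that N[of A r] by (simp add: dens[symmetric] emeasure_density)
  have G_fin: "(\<integral>\<^sup>+x. G r x \<partial>\<eta>) < \<infinity>" for r
    using G[of UNIV r] by (simp add: less_top[symmetric])
  have mono: "AE x in \<eta>. G r x \<le> G r' x" if "r \<le> r'" for r r'
  proof -
    have "{..of_rat r} \<subseteq> {..of_rat r' :: real}" using that by (simp add: of_rat_less_eq)
    then show ?thesis
      using G_fin[of r']
      by (intro AE_le_of_set_nn_integral_le) (auto simp: G intro!: emeasure_mono)
  qed
  have le1: "AE x in \<eta>. G r x \<le> 1" for r
    by (intro AE_le_of_set_nn_integral_le) (auto simp: G N[symmetric] N_le less_top[symmetric])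
  have AEmono: "AE x in \<eta>. \<forall>r r'. r \<le> r' \<longrightarrow> G r x \<le> G r' x"
    using mono by (simp add: AE_all_countable)
  have AEle1: "AE x in \<eta>. \<forall>r. G r x \<le> 1"
    using le1 by (simp add: AE_all_countable)
  have SUPint: "(\<integral>\<^sup>+x. (SUP n. G (r n) x) * indicator A x \<partial>\<eta>) = emeasure \<pi> (A \<times> {y. \<exists>n. y \<le> of_rat (r n)})"
    if "incseq r" and [measurable]: "A \<in> sets borel" for r :: "nat \<Rightarrow> rat" and A
  proof -
    have "(\<integral>\<^sup>+x. (SUP n. G (r n) x) * indicator A x \<partial>\<eta>) = (\<integral>\<^sup>+x. (SUP n. G (r n) x * indicator A x) \<partial>\<eta>)"
      by (auto intro!: nn_integral_cong simp: indicator_def)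
    also have "\<dots> = (SUP n. \<integral>\<^sup>+x. G (r n) x * indicator A x \<partial>\<eta>)"
    proof (rule nn_integral_monotone_convergence_SUP_AE)
      show "AE x in \<eta>. G (r i) x * indicator A x \<le> G (r (Suc i)) x * indicator A x" for i
        using mono[OF incseq_SucD[OF that(1)], of i] by eventually_elim (auto simp: indicator_def)
    qed simp
    also have "\<dots> = (SUP n. emeasure \<pi> (A \<times> {..of_rat (r n)}))"
      by (simp add: G)
    also have "\<dots> = emeasure \<pi> (\<Union>n. A \<times> {..of_rat (r n)})"
    proof (intro SUP_emeasure_incseq incseq_SucI)
      show "A \<times> {..of_rat (r n)} \<subseteq> A \<times> {..of_rat (r (Suc n)) :: real}" for n
        using incseq_SucD[OF that(1), of n] by (auto simp: of_rat_less_eq intro: order_trans[of _ "of_rat (r n)"])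
    qed auto
    also have "(\<Union>n. A \<times> {..of_rat (r n)}) = A \<times> {y. \<exists>n. y \<le> of_rat (r n)}" by auto
    finally show ?thesis .
  qed
  have top: "AE x in \<eta>. 1 \<le> (SUP n. G (of_nat n) x)"
  proof (rule AE_le_of_set_nn_integral_le)
    have "{y. \<exists>n. y \<le> of_rat (rat_of_nat n)} = (UNIV :: real set)"
      using real_arch_simple by auto
    then have *: "(\<integral>\<^sup>+x. (SUP n. G (of_nat n) x) * indicator A x \<partial>\<eta>) = emeasure \<eta> A" if "A \<in> sets borel" for A
      using SUPint[of "of_nat" A] that by (simp add: eta_eq incseq_def)
    then show "(\<integral>\<^sup>+x. 1 * indicator A x \<partial>\<eta>) \<le> (\<integral>\<^sup>+x. (SUP n. G (of_nat n) x) * indicator A x \<partial>\<eta>)"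
      if "A \<in> sets \<eta>" for A using that by simp
    show "(\<integral>\<^sup>+x. (SUP n. G (of_nat n) x) \<partial>\<eta>) < \<infinity>"
      using *[of UNIV] by (simp add: less_top[symmetric])
  qed auto
  have bot: "AE x in \<eta>. (INF n. G (- of_nat n) x) = 0"
  proof -
    have "(\<integral>\<^sup>+x. (INF n. G (- of_nat n) x) \<partial>\<eta>) = (INF n. \<integral>\<^sup>+x. G (- of_nat n) x \<partial>\<eta>)"
      using G_fin[of 0] mono by (intro nn_integral_monotone_convergence_INF_AE[where i=0]) auto
    also have "\<dots> = (INF n. emeasure \<pi> (UNIV \<times> {..of_rat (- of_nat n)}))"
      using G[of UNIV] by simp
    also have "\<dots> = emeasure \<pi> (\<Inter>n. UNIV \<times> {..of_rat (- of_nat n)})"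
      by (intro INF_emeasure_decseq) (auto simp: decseq_def less_top[symmetric] of_rat_minus)
    also have "(\<Inter>n. UNIV \<times> {..of_rat (- of_nat n)}) = ({} :: (real \<times> real) set)"
    proof -
      have "\<exists>n. \<not> y \<le> - real n" for y
        using reals_Archimedean2[of "- y"] by (auto simp: not_le minus_less_iff)
      then show ?thesis by (auto simp: of_rat_minus)
    qed
    finally have "(\<integral>\<^sup>+x. (INF n. G (- of_nat n) x) \<partial>\<eta>) = 0" by simp
    then show ?thesis by (subst (asm) nn_integral_0_iff_AE) auto
  qed
  \<comment> \<open>the points where \<open>r \<mapsto> G r x\<close> is a distribution function on the rationals; elsewhere the
    kernel may be any probability measure, and \<open>Y x = 0\<close> makes it a point mass at 0\<close>
  define X0 where "X0 = {x. (\<forall>r r'. r \<le> r' \<longrightarrow> G r x \<le> G r' x) \<and> (\<forall>r. G r x \<le> 1) \<and>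
    1 \<le> (SUP n. G (of_nat n) x) \<and> (INF n. G (- of_nat n) x) = 0}"
  have [measurable]: "X0 \<in> sets borel"
    unfolding X0_def by measurable
  have AE_X0: "AE x in \<eta>. x \<in> X0"
    using AEmono AEle1 top bot by eventually_elim (auto simp: X0_def)
  define Y where "Y x s = (if x \<in> X0 \<and> 0 < s \<and> s < 1 then Inf {of_rat r | r. ennreal s \<le> G r x} else 0 :: real)" for x s
  \<comment> \<open>the limits of \<open>G r x\<close> make the infimum in \<open>Y\<close> one over a nonempty set bounded below\<close>
  have Y_less: "Y x s < y \<longleftrightarrow> (\<exists>r. of_rat r < y \<and> ennreal s \<le> G r x)" if "x \<in> X0" "0 < s" "s < 1" for x s y
  proof -
    have "ennreal s < (SUP n. G (of_nat n) x)"
      using that by (auto simp: X0_def intro: less_le_trans[of _ 1])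
    then obtain n where "ennreal s < G (of_nat n) x" by (auto simp: less_SUP_iff)
    then have "{of_rat r | r. ennreal s \<le> G r x} \<noteq> ({} :: real set)" by (auto intro: less_imp_le)
    moreover have "(INF n. G (- of_nat n) x) < ennreal s"
      using that by (auto simp: X0_def)
    then obtain m where m: "G (- of_nat m) x < ennreal s" by (auto simp: INF_less_iff)
    have "- real m \<le> of_rat r" if "ennreal s \<le> G r x" for r
    proof (rule ccontr)
      assume "\<not> - real m \<le> of_rat r"
      then have "of_rat r \<le> (of_rat (- of_nat m) :: real)" by (simp add: of_rat_minus)
      then have "G r x \<le> G (- of_nat m) x" using \<open>x \<in> X0\<close> unfolding of_rat_less_eq by (simp add: X0_def)
      with m that show False by simp
    qed
    then have "bdd_below {of_rat r :: real | r. ennreal s \<le> G r x}" by (auto intro!: bdd_belowI[of _ "- real m"])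
    ultimately show ?thesis using that by (auto simp: Y_def cInf_less_iff)
  qed
  have [measurable]: "(\<lambda>(x, s). Y x s) \<in> borel_measurable (borel \<Otimes>\<^sub>M borel)"
  proof (rule borel_measurable_iff_less[THEN iffD2], rule allI)
    fix y
    have "{w \<in> space (borel \<Otimes>\<^sub>M borel). (\<lambda>(x, s). Y x s) w < y} =
       {w \<in> space (borel \<Otimes>\<^sub>M borel). if fst w \<in> X0 \<and> 0 < snd w \<and> snd w < 1 then
          (\<exists>r. of_rat r < y \<and> ennreal (snd w) \<le> G r (fst w)) else 0 < y}"
    proof (intro Collect_cong conj_cong refl)
      fix w :: "real \<times> real"
      show "(\<lambda>(x, s). Y x s) w < y \<longleftrightarrow> (if fst w \<in> X0 \<and> 0 < snd w \<and> snd w < 1 then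
          (\<exists>r. of_rat r < y \<and> ennreal (snd w) \<le> G r (fst w)) else 0 < y)"
      proof (cases "fst w \<in> X0 \<and> 0 < snd w \<and> snd w < 1")
        case True
        then show ?thesis using Y_less[of "fst w" "snd w" y] by (simp add: case_prod_beta)
      next
        case False
        then have "Y (fst w) (snd w) = 0" by (auto simp: Y_def)
        with False show ?thesis by (simp only: case_prod_beta if_False)
      qed
    qed
    also have "\<dots> \<in> sets (borel \<Otimes>\<^sub>M borel)" by measurable
    finally show "{w \<in> space (borel \<Otimes>\<^sub>M borel). (\<lambda>(x, s). Y x s) w < y} \<in> sets (borel \<Otimes>\<^sub>M borel)" .
  qed
  define K where "K x = distr unif borel (Y x)" for x
  interpret U: prob_space unif by (rule prob_space_unif)
  have Y_meas [measurable]: "Y x \<in> borel_measurable borel" for x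
    by measurable
  have K_meas: "K \<in> borel \<rightarrow>\<^sub>M prob_algebra borel"
  proof (rule measurable_prob_algebraI)
    show "prob_space (K x)" for x unfolding K_def by (rule U.prob_space_distr) measurable
    have "unif \<in> space (subprob_algebra borel)"
      by (simp add: space_subprob_algebra U.subprob_space_axioms)
    then show "K \<in> borel \<rightarrow>\<^sub>M subprob_algebra borel" unfolding K_def
      by (intro measurable_distr2[where M=borel]) auto
  qed
  have K_meas' [measurable]: "K \<in> borel \<rightarrow>\<^sub>M subprob_algebra borel"
    using K_meas by (rule measurable_prob_algebraD)
  have K_less: "emeasure (K x) {..<y} = (SUP n. G (r n) x)"
    if "x \<in> X0" "incseq r" "\<And>n. of_rat (r n) < (y::real)" and approx: "\<And>z. z < y \<Longrightarrow> \<exists>n. z \<le> of_rat (r n)" for x y r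
  proof -
    have "emeasure (K x) {..<y} = emeasure unif {s. Y x s < y}"
      by (simp add: K_def emeasure_distr vimage_def)
    also have "\<dots> = emeasure unif (\<Union>n. {s. ennreal s \<le> G (r n) x})"
    proof (rule emeasure_eq_AE)
      have *: "(\<exists>q. of_rat q < y \<and> ennreal s \<le> G q x) \<longleftrightarrow> (\<exists>n. ennreal s \<le> G (r n) x)" for s
      proof safe
        fix q assume q: "of_rat q < y" "ennreal s \<le> G q x"
        then obtain n where "(of_rat q :: real) \<le> of_rat (r n)" using approx by blast
        then have "G q x \<le> G (r n) x" using that(1) by (simp add: X0_def of_rat_less_eq)
        then show "\<exists>n. ennreal s \<le> G (r n) x" using q by (auto intro: order_trans)
      qed (use that(3) in auto)
      show "AE s in unif. s \<in> {s. Y x s < y} \<longleftrightarrow> s \<in> (\<Union>n. {s. ennreal s \<le> G (r n) x})"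
        using AE_unif by eventually_elim (use \<open>x \<in> X0\<close> * in \<open>auto simp: Y_less\<close>)
    qed measurable
    also have "\<dots> = (SUP n. emeasure unif {s. ennreal s \<le> G (r n) x})"
      using \<open>x \<in> X0\<close> \<open>incseq r\<close> by (intro SUP_emeasure_incseq[symmetric])
       (auto simp: incseq_def X0_def intro: order_trans)
    also have "\<dots> = (SUP n. G (r n) x)"
      using \<open>x \<in> X0\<close> by (simp add: emeasure_unif_Iic_ennreal X0_def)
    finally show ?thesis .
  qed
  define \<pi>' where "\<pi>' = kernel_product \<eta> K"
  note sets_pi' = sets_kernel_product[OF K_meas sets_eta, folded \<pi>'_def]
    and pi' = emeasure_kernel_product[OF K_meas sets_eta, folded \<pi>'_def]
  have "\<pi> = \<pi>'"
  proof (rule finite_measure_pair_eqI)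
    fix A :: "real set" and y :: real assume [measurable]: "A \<in> sets borel"
    obtain r :: "nat \<Rightarrow> rat" where r: "incseq r" "\<And>n. of_rat (r n) < y" "\<And>z. z < y \<Longrightarrow> \<exists>n. z \<le> of_rat (r n)"
      by (rule strict_approx_rat[of y]) blast
    have "emeasure \<pi>' (A \<times> {..<y}) = (\<integral>\<^sup>+x. (\<integral>\<^sup>+z. indicator (A \<times> {..<y}) (x, z) \<partial>K x) \<partial>\<eta>)"
      by (rule pi') measurable
    also have "\<dots> = (\<integral>\<^sup>+x. (SUP n. G (r n) x) * indicator A x \<partial>\<eta>)"
      using AE_X0
    proof (intro nn_integral_cong_AE, eventually_elim)
      case (elim x)
      have "(\<integral>\<^sup>+z. indicator (A \<times> {..<y}) (x, z) \<partial>K x) = (\<integral>\<^sup>+z. indicator A x * indicator {..<y} z \<partial>K x)"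
        by (intro nn_integral_cong) (auto simp: indicator_def)
      also have "\<dots> = indicator A x * emeasure (K x) {..<y}"
        by (subst nn_integral_cmult) (auto simp: K_def)
      finally show ?case using K_less[OF elim(2) r] by (simp add: mult.commute)
    qed
    also have "\<dots> = emeasure \<pi> (A \<times> {z. \<exists>n. z \<le> of_rat (r n)})"
      using r by (intro SUPint) auto
    also have "{z. \<exists>n. z \<le> of_rat (r n)} = {..<y}" using r by (auto intro: le_less_trans)
    finally show "emeasure \<pi> (A \<times> {..<y}) = emeasure \<pi>' (A \<times> {..<y})" by simp
  qed (use fin sets_pi' in auto)
  then have "K \<in> disintegrations \<eta> \<pi>"
    using K_meas pi' by (simp add: disintegrations_def)
  then show ?thesis by blast
qed

section \<open>Martingale couplings of measures in convex order\<close>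

text \<open>Strassen's theorem for probability measures on the line, by an explicit construction. Let
\<open>A\<close> and \<open>B\<close> be the quantile functions of \<open>\<eta>\<close> and \<open>\<theta>\<close>, and \<open>f = A - B\<close>. The comparison of the put
potentials at \<open>k = B u\<close> says that \<open>f\<close> has a nonnegative integral over \<open>(0, u]\<close>. So the levels with
\<open>f > 0\<close> are paired with levels with \<open>f < 0\<close> to their right: for a pair \<open>u < v\<close>,
\<open>B u < A u \<le> A v < B v\<close>.

Start from the coupling \<open>(A t, B t)\<close>, in which mass at \<open>A u\<close> travels too far down and mass at
\<open>A v\<close> too far up, and exchange targets within each pair: an amount of the mass that moves
\<open>A u \<mapsto> B u\<close> and \<open>A v \<mapsto> B v\<close> now moves \<open>A u \<mapsto> B v\<close> and \<open>A v \<mapsto> B u\<close>. Both marginals are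
kept. With the amount \<open>M / (B v - B u)\<close> the exchange raises the mean target at \<open>A u\<close> by
exactly the deficit \<open>f u\<close> and lowers the one at \<open>A v\<close> by the excess \<open>- f v\<close>, whatever the pair.
There is enough mass to exchange because \<open>B v - B u\<close> is at least both \<open>f u\<close> and \<open>- f v\<close>.\<close>

lemma martingale_coupling_prob:
  assumes eta: "real_distribution \<eta>" "integrable \<eta> (\<lambda>x. x)"
    and chi: "real_distribution \<theta>" "integrable \<theta> (\<lambda>x. x)"
    and mean: "(\<integral>x. x \<partial>\<eta>) = (\<integral>x. x \<partial>\<theta>)"
    and le: "\<And>k. put_pot \<eta> k \<le> put_pot \<theta> k"
  obtains \<pi> where "\<pi> \<in> couplings \<eta> \<theta>"
    "\<And>E. E \<in> sets borel \<Longrightarrow> (\<integral>p. indicator E (fst p) * (snd p - fst p) \<partial>\<pi>) = 0"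
proof -
  interpret eta: real_distribution \<eta> by fact
  interpret chi: real_distribution \<theta> by fact
  interpret U: prob_space unif by (rule prob_space_unif)
  obtain A where [measurable]: "A \<in> borel_measurable borel" and dA: "distr unif borel A = \<eta>"
    and A: "\<And>w y. 0 < w \<Longrightarrow> w < 1 \<Longrightarrow> A w \<le> y \<longleftrightarrow> w \<le> cdf \<eta> y"
    using quantile_function[OF eta(1)] by blast
  obtain B where [measurable]: "B \<in> borel_measurable borel" and dB: "distr unif borel B = \<theta>"
    and B: "\<And>w y. 0 < w \<Longrightarrow> w < 1 \<Longrightarrow> B w \<le> y \<longleftrightarrow> w \<le> cdf \<theta> y"
    using quantile_function[OF chi(1)] by blast
  have A_mono: "A s \<le> A t" if "0 < s" "s \<le> t" "t < 1" for s t
    using that A[of t "A t"] A[of s "A t"] by simp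
  have B_mono: "B s \<le> B t" if "0 < s" "s \<le> t" "t < 1" for s t
    using that B[of t "B t"] B[of s "B t"] by simp
  have intA: "integrable unif A"
    by (rule integrable_distr[where M'=borel and f="\<lambda>x. x"]) (simp_all add: dA eta(2))
  have intB: "integrable unif B"
    by (rule integrable_distr[where M'=borel and f="\<lambda>x. x"]) (simp_all add: dB chi(2))
  have distA: "(\<integral>x. g x \<partial>\<eta>) = (\<integral>t. g (A t) \<partial>unif)" if "g \<in> borel_measurable borel" for g :: "real \<Rightarrow> real"
    unfolding dA[symmetric] using that by (intro integral_distr) simp_all
  have distB: "(\<integral>x. g x \<partial>\<theta>) = (\<integral>t. g (B t) \<partial>unif)" if "g \<in> borel_measurable borel" for g :: "real \<Rightarrow> real"
    unfolding dB[symmetric] using that by (intro integral_distr) simp_all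
  define f where "f t = A t - B t" for t
  have f_meas [measurable]: "f \<in> borel_measurable borel" unfolding f_def by measurable
  have intf: "integrable unif f" unfolding f_def using intA intB by simp
  have f0: "(\<integral>t. f t \<partial>unif) = 0"
    using mean intA intB unfolding f_def by (simp add: distA distB)
  \<comment> \<open>\<open>B \<le> B u\<close> exactly on the levels up to \<open>u\<close> (up to ties), which turns \<open>put_pot \<theta> (B u)\<close> into a
    partial integral; for \<open>A\<close> one inequality remains\<close>
  have partial: "0 \<le> (\<integral>t. f t * indicator {..u} t \<partial>unif)" if u: "0 < u" "u < 1" for u
  proof -
    let ?k = "B u"
    have int: "integrable unif (\<lambda>t. g t * indicator {..u} t)" if "integrable unif g" for g :: "real \<Rightarrow> real"
      using that by (intro integrable_real_mult_indicator) auto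
    have "(\<integral>t. (?k - A t) * indicator {..u} t \<partial>unif) \<le> (\<integral>t. max (?k - A t) 0 \<partial>unif)"
      using intA int by (intro integral_mono) (auto simp: indicator_def)
    also have "\<dots> = put_pot \<eta> ?k"
      unfolding put_pot_def by (subst distA) auto
    also have "\<dots> \<le> put_pot \<theta> ?k" by (rule le)
    also have "\<dots> = (\<integral>t. max (?k - B t) 0 \<partial>unif)"
      unfolding put_pot_def by (subst distB) auto
    also have "\<dots> = (\<integral>t. (?k - B t) * indicator {..u} t \<partial>unif)"
    proof (rule integral_cong_AE)
      show "AE t in unif. max (B u - B t) 0 = (B u - B t) * indicator {..u} t"
        using AE_unif
      proof eventually_elim
        case (elim t)
        then show ?case using B_mono[of t u] B_mono[of u t] u by (auto simp: indicator_def)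
      qed
    qed measurable
    finally have "0 \<le> (\<integral>t. (?k - B t) * indicator {..u} t \<partial>unif) - (\<integral>t. (?k - A t) * indicator {..u} t \<partial>unif)"
      by simp
    also have "\<dots> = (\<integral>t. (?k - B t) * indicator {..u} t - (?k - A t) * indicator {..u} t \<partial>unif)"
      using intA intB int by (intro Bochner_Integration.integral_diff[symmetric]) auto
    also have "\<dots> = (\<integral>t. f t * indicator {..u} t \<partial>unif)"
      by (intro Bochner_Integration.integral_cong) (auto simp: f_def algebra_simps)
    finally show ?thesis .
  qed
  define M where "M = (\<integral>t. max (f t) 0 \<partial>unif)"
  define \<pi>\<^sub>0 where "\<pi>\<^sub>0 = distr unif borel (\<lambda>t. (A t, B t))"
  have sets_pi0 [simp, measurable_cong]: "sets \<pi>\<^sub>0 = sets borel" by (simp add: \<pi>\<^sub>0_def)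
  have pair_meas: "(\<lambda>t. (g t, h t)) \<in> unif \<rightarrow>\<^sub>M borel"
    if "g \<in> borel_measurable borel" "h \<in> borel_measurable borel" for g h :: "real \<Rightarrow> real"
    using that by (intro borel_measurable_Pair) simp_all
  have fst_snd: "(fst :: real \<times> real \<Rightarrow> real) \<in> borel_measurable borel" "(snd :: real \<times> real \<Rightarrow> real) \<in> borel_measurable borel"
    unfolding borel_prod[symmetric] by measurable
  have pi0: "\<pi>\<^sub>0 \<in> couplings \<eta> \<theta>"
    unfolding couplings_def \<pi>\<^sub>0_def using pair_meas[of A B] fst_snd
    by (simp add: distr_distr o_def dA dB)
  have "0 \<le> M" unfolding M_def by (rule Bochner_Integration.integral_nonneg) simp
  consider "M = 0" | "0 < M" using \<open>0 \<le> M\<close> by linarith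
  then show thesis
  proof cases
    case 1
    have "AE t in unif. f t = 0"
    proof -
      have "AE t in unif. max (f t) 0 = 0"
        using 1 intf unfolding M_def by (subst (asm) integral_nonneg_eq_0_iff_AE) auto
      moreover have "(\<integral>t. max (- f t) 0 \<partial>unif) = (\<integral>t. max (f t) 0 - f t \<partial>unif)"
        by (intro Bochner_Integration.integral_cong) auto
      then have "(\<integral>t. max (- f t) 0 \<partial>unif) = 0"
        using 1 intf f0 by (simp add: M_def)
      then have "AE t in unif. max (- f t) 0 = 0"
        using intf by (subst (asm) integral_nonneg_eq_0_iff_AE) auto
      ultimately show ?thesis by eventually_elim auto
    qed
    then have AB: "AE t in unif. A t = B t" by (simp add: f_def)
    have "(\<integral>p. indicator E (fst p) * (snd p - fst p) \<partial>\<pi>\<^sub>0) = 0" if [measurable]: "E \<in> sets borel" for E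
    proof -
      have "(\<integral>p. indicator E (fst p) * (snd p - fst p) \<partial>\<pi>\<^sub>0) = (\<integral>t. indicator E (A t) * (B t - A t) \<partial>unif)"
        unfolding \<pi>\<^sub>0_def using pair_meas[of A B]
        by (subst integral_distr) (auto simp: borel_prod[symmetric])
      also have "\<dots> = (\<integral>t. 0 \<partial>unif)"
        by (rule integral_cong_AE) (use AB in auto)
      finally show ?thesis by simp
    qed
    with pi0 show thesis by (rule that)
  next
    case 2
    obtain u v where [measurable]: "u \<in> borel_measurable borel" "v \<in> borel_measurable borel"
      and du: "distr unif borel u = density unif (\<lambda>t. ennreal (max (f t) 0 / M))"
      and dv: "distr unif borel v = density unif (\<lambda>t. ennreal (max (- f t) 0 / M))"
      and uv: "AE w in unif. u w \<le> v w"
      using ordered_pairing[OF intf f0 partial M_def 2] by blast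
    have AE_law: "AE w in unif. P (g w)"
      if law: "distr unif borel g = density unif (\<lambda>t. ennreal (max (\<phi> t) 0 / M))"
        and [measurable]: "g \<in> borel_measurable borel" "\<phi> \<in> borel_measurable borel" "Measurable.pred borel P"
        and P: "AE t in unif. 0 < \<phi> t \<longrightarrow> P t" for g \<phi> :: "real \<Rightarrow> real" and P
    proof -
      have "AE t in distr unif borel g. P t"
        unfolding law using P \<open>0 < M\<close>
        by (subst AE_density) (auto elim!: eventually_mono simp: max_def split: if_splits)
      then show ?thesis by (subst (asm) AE_distr_iff) auto
    qed
    have "AE w in unif. 0 < u w \<and> u w < 1 \<and> 0 < f (u w)"
      by (rule AE_law[OF du]) (use AE_unif in \<open>auto elim: eventually_mono\<close>)
    moreover have "AE w in unif. 0 < v w \<and> v w < 1 \<and> f (v w) < 0"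
      by (rule AE_law[OF dv]) (use AE_unif in \<open>auto elim: eventually_mono\<close>)
    ultimately have ord: "AE w in unif. B (u w) < A (u w) \<and> A (u w) \<le> A (v w) \<and> A (v w) < B (v w)"
      using uv by eventually_elim (auto simp: f_def intro!: A_mono)
    \<comment> \<open>the rate of exchange; the maximum with 0 only concerns a null set of pairs\<close>
    define r where "r w = max 0 (M / (B (v w) - B (u w)))" for w
    have r_meas [measurable]: "r \<in> borel_measurable borel" unfolding r_def by measurable
    have r_pos: "0 \<le> r w" for w unfolding r_def by simp
    have r: "AE w in unif. r w * (B (v w) - B (u w)) = M \<and> r w \<le> M / f (u w) \<and> r w \<le> M / - f (v w)"
      using ord
    proof eventually_elim
      case (elim w)
      then have "0 < B (v w) - B (u w)" by simp
      with \<open>0 < M\<close> elim show ?case by (auto simp: r_def f_def max_def intro!: divide_left_mono)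
    qed
    define \<rho> where "\<rho> = density unif (\<lambda>w. ennreal (r w))"
    have sets_rho [simp, measurable_cong]: "sets \<rho> = sets borel" by (simp add: \<rho>_def)
    have space_rho [simp]: "space \<rho> = UNIV" by (simp add: \<rho>_def)
    have pair_rho: "(\<lambda>t. (g t, h t)) \<in> \<rho> \<rightarrow>\<^sub>M borel"
      if "g \<in> borel_measurable borel" "h \<in> borel_measurable borel" for g h :: "real \<Rightarrow> real"
      using that by (intro borel_measurable_Pair) simp_all
    define D where "D g h = distr \<rho> borel (\<lambda>w. (g w, h w))" for g h :: "real \<Rightarrow> real"
    have sets_D [simp, measurable_cong]: "sets (D g h) = sets borel" for g h by (simp add: D_def)
    \<comment> \<open>\<open>R\<close> is the mass that the exchange removes, \<open>S\<close> the mass that it adds\<close>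
    define R where "R = add_measure (D (\<lambda>w. A (u w)) (\<lambda>w. B (u w))) (D (\<lambda>w. A (v w)) (\<lambda>w. B (v w)))"
    define S where "S = add_measure (D (\<lambda>w. A (u w)) (\<lambda>w. B (v w))) (D (\<lambda>w. A (v w)) (\<lambda>w. B (u w)))"
    have sets_RS [simp, measurable_cong]: "sets R = sets borel" "sets S = sets borel"
      by (simp_all add: R_def S_def)
    have D_eq: "emeasure (D g h) X = (\<integral>\<^sup>+w. ennreal (r w) * indicator X (g w, h w) \<partial>unif)"
      if [measurable]: "g \<in> borel_measurable borel" "h \<in> borel_measurable borel" and X: "X \<in> sets borel" for g h X
    proof -
      have [measurable]: "(\<lambda>w. (g w, h w)) -` X \<in> sets borel"
        using measurable_sets[OF pair_meas[of g h] X] by simp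
      show ?thesis
        using pair_rho[of g h] X by (simp add: D_def emeasure_distr \<rho>_def emeasure_density)
          (simp add: indicator_def)
    qed
    have R_le: "emeasure R X \<le> emeasure \<pi>\<^sub>0 X" if X: "X \<in> sets borel" for X
    proof -
      let ?I = "\<lambda>t. indicator X (A t, B t) :: ennreal"
      have Y [measurable]: "{t. (A t, B t) \<in> X} \<in> sets borel"
        using measurable_sets[OF pair_meas[of A B] X] by (simp add: vimage_def)
      have I [measurable]: "?I \<in> borel_measurable borel"
      proof -
        have "?I = indicator {t. (A t, B t) \<in> X}" by (auto simp: indicator_def fun_eq_iff)
        then show ?thesis using Y by (simp only: borel_measurable_indicator)
      qed
      \<comment> \<open>the law of \<open>g\<close> has density \<open>\<phi> / M\<close> where \<open>\<phi> > 0\<close>, which cancels the bound \<open>M / \<phi>\<close> for the rate: no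
        more mass is removed than the monotone coupling has there\<close>
      have half: "emeasure (D (\<lambda>w. A (g w)) (\<lambda>w. B (g w))) X \<le> (\<integral>\<^sup>+t. indicator {t. 0 < \<phi> t} t * ?I t \<partial>unif)"
        if law: "distr unif borel g = density unif (\<lambda>t. ennreal (max (\<phi> t) 0 / M))"
          and [measurable]: "g \<in> borel_measurable borel" "\<phi> \<in> borel_measurable borel"
          and r_le: "AE w in unif. r w \<le> M / \<phi> (g w)" for g \<phi> :: "real \<Rightarrow> real"
      proof -
        have "emeasure (D (\<lambda>w. A (g w)) (\<lambda>w. B (g w))) X = (\<integral>\<^sup>+w. ennreal (r w) * ?I (g w) \<partial>unif)"
          using X by (subst D_eq) auto
        also have "\<dots> \<le> (\<integral>\<^sup>+w. ennreal (M / \<phi> (g w)) * ?I (g w) \<partial>unif)"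
          by (rule nn_integral_mono_AE) (use r_le in eventually_elim, auto intro!: mult_right_mono ennreal_leI)
        also have "\<dots> = (\<integral>\<^sup>+t. ennreal (M / \<phi> t) * ?I t \<partial>distr unif borel g)"
          by (subst nn_integral_distr) auto
        also have "\<dots> = (\<integral>\<^sup>+t. ennreal (max (\<phi> t) 0 / M) * (ennreal (M / \<phi> t) * ?I t) \<partial>unif)"
          unfolding law by (subst nn_integral_density) auto
        also have "\<dots> = (\<integral>\<^sup>+t. indicator {t. 0 < \<phi> t} t * ?I t \<partial>unif)"
          using \<open>0 < M\<close> by (intro nn_integral_cong)
            (auto simp: indicator_def max_def ennreal_mult[symmetric] split: if_splits)
        finally show ?thesis .
      qed
      have "emeasure (D (\<lambda>w. A (u w)) (\<lambda>w. B (u w))) X \<le> (\<integral>\<^sup>+t. indicator {t. 0 < f t} t * ?I t \<partial>unif)"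
        by (rule half[OF du]) (use r in \<open>auto elim: eventually_mono\<close>)
      moreover have "emeasure (D (\<lambda>w. A (v w)) (\<lambda>w. B (v w))) X \<le> (\<integral>\<^sup>+t. indicator {t. 0 < - f t} t * ?I t \<partial>unif)"
        by (rule half[OF dv]) (use r in \<open>auto elim: eventually_mono\<close>)
      ultimately have "emeasure R X \<le> (\<integral>\<^sup>+t. indicator {t. 0 < f t} t * ?I t \<partial>unif) + (\<integral>\<^sup>+t. indicator {t. 0 < - f t} t * ?I t \<partial>unif)"
        using X unfolding R_def by (subst emeasure_add_measure) (auto intro!: add_mono)
      also have "\<dots> = (\<integral>\<^sup>+t. indicator {t. 0 < f t} t * ?I t + indicator {t. 0 < - f t} t * ?I t \<partial>unif)"
        by (rule nn_integral_add[symmetric]) auto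
      also have "\<dots> \<le> (\<integral>\<^sup>+t. indicator {t. (A t, B t) \<in> X} t \<partial>unif)"
        by (intro nn_integral_mono) (auto simp: indicator_def)
      also have "\<dots> = emeasure \<pi>\<^sub>0 X"
        using X pair_meas[of A B] by (simp add: \<pi>\<^sub>0_def emeasure_distr vimage_def)
      finally show ?thesis .
    qed
    have fin0: "finite_measure \<pi>\<^sub>0" unfolding \<pi>\<^sub>0_def using pair_meas[of A B]
      by (intro U.finite_measure_distr) auto
    have finR: "finite_measure R"
      using R_le[of UNIV] finite_measure.emeasure_finite[OF fin0, of UNIV] sets_eq_imp_space_eq[OF sets_RS(1)]
      by (intro finite_measureI) (auto simp: top_unique)
    define \<pi> where "\<pi> = add_measure (diff_measure \<pi>\<^sub>0 R) S"
    have sets_pi [simp, measurable_cong]: "sets \<pi> = sets borel" by (simp add: \<pi>_def)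
    \<comment> \<open>subtraction-free form of \<open>\<pi> = \<pi>\<^sub>0 - R + S\<close>, from which marginals and integrals are read off\<close>
    have bal: "add_measure \<pi> R = add_measure \<pi>\<^sub>0 S"
    proof (rule measure_eqI)
      fix X assume "X \<in> sets (add_measure \<pi> R)"
      then have X: "X \<in> sets borel" by simp
      have "emeasure (diff_measure \<pi>\<^sub>0 R) X + emeasure R X = emeasure \<pi>\<^sub>0 X"
        using X R_le[of X] fin0 finR R_le by (subst emeasure_diff_measure) (auto intro!: diff_add_cancel_ennreal)
      then show "emeasure (add_measure \<pi> R) X = emeasure (add_measure \<pi>\<^sub>0 S) X"
        using X by (simp add: \<pi>_def emeasure_add_measure ac_simps)
    qed simp
    have marg: "distr \<pi> borel g = distr \<pi>\<^sub>0 borel g"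
      if g [measurable]: "g \<in> borel_measurable borel" and RS: "\<And>X. X \<in> sets borel \<Longrightarrow> emeasure R (g -` X) = emeasure S (g -` X)"
      for g :: "real \<times> real \<Rightarrow> real"
    proof (rule measure_eqI)
      fix X assume "X \<in> sets (distr \<pi> borel g)"
      then have X: "X \<in> sets borel" by simp
      have sp: "space \<pi> = UNIV" "space \<pi>\<^sub>0 = UNIV" using sets_pi[THEN sets_eq_imp_space_eq] sets_pi0[THEN sets_eq_imp_space_eq] by simp_all
      have gX: "g -` X \<in> sets borel" using measurable_sets[OF g X] by simp
      have "emeasure \<pi> (g -` X) + emeasure R (g -` X) = emeasure \<pi>\<^sub>0 (g -` X) + emeasure S (g -` X)"
        using arg_cong[OF bal, of "\<lambda>M. emeasure M (g -` X)"] gX by (simp add: emeasure_add_measure)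
      then have "emeasure \<pi> (g -` X) = emeasure \<pi>\<^sub>0 (g -` X)"
        using RS[OF X] finite_measure.emeasure_finite[OF finR, of "g -` X"]
        by (metis add.commute ennreal_add_left_cancel infinity_ennreal_def)
      then show "emeasure (distr \<pi> borel g) X = emeasure (distr \<pi>\<^sub>0 borel g) X"
        using X sp by (simp add: emeasure_distr)
    qed simp
    have D_fst: "emeasure (D g h) (fst -` X) = (\<integral>\<^sup>+w. ennreal (r w) * indicator X (g w) \<partial>unif)"
      if "g \<in> borel_measurable borel" "h \<in> borel_measurable borel" "X \<in> sets borel" for g h X
      using that fst_snd(1)[THEN measurable_sets, of X] by (subst D_eq) (auto simp: indicator_def)
    have D_snd: "emeasure (D g h) (snd -` X) = (\<integral>\<^sup>+w. ennreal (r w) * indicator X (h w) \<partial>unif)"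
      if "g \<in> borel_measurable borel" "h \<in> borel_measurable borel" "X \<in> sets borel" for g h X
      using that fst_snd(2)[THEN measurable_sets, of X] by (subst D_eq) (auto simp: indicator_def)
    have "distr \<pi> borel fst = distr \<pi>\<^sub>0 borel fst"
    proof (rule marg)
      fix X :: "real set" assume "X \<in> sets borel"
      then show "emeasure R (fst -` X) = emeasure S (fst -` X)"
        using fst_snd(1)[THEN measurable_sets, of X] by (simp add: R_def S_def emeasure_add_measure D_fst)
    qed (rule fst_snd)
    moreover have "distr \<pi> borel snd = distr \<pi>\<^sub>0 borel snd"
    proof (rule marg)
      fix X :: "real set" assume "X \<in> sets borel"
      then show "emeasure R (snd -` X) = emeasure S (snd -` X)"
        using fst_snd(2)[THEN measurable_sets, of X] by (simp add: R_def S_def emeasure_add_measure D_snd add.commute)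
    qed (rule fst_snd)
    ultimately have pi: "\<pi> \<in> couplings \<eta> \<theta>" using pi0 by (simp add: couplings_def)
    have "(\<integral>p. indicator E (fst p) * (snd p - fst p) \<partial>\<pi>) = 0" if [measurable]: "E \<in> sets borel" for E
    proof -
      let ?F = "\<lambda>p. indicator E (fst p) * (snd p - fst p) :: real"
      have F [measurable]: "?F \<in> borel_measurable borel" unfolding borel_prod[symmetric] by measurable
      have int_coord: "integrable N ?F" if "integrable N fst" "integrable N snd" "sets N = sets borel" for N
      proof (rule Bochner_Integration.integrable_bound[of _ "\<lambda>p. \<bar>fst p\<bar> + \<bar>snd p\<bar>"])
        show "?F \<in> borel_measurable N" using F by (simp cong: measurable_cong_sets add: that(3))
      qed (use that in \<open>auto simp: indicator_def\<close>)
      have int_couplings: "integrable N ?F" if "N \<in> couplings \<eta> \<theta>" for N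
      proof (rule int_coord)
        have *: "sets N = sets borel" "distr N borel fst = \<eta>" "distr N borel snd = \<theta>"
          using that by (auto simp: couplings_def)
        then show "sets N = sets borel" by simp
        have m: "fst \<in> borel_measurable N" "snd \<in> borel_measurable N"
          using fst_snd * by (simp_all cong: measurable_cong_sets)
        show "integrable N fst" using eta(2) m unfolding *(2)[symmetric] by (simp add: integrable_distr_eq)
        show "integrable N snd" using chi(2) m unfolding *(3)[symmetric] by (simp add: integrable_distr_eq)
      qed
      have int_rho: "integrable \<rho> (\<lambda>w. A (u w))" "integrable \<rho> (\<lambda>w. B (u w))"
        "integrable \<rho> (\<lambda>w. A (v w))" "integrable \<rho> (\<lambda>w. B (v w))"
      proof -
        have nn: "(\<integral>\<^sup>+p. g p \<partial>R) \<le> (\<integral>\<^sup>+p. g p \<partial>\<pi>\<^sub>0)" if "g \<in> borel_measurable borel" for g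
          using R_le by (intro nn_integral_mono_measure) (auto simp: le_measure)
        have gen: "(\<integral>\<^sup>+w. g (A (u w), B (u w)) \<partial>\<rho>) \<le> (\<integral>\<^sup>+p. g p \<partial>\<pi>\<^sub>0)"
          "(\<integral>\<^sup>+w. g (A (v w), B (v w)) \<partial>\<rho>) \<le> (\<integral>\<^sup>+p. g p \<partial>\<pi>\<^sub>0)" if g: "g \<in> borel_measurable borel" for g
        proof -
          have "(\<integral>\<^sup>+p. g p \<partial>R) = (\<integral>\<^sup>+w. g (A (u w), B (u w)) \<partial>\<rho>) + (\<integral>\<^sup>+w. g (A (v w), B (v w)) \<partial>\<rho>)"
            using g pair_rho unfolding R_def
            by (subst nn_integral_add_measure) (auto simp: D_def nn_integral_distr)
          then show "(\<integral>\<^sup>+w. g (A (u w), B (u w)) \<partial>\<rho>) \<le> (\<integral>\<^sup>+p. g p \<partial>\<pi>\<^sub>0)"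
             "(\<integral>\<^sup>+w. g (A (v w), B (v w)) \<partial>\<rho>) \<le> (\<integral>\<^sup>+p. g p \<partial>\<pi>\<^sub>0)"
            using nn[OF g] by (auto intro: order_trans[rotated])
        qed
        have *: "(\<integral>\<^sup>+p. ennreal \<bar>fst p\<bar> \<partial>\<pi>\<^sub>0) < \<infinity>" "(\<integral>\<^sup>+p. ennreal \<bar>snd p\<bar> \<partial>\<pi>\<^sub>0) < \<infinity>"
          using intA intB pair_meas[of A B] fst_snd unfolding \<pi>\<^sub>0_def integrable_iff_bounded
          by (auto simp: nn_integral_distr)
        have m: "(\<lambda>p::real\<times>real. ennreal \<bar>fst p\<bar>) \<in> borel_measurable borel" "(\<lambda>p::real\<times>real. ennreal \<bar>snd p\<bar>) \<in> borel_measurable borel"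
          unfolding borel_prod[symmetric] by measurable
        show "integrable \<rho> (\<lambda>w. A (u w))" "integrable \<rho> (\<lambda>w. B (u w))"
          "integrable \<rho> (\<lambda>w. A (v w))" "integrable \<rho> (\<lambda>w. B (v w))"
          unfolding integrable_iff_bounded using gen[OF m(1)] gen[OF m(2)] *
          by (auto intro: le_less_trans)
      qed
      have int_D: "integrable (D g h) ?F"
        and D_int: "(\<integral>p. ?F p \<partial>D g h) = (\<integral>w. indicator E (g w) * (h w - g w) \<partial>\<rho>)"
        and D_int': "integrable \<rho> (\<lambda>w. indicator E (g w) * (h w - g w))"
        if gh: "integrable \<rho> g" "integrable \<rho> h" for g h
      proof -
        have m: "g \<in> borel_measurable borel" "h \<in> borel_measurable borel"
          using gh[THEN borel_measurable_integrable] by (simp_all cong: measurable_cong_sets)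
        show "integrable (D g h) ?F"
          using gh fst_snd pair_rho[OF m] by (intro int_coord) (auto simp: D_def integrable_distr_eq)
        then show "integrable \<rho> (\<lambda>w. indicator E (g w) * (h w - g w))"
          using pair_rho[OF m] F by (simp add: D_def integrable_distr_eq)
        show "(\<integral>p. ?F p \<partial>D g h) = (\<integral>w. indicator E (g w) * (h w - g w) \<partial>\<rho>)"
          using pair_rho[OF m] F by (simp add: D_def integral_distr)
      qed
      note ir = int_rho
      note intD = int_D[OF ir(1) ir(2)] int_D[OF ir(3) ir(4)] int_D[OF ir(1) ir(4)] int_D[OF ir(3) ir(2)]
      have intRS: "integrable R ?F" "integrable S ?F"
        unfolding R_def S_def using intD by (auto intro!: integrable_add_measure)
      have "(\<integral>p. ?F p \<partial>\<pi>) + (\<integral>p. ?F p \<partial>R) = (\<integral>p. ?F p \<partial>\<pi>\<^sub>0) + (\<integral>p. ?F p \<partial>S)"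
        using arg_cong[OF bal, of "\<lambda>N. \<integral>p. ?F p \<partial>N"] int_couplings[OF pi] int_couplings[OF pi0] intRS
        by (simp add: integral_add_measure)
      \<comment> \<open>the factor \<open>B v - B u\<close> cancels against the rate, and the laws of \<open>u\<close> and \<open>v\<close> give back the
        positive and the negative part of \<open>f\<close>\<close>
      moreover have "(\<integral>p. ?F p \<partial>S) - (\<integral>p. ?F p \<partial>R) = (\<integral>t. indicator E (A t) * f t \<partial>unif)"
      proof -
        let ?e = "\<lambda>w. indicator E (A (u w)) - indicator E (A (v w)) :: real"
        have "(\<integral>p. ?F p \<partial>S) - (\<integral>p. ?F p \<partial>R) =
           (\<integral>w. (indicator E (A (u w)) * (B (v w) - A (u w)) + indicator E (A (v w)) * (B (u w) - A (v w)))
             - (indicator E (A (u w)) * (B (u w) - A (u w)) + indicator E (A (v w)) * (B (v w) - A (v w))) \<partial>\<rho>)"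
          using intD D_int'[OF ir(1) ir(2)] D_int'[OF ir(3) ir(4)] D_int'[OF ir(1) ir(4)] D_int'[OF ir(3) ir(2)]
          unfolding R_def S_def
          by (simp add: integral_add_measure D_int[OF ir(1) ir(2)] D_int[OF ir(3) ir(4)] D_int[OF ir(1) ir(4)] D_int[OF ir(3) ir(2)])
        also have "\<dots> = (\<integral>w. ?e w * (B (v w) - B (u w)) \<partial>\<rho>)"
          by (intro Bochner_Integration.integral_cong) (auto simp: algebra_simps)
        also have "\<dots> = (\<integral>w. r w * (?e w * (B (v w) - B (u w))) \<partial>unif)"
          unfolding \<rho>_def using r_pos by (subst integral_density) auto
        also have "\<dots> = (\<integral>w. M * ?e w \<partial>unif)"
        proof (rule integral_cong_AE)
          show "AE w in unif. r w * (?e w * (B (v w) - B (u w))) = M * ?e w"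
            using r
          proof eventually_elim
            case (elim w)
            have "r w * (?e w * (B (v w) - B (u w))) = (r w * (B (v w) - B (u w))) * ?e w"
              by (simp only: mult_ac)
            with elim show ?case by simp
          qed
        qed measurable
        also have "\<dots> = M * (\<integral>w. indicator E (A (u w)) \<partial>unif) - M * (\<integral>w. indicator E (A (v w)) \<partial>unif)"
        proof -
          have "integrable unif (\<lambda>w. indicator E (A (g w)) :: real)" if [measurable]: "g \<in> borel_measurable borel" for g
            by (rule U.integrable_const_bound[of _ 1]) (auto simp: indicator_def)
          then show ?thesis by (simp add: right_diff_distrib)
        qed
        also have "(\<integral>w. indicat_real E (A (u w)) \<partial>unif) = (\<integral>t. indicat_real E (A t) \<partial>distr unif borel u)"
          by (subst integral_distr) auto
        also have "\<dots> = (\<integral>t. (max (f t) 0 / M) * indicator E (A t) \<partial>unif)"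
          unfolding du using \<open>0 < M\<close> by (subst integral_density) auto
        also have "(\<integral>w. indicat_real E (A (v w)) \<partial>unif) = (\<integral>t. indicat_real E (A t) \<partial>distr unif borel v)"
          by (subst integral_distr) auto
        also have "\<dots> = (\<integral>t. (max (- f t) 0 / M) * indicator E (A t) \<partial>unif)"
          unfolding dv using \<open>0 < M\<close> by (subst integral_density) auto
        also have "M * (\<integral>t. (max (f t) 0 / M) * indicator E (A t) \<partial>unif) - M * (\<integral>t. (max (- f t) 0 / M) * indicator E (A t) \<partial>unif)
            = (\<integral>t. max (f t) 0 * indicator E (A t) \<partial>unif) - (\<integral>t. max (- f t) 0 * indicator E (A t) \<partial>unif)"
          using \<open>0 < M\<close> by simp
        also have "\<dots> = (\<integral>t. max (f t) 0 * indicator E (A t) - max (- f t) 0 * indicator E (A t) \<partial>unif)"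
        proof (rule Bochner_Integration.integral_diff[symmetric])
          have *: "integrable unif (\<lambda>t. g t * indicator E (A t))" if g: "integrable unif g" for g :: "real \<Rightarrow> real"
          proof (rule Bochner_Integration.integrable_bound[OF g])
            show "(\<lambda>t. g t * indicator E (A t)) \<in> borel_measurable unif" using g by measurable
          qed (auto simp: indicator_def)
          show "integrable unif (\<lambda>t. max (f t) 0 * indicator E (A t))" "integrable unif (\<lambda>t. max (- f t) 0 * indicator E (A t))"
            using intf by (auto intro!: *)
        qed
        also have "\<dots> = (\<integral>t. indicator E (A t) * f t \<partial>unif)"
          by (intro Bochner_Integration.integral_cong) (auto simp: indicator_def)
        finally show ?thesis .
      qed
      moreover have "(\<integral>p. ?F p \<partial>\<pi>\<^sub>0) = (\<integral>t. - (indicator E (A t) * f t) \<partial>unif)"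
        unfolding \<pi>\<^sub>0_def using pair_meas[of A B] F
        by (subst integral_distr) (auto simp: f_def algebra_simps intro!: Bochner_Integration.integral_cong)
      ultimately show ?thesis by simp
    qed
    with pi show thesis by (rule that)
  qed
qed

section \<open>Barycenters of kernels and Strassen's theorem\<close>

lemma disintegrationsD:
  assumes "K \<in> disintegrations \<eta> \<pi>"
  shows "K \<in> borel \<rightarrow>\<^sub>M prob_algebra borel"
    and "S \<in> sets borel \<Longrightarrow> emeasure \<pi> S = (\<integral>\<^sup>+x. (\<integral>\<^sup>+y. indicator S (x, y) \<partial>K x) \<partial>\<eta>)"
  using assms by (auto simp: disintegrations_def)

lemma prob_kernelD:
  assumes "K \<in> borel \<rightarrow>\<^sub>M prob_algebra (borel :: real measure)"
  shows "prob_space (K (x::real))" "sets (K x) = sets borel" "space (K x) = UNIV"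
  using measurable_space[OF assms, of x] sets_eq_imp_space_eq[of "K x" borel] by (auto simp: space_prob_algebra)

lemma couplingsD:
  assumes "\<pi> \<in> couplings \<eta> \<theta>"
  shows "sets \<pi> = sets borel" "sets \<eta> = sets borel" "sets \<theta> = sets borel"
    "distr \<pi> borel fst = \<eta>" "distr \<pi> borel snd = \<theta>"
  using assms by (auto simp: couplings_def)

lemma nn_integral_kernel_product:
  assumes K: "K \<in> borel \<rightarrow>\<^sub>M prob_algebra borel" and sets_eta [simp, measurable_cong]: "sets \<eta> = sets borel"
    and F: "F \<in> borel_measurable borel"
  shows "(\<integral>\<^sup>+p. F p \<partial>kernel_product \<eta> K) = (\<integral>\<^sup>+x. (\<integral>\<^sup>+y. F (x, y) \<partial>K x) \<partial>\<eta>)"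
proof -
  have "(\<integral>\<^sup>+p. F p \<partial>kernel_product \<eta> K) = (\<integral>\<^sup>+x. (\<integral>\<^sup>+p. F p \<partial>distr (K x) borel (\<lambda>y. (x, y))) \<partial>\<eta>)"
    unfolding kernel_product_def by (rule nn_integral_bind[OF F kernel_product_measurable[OF K sets_eta]])
  also have "\<dots> = (\<integral>\<^sup>+x. (\<integral>\<^sup>+y. F (x, y) \<partial>K x) \<partial>\<eta>)"
  proof (rule nn_integral_cong)
    fix x
    have "(\<lambda>y. (x, y)) \<in> K x \<rightarrow>\<^sub>M borel"
      using prob_kernelD[OF K, of x] by (intro borel_measurable_Pair) (simp_all cong: measurable_cong_sets)
    then show "(\<integral>\<^sup>+p. F p \<partial>distr (K x) borel (\<lambda>y. (x, y))) = (\<integral>\<^sup>+y. F (x, y) \<partial>K x)"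
      using F by (subst nn_integral_distr) simp_all
  qed
  finally show ?thesis .
qed

lemma disintegration_eq_kernel_product:
  assumes "\<pi> \<in> couplings \<eta> \<theta>" "K \<in> disintegrations \<eta> \<pi>"
  shows "\<pi> = kernel_product \<eta> K"
  using couplingsD[OF assms(1)] disintegrationsD[OF assms(2)]
  by (intro measure_eqI) (auto simp: sets_kernel_product emeasure_kernel_product)

text \<open>Couplings together with a disintegration are the same thing as kernels that carry \<open>\<eta>\<close> to \<open>\<theta>\<close>;
with the converse \<open>second_marginal_bind\<close> below, one can work with kernels only.\<close>

lemma coupling_of_kernel:
  assumes K: "K \<in> borel \<rightarrow>\<^sub>M prob_algebra borel" and sets_eta [simp]: "sets \<eta> = sets borel"
  shows "kernel_product \<eta> K \<in> couplings \<eta> (\<eta> \<bind> K)" "K \<in> disintegrations \<eta> (kernel_product \<eta> K)"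
proof -
  let ?P = "kernel_product \<eta> K"
  note [simp] = sets_kernel_product[OF K sets_eta]
  have [simp]: "space ?P = UNIV" "space \<eta> = UNIV"
    using sets_eq_imp_space_eq[of ?P borel] sets_eq_imp_space_eq[of \<eta> borel] by simp_all
  have K': "K \<in> \<eta> \<rightarrow>\<^sub>M subprob_algebra borel"
    using measurable_prob_algebraD[OF K] by (simp cong: measurable_cong_sets)
  have fst_snd: "(fst :: real \<times> real \<Rightarrow> real) \<in> borel_measurable borel" "(snd :: real \<times> real \<Rightarrow> real) \<in> borel_measurable borel"
    unfolding borel_prod[symmetric] by measurable
  note fst_snd' = fst_snd[THEN measurable_sets, simplified]
  have fs: "fst \<in> borel_measurable ?P" "snd \<in> borel_measurable ?P"
    using fst_snd by (simp_all cong: measurable_cong_sets)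
  have "distr ?P borel fst = \<eta>"
  proof (rule measure_eqI)
    fix X assume "X \<in> sets (distr ?P borel fst)"
    then have X: "X \<in> sets borel" by simp
    have "emeasure (distr ?P borel fst) X = emeasure ?P (fst -` X)"
      using X fs by (simp add: emeasure_distr)
    also have "\<dots> = (\<integral>\<^sup>+x. (\<integral>\<^sup>+y. indicator X x \<partial>K x) \<partial>\<eta>)"
      using X by (subst emeasure_kernel_product[OF K]) (auto intro!: fst_snd' nn_integral_cong simp: indicator_def)
    also have "\<dots> = (\<integral>\<^sup>+x. indicator X x \<partial>\<eta>)"
      using prob_space.emeasure_space_1[OF prob_kernelD(1)[OF K]] by (intro nn_integral_cong) simp
    finally show "emeasure (distr ?P borel fst) X = emeasure \<eta> X" using X by simp
  qed simp
  moreover have "distr ?P borel snd = \<eta> \<bind> K"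
  proof (rule measure_eqI)
    show "sets (distr ?P borel snd) = sets (\<eta> \<bind> K)"
      using prob_kernelD(2)[OF K] by (subst sets_bind[where N=borel]) auto
    fix X assume "X \<in> sets (distr ?P borel snd)"
    then have X: "X \<in> sets borel" by simp
    have "emeasure (distr ?P borel snd) X = emeasure ?P (snd -` X)"
      using X fs by (simp add: emeasure_distr)
    also have "\<dots> = (\<integral>\<^sup>+x. (\<integral>\<^sup>+y. indicator X y \<partial>K x) \<partial>\<eta>)"
      using X by (subst emeasure_kernel_product[OF K]) (auto intro!: fst_snd' nn_integral_cong simp: indicator_def)
    also have "\<dots> = emeasure (\<eta> \<bind> K) X"
      using X K' prob_kernelD(2)[OF K] by (subst emeasure_bind[where N=borel]) auto
    finally show "emeasure (distr ?P borel snd) X = emeasure (\<eta> \<bind> K) X" .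
  qed
  ultimately show "?P \<in> couplings \<eta> (\<eta> \<bind> K)" by (simp add: couplings_def)
  show "K \<in> disintegrations \<eta> ?P"
    using K emeasure_kernel_product[OF K] by (simp add: disintegrations_def)
qed

lemma second_marginal_bind:
  assumes "\<pi> \<in> couplings \<eta> \<theta>" "K \<in> disintegrations \<eta> \<pi>"
  shows "\<theta> = \<eta> \<bind> K"
  using coupling_of_kernel(1)[OF disintegrationsD(1)[OF assms(2)] couplingsD(2)[OF assms(1)]]
    disintegration_eq_kernel_product[OF assms] couplingsD(5)[OF assms(1)] by (simp add: couplings_def)

lemma nn_integral_bind_kernel:
  assumes K: "K \<in> borel \<rightarrow>\<^sub>M prob_algebra borel" and "sets \<eta> = sets borel" and "f \<in> borel_measurable borel"
  shows "(\<integral>\<^sup>+y. f y \<partial>(\<eta> \<bind> K)) = (\<integral>\<^sup>+x. (\<integral>\<^sup>+y. f y \<partial>K x) \<partial>\<eta>)"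
  using assms measurable_prob_algebraD[OF K]
  by (intro nn_integral_bind[where B=borel]) (simp_all cong: measurable_cong_sets)

lemma measurable_barycenter:
  assumes "K \<in> borel \<rightarrow>\<^sub>M prob_algebra borel"
  shows "barycenter K \<in> borel_measurable borel"
  unfolding barycenter_def
  by (rule measurable_compose[OF measurable_prob_algebraD[OF assms] integral_measurable_subprob_algebra]) simp

context
  fixes \<eta> \<theta> :: "real measure" and K :: "real \<Rightarrow> real measure"
  assumes K: "K \<in> borel \<rightarrow>\<^sub>M prob_algebra borel" and sets_eta [simp, measurable_cong]: "sets \<eta> = sets borel"
    and bind: "\<theta> = \<eta> \<bind> K" and int_theta: "integrable \<theta> (\<lambda>y. y)"
begin

lemma AE_kernel_integrable: "AE x in \<eta>. integrable (K x) (\<lambda>y. y)"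
proof -
  have m: "(\<lambda>x. \<integral>\<^sup>+y. ennreal \<bar>y\<bar> \<partial>K x) \<in> borel_measurable \<eta>"
    using measurable_compose[OF measurable_prob_algebraD[OF K] nn_integral_measurable_subprob_algebra, of "\<lambda>y. ennreal \<bar>y\<bar>"]
    by (simp cong: measurable_cong_sets)
  have "(\<integral>\<^sup>+x. (\<integral>\<^sup>+y. ennreal \<bar>y\<bar> \<partial>K x) \<partial>\<eta>) = (\<integral>\<^sup>+y. ennreal \<bar>y\<bar> \<partial>\<theta>)"
    unfolding bind by (rule nn_integral_bind_kernel[symmetric]) (use K in auto)
  also have "\<dots> < \<infinity>" using int_theta by (simp add: integrable_iff_bounded)
  finally have "AE x in \<eta>. (\<integral>\<^sup>+y. ennreal \<bar>y\<bar> \<partial>K x) \<noteq> \<infinity>"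
    using m by (intro nn_integral_PInf_AE) auto
  then show ?thesis
  proof eventually_elim
    case (elim x)
    then show ?case using prob_kernelD[OF K, of x]
      by (auto simp: integrable_iff_bounded less_top[symmetric] cong: measurable_cong_sets)
  qed
qed

lemma
  assumes [measurable]: "E \<in> sets borel"
  shows integrable_barycenter: "integrable \<eta> (\<lambda>x. indicator E x * barycenter K x)"
    and integral_barycenter: "(\<integral>x. indicator E x * barycenter K x \<partial>\<eta>) = (\<integral>p. indicator E (fst p) * snd p \<partial>kernel_product \<eta> K)"
proof -
  let ?\<pi> = "kernel_product \<eta> K"
  note [measurable_cong] = sets_kernel_product[OF K sets_eta]
  have m: "(\<lambda>x. \<integral>\<^sup>+y. f y \<partial>K x) \<in> borel_measurable \<eta>" if "f \<in> borel_measurable borel" for f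
    using measurable_compose[OF measurable_prob_algebraD[OF K] nn_integral_measurable_subprob_algebra[OF that]]
    by (simp cong: measurable_cong_sets)
  have [measurable]: "barycenter K \<in> borel_measurable borel" by (rule measurable_barycenter[OF K])
  have F: "(\<lambda>p::real\<times>real. indicator E (fst p) * snd p :: real) \<in> borel_measurable borel"
    unfolding borel_prod[symmetric] by measurable
  define p where "p s x = (\<integral>\<^sup>+y. ennreal (s * y) \<partial>K x)" for s :: real and x
  have [measurable]: "p s \<in> borel_measurable \<eta>" for s unfolding p_def by (rule m) measurable
  have p_prod: "(\<integral>\<^sup>+x. indicator E x * p s x \<partial>\<eta>) = (\<integral>\<^sup>+q. ennreal (s * (indicator E (fst q) * snd q)) \<partial>?\<pi>)" for s
  proof -
    have "(\<integral>\<^sup>+q. ennreal (s * (indicator E (fst q) * snd q)) \<partial>?\<pi>) = (\<integral>\<^sup>+x. (\<integral>\<^sup>+y. ennreal (s * (indicator E x * y)) \<partial>K x) \<partial>\<eta>)"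
      using F by (subst nn_integral_kernel_product[OF K sets_eta]) auto
    also have "\<dots> = (\<integral>\<^sup>+x. indicator E x * p s x \<partial>\<eta>)"
      by (intro nn_integral_cong) (auto simp: p_def indicator_def)
    finally show ?thesis by simp
  qed
  have p_fin: "(\<integral>\<^sup>+x. p s x \<partial>\<eta>) < \<infinity>" for s
  proof -
    have "(\<integral>\<^sup>+x. p s x \<partial>\<eta>) = (\<integral>\<^sup>+y. ennreal (s * y) \<partial>\<theta>)"
      unfolding bind p_def by (rule nn_integral_bind_kernel[symmetric]) (use K in auto)
    also have "\<dots> < \<infinity>"
      using integrableD(2)[OF integrable_mult_right[OF int_theta, of s]] by (simp add: less_top)
    finally show ?thesis .
  qed
  have AE_fin: "AE x in \<eta>. p s x \<noteq> \<infinity>" for s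
    using p_fin[of s] by (intro nn_integral_PInf_AE) auto
  have bary: "AE x in \<eta>. barycenter K x = enn2real (p 1 x) - enn2real (p (-1) x)"
    using AE_kernel_integrable by eventually_elim (simp add: barycenter_def real_lebesgue_integral_def p_def)
  have int: "integrable \<eta> (\<lambda>x. indicator E x * enn2real (p s x))" for s
    unfolding integrable_iff_bounded
  proof safe
    have "(\<integral>\<^sup>+x. ennreal (norm (indicator E x * enn2real (p s x))) \<partial>\<eta>) \<le> (\<integral>\<^sup>+x. p s x \<partial>\<eta>)"
      using AE_fin[of s] by (intro nn_integral_mono_AE, eventually_elim) (auto simp: indicator_def less_top[symmetric])
    then show "(\<integral>\<^sup>+x. ennreal (norm (indicator E x * enn2real (p s x))) \<partial>\<eta>) < \<infinity>"
      using p_fin[of s] by (rule le_less_trans)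
  qed measurable
  have eq: "(\<integral>x. indicator E x * enn2real (p s x) \<partial>\<eta>) = enn2real (\<integral>\<^sup>+q. ennreal (s * (indicator E (fst q) * snd q)) \<partial>?\<pi>)" for s
  proof -
    have "(\<integral>x. indicator E x * enn2real (p s x) \<partial>\<eta>) = enn2real (\<integral>\<^sup>+x. ennreal (indicator E x * enn2real (p s x)) \<partial>\<eta>)"
      by (rule integral_eq_nn_integral) auto
    also have "(\<integral>\<^sup>+x. ennreal (indicator E x * enn2real (p s x)) \<partial>\<eta>) = (\<integral>\<^sup>+x. indicator E x * p s x \<partial>\<eta>)"
      using AE_fin[of s] by (intro nn_integral_cong_AE, eventually_elim) (auto simp: indicator_def less_top[symmetric])
    finally show ?thesis by (simp add: p_prod)
  qed
  have bary': "AE x in \<eta>. indicator E x * barycenter K x = indicator E x * enn2real (p 1 x) - indicator E x * enn2real (p (-1) x)"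
    using bary by eventually_elim (simp add: right_diff_distrib)
  have "integrable \<eta> (\<lambda>x. indicator E x * enn2real (p 1 x) - indicator E x * enn2real (p (-1) x))"
    using int by auto
  then show "integrable \<eta> (\<lambda>x. indicator E x * barycenter K x)"
    by (subst integrable_cong_AE[OF _ _ bary']) auto
  have "(\<integral>x. indicator E x * barycenter K x \<partial>\<eta>) = (\<integral>x. indicator E x * enn2real (p 1 x) - indicator E x * enn2real (p (-1) x) \<partial>\<eta>)"
    by (rule integral_cong_AE) (use bary' in auto)
  also have "\<dots> = enn2real (\<integral>\<^sup>+q. ennreal (1 * (indicator E (fst q) * snd q)) \<partial>?\<pi>) - enn2real (\<integral>\<^sup>+q. ennreal (- 1 * (indicator E (fst q) * snd q)) \<partial>?\<pi>)"
    using int by (simp only: Bochner_Integration.integral_diff eq)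
  also have "\<dots> = (\<integral>p. indicator E (fst p) * snd p \<partial>?\<pi>)"
  proof (subst real_lebesgue_integral_def)
    have fin: "(\<integral>\<^sup>+q. ennreal (s * (indicator E (fst q) * snd q)) \<partial>?\<pi>) < \<infinity>" for s
      unfolding p_prod[symmetric]
      by (rule le_less_trans[OF nn_integral_mono p_fin[of s]]) (auto simp: indicator_def)
    have "(\<integral>\<^sup>+q. ennreal \<bar>indicator E (fst q) * snd q\<bar> \<partial>?\<pi>)
      = (\<integral>\<^sup>+q. ennreal (1 * (indicator E (fst q) * snd q)) + ennreal (- 1 * (indicator E (fst q) * snd q)) \<partial>?\<pi>)"
      by (intro nn_integral_cong) (auto simp: abs_if ennreal_neg)
    also have "\<dots> < \<infinity>" using fin[of 1] fin[of "-1"] F by (subst nn_integral_add) auto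
    finally show "integrable ?\<pi> (\<lambda>p. indicator E (fst p) * snd p)"
      using F by (simp add: integrable_iff_bounded cong: measurable_cong_sets)
  qed simp
  finally show "(\<integral>x. indicator E x * barycenter K x \<partial>\<eta>) = (\<integral>p. indicator E (fst p) * snd p \<partial>?\<pi>)" .
qed

lemma integrable_barycenter_UNIV: "integrable \<eta> (barycenter K)"
  using integrable_barycenter[of UNIV] by simp

text \<open>Jensen's inequality on each \<open>K x\<close>. With \<open>s = - 1\<close> and \<open>s = 1\<close> it compares put and call potentials:
the law of the barycenter precedes \<open>\<theta>\<close> in convex order.\<close>

lemma barycenter_jensen:
  assumes "finite_measure \<eta>"
  shows "(\<integral>x. max (c + s * barycenter K x) 0 \<partial>\<eta>) \<le> (\<integral>y. max (c + s * y) 0 \<partial>\<theta>)"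
proof -
  interpret eta: finite_measure \<eta> by fact
  have m: "(\<lambda>x. \<integral>\<^sup>+y. f y \<partial>K x) \<in> borel_measurable \<eta>" if "f \<in> borel_measurable borel" for f
    using measurable_compose[OF measurable_prob_algebraD[OF K] nn_integral_measurable_subprob_algebra[OF that]]
    by (simp cong: measurable_cong_sets)
  have fin: "finite_measure \<theta>"
  proof (rule finite_measureI)
    have "emeasure \<theta> (space \<theta>) = (\<integral>\<^sup>+y. 1 \<partial>\<theta>)" by simp
    also have "\<dots> = (\<integral>\<^sup>+x. (\<integral>\<^sup>+y. 1 \<partial>K x) \<partial>\<eta>)"
      unfolding bind by (rule nn_integral_bind_kernel) (use K in auto)
    also have "\<dots> = (\<integral>\<^sup>+x. 1 \<partial>\<eta>)" using prob_space.emeasure_space_1[OF prob_kernelD(1)[OF K]] by simp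
    finally show "emeasure \<theta> (space \<theta>) \<noteq> \<infinity>" by simp
  qed
  interpret theta: finite_measure \<theta> by (rule fin)
  have "ennreal (\<integral>x. max (c + s * barycenter K x) 0 \<partial>\<eta>) = (\<integral>\<^sup>+x. ennreal (max (c + s * barycenter K x) 0) \<partial>\<eta>)"
    using integrable_barycenter_UNIV by (intro nn_integral_eq_integral[symmetric]) auto
  also have "\<dots> \<le> (\<integral>\<^sup>+x. (\<integral>\<^sup>+y. ennreal (max (c + s * y) 0) \<partial>K x) \<partial>\<eta>)"
    using AE_kernel_integrable
  proof (intro nn_integral_mono_AE, eventually_elim)
    case (elim x)
    interpret Kx: prob_space "K x" by (rule prob_kernelD[OF K])
    have "c + s * barycenter K x = (\<integral>y. c + s * y \<partial>K x)"
      using elim Kx.prob_space by (simp add: barycenter_def)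
    also have "\<dots> \<le> (\<integral>y. max (c + s * y) 0 \<partial>K x)"
      using elim by (intro integral_mono) auto
    finally have "max (c + s * barycenter K x) 0 \<le> (\<integral>y. max (c + s * y) 0 \<partial>K x)"
      by (simp add: Bochner_Integration.integral_nonneg)
    also have "ennreal \<dots> = (\<integral>\<^sup>+y. ennreal (max (c + s * y) 0) \<partial>K x)"
      using elim by (intro nn_integral_eq_integral[symmetric]) auto
    finally show ?case by (simp add: ennreal_leI)
  qed
  also have "\<dots> = (\<integral>\<^sup>+y. ennreal (max (c + s * y) 0) \<partial>\<theta>)"
    unfolding bind by (rule nn_integral_bind_kernel[symmetric]) (use K in auto)
  also have "\<dots> = ennreal (\<integral>y. max (c + s * y) 0 \<partial>\<theta>)"
    using int_theta by (intro nn_integral_eq_integral) auto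
  finally show ?thesis by (simp add: ennreal_le_iff Bochner_Integration.integral_nonneg)
qed

end

text \<open>Normalize to probability measures and disintegrate the martingale coupling. The null measure
cannot be normalized; every kernel carries it to itself.\<close>

theorem strassen_kernel:
  assumes eta: "\<eta> \<in> finite_first_moment" and theta: "\<theta> \<in> finite_first_moment"
    and mass: "measure \<eta> UNIV = measure \<theta> UNIV"
    and mean: "(\<integral>x. x \<partial>\<eta>) = (\<integral>x. x \<partial>\<theta>)"
    and le: "\<And>k. put_pot \<eta> k \<le> put_pot \<theta> k"
  obtains K where "K \<in> borel \<rightarrow>\<^sub>M prob_algebra borel" "\<theta> = \<eta> \<bind> K" "AE x in \<eta>. barycenter K x = x"
proof -
  have [simp, measurable_cong]: "sets \<eta> = sets borel" "sets \<theta> = sets borel"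
    and int: "integrable \<eta> (\<lambda>x. x)" "integrable \<theta> (\<lambda>x. x)"
    and fin: "finite_measure \<eta>" "finite_measure \<theta>"
    using eta theta by (auto simp: finite_first_moment_def)
  have [simp]: "space \<eta> = UNIV" "space \<theta> = UNIV"
    using sets_eq_imp_space_eq[of \<eta> borel] sets_eq_imp_space_eq[of \<theta> borel] by simp_all
  interpret eta: finite_measure \<eta> by fact
  interpret theta: finite_measure \<theta> by fact
  define m where "m = measure \<eta> UNIV"
  have em: "emeasure \<eta> UNIV = ennreal m" "emeasure \<theta> UNIV = ennreal m"
    using mass by (simp_all add: m_def eta.emeasure_eq_measure theta.emeasure_eq_measure)
  show thesis
  proof (cases "m = 0")
    case True
    then have null: "emeasure \<eta> X = 0" "emeasure \<theta> X = 0" if "X \<in> sets borel" for X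
      using em emeasure_mono[of X UNIV \<eta>] emeasure_mono[of X UNIV \<theta>] that by auto
    have K: "return borel \<in> borel \<rightarrow>\<^sub>M prob_algebra (borel::real measure)"
      by (rule measurable_prob_algebraI) (auto intro: prob_space_return)
    have AE: "AE x in \<eta>. P x" for P
      using null(1)[of UNIV] by (intro AE_I[of _ _ UNIV]) auto
    have K': "return borel \<in> \<eta> \<rightarrow>\<^sub>M subprob_algebra (borel::real measure)"
      using measurable_prob_algebraD[OF K] by (simp cong: measurable_cong_sets)
    have "\<theta> = \<eta> \<bind> return borel"
    proof (rule measure_eqI)
      fix X assume "X \<in> sets \<theta>"
      then have X: "X \<in> sets borel" by simp
      have "emeasure (\<eta> \<bind> return borel) X = (\<integral>\<^sup>+x. emeasure (return borel x) X \<partial>\<eta>)"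
        using X K' by (intro emeasure_bind) auto
      also have "\<dots> = (\<integral>\<^sup>+x. 0 \<partial>\<eta>)" by (rule nn_integral_cong_AE) (rule AE)
      finally show "emeasure \<theta> X = emeasure (\<eta> \<bind> return borel) X" using X null by simp
    qed (use K' in \<open>subst sets_bind[where N=borel]; simp\<close>)
    with K AE show thesis by (intro that[of "return borel"]) auto
  next
    case False
    then have "0 < m" by (simp add: m_def zero_less_measure_iff)
    define c where "c = 1 / m"
    have "0 < c" using \<open>0 < m\<close> by (simp add: c_def)
    define \<eta>' where "\<eta>' = density \<eta> (\<lambda>_. ennreal c)"
    define \<theta>' where "\<theta>' = density \<theta> (\<lambda>_. ennreal c)"
    have rd: "real_distribution \<eta>'" "real_distribution \<theta>'"
      unfolding real_distribution_def real_distribution_axioms_def \<eta>'_def \<theta>'_def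
      using \<open>0 < m\<close> by (auto intro!: prob_spaceI simp: emeasure_density em c_def ennreal_mult[symmetric])
    have int': "integrable \<eta>' (\<lambda>x. x)" "integrable \<theta>' (\<lambda>x. x)"
      unfolding \<eta>'_def \<theta>'_def using int \<open>0 < c\<close>
      by (auto intro!: integrable_density[THEN iffD2])
    have sc: "(\<integral>x. g x \<partial>\<eta>') = c * (\<integral>x. g x \<partial>\<eta>)" "(\<integral>x. g x \<partial>\<theta>') = c * (\<integral>x. g x \<partial>\<theta>)"
      if "g \<in> borel_measurable borel" for g :: "real \<Rightarrow> real"
      unfolding \<eta>'_def \<theta>'_def using that \<open>0 < c\<close> by (subst integral_density; simp)+
    obtain \<pi> where pi: "\<pi> \<in> couplings \<eta>' \<theta>'"
      and mart: "\<And>E. E \<in> sets borel \<Longrightarrow> (\<integral>p. indicator E (fst p) * (snd p - fst p) \<partial>\<pi>) = 0"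
    proof (rule martingale_coupling_prob[OF rd(1) int'(1) rd(2) int'(2)])
      show "put_pot \<eta>' k \<le> put_pot \<theta>' k" for k
        using le[of k] \<open>0 < c\<close> unfolding put_pot_def by (simp add: sc)
    qed (use mean in \<open>auto simp: sc\<close>)
    interpret eta': real_distribution \<eta>' by (rule rd)
    note sets_pi [measurable_cong] = couplingsD(1)[OF pi]
    have fst_snd: "fst \<in> borel_measurable \<pi>" "snd \<in> borel_measurable \<pi>"
      unfolding measurable_cong_sets[OF sets_pi refl] borel_prod[symmetric] by measurable
    have "finite_measure \<pi>"
    proof (rule finite_measureI)
      have "emeasure \<pi> (space \<pi>) = emeasure (distr \<pi> borel fst) UNIV"
        using fst_snd by (simp add: emeasure_distr)
      then show "emeasure \<pi> (space \<pi>) \<noteq> \<infinity>" by (simp add: couplingsD(4)[OF pi])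
    qed
    then obtain K where KD: "K \<in> disintegrations \<eta>' \<pi>"
      using disintegration_exists[OF sets_pi _ couplingsD(4)[OF pi, symmetric]] by blast
    note K = disintegrationsD(1)[OF KD]
    note bind' = second_marginal_bind[OF pi KD]
    have K_eta: "K \<in> \<eta> \<rightarrow>\<^sub>M subprob_algebra borel"
      using measurable_prob_algebraD[OF K] by (simp cong: measurable_cong_sets)
    have "\<theta> = \<eta> \<bind> K"
    proof (rule measure_eqI)
      show "sets \<theta> = sets (\<eta> \<bind> K)"
        using prob_kernelD(2)[OF K] by (subst sets_bind[where N=borel]) auto
      fix X assume "X \<in> sets \<theta>"
      then have X: "X \<in> sets borel" by simp
      have m: "(\<lambda>x. emeasure (K x) X) \<in> borel_measurable \<eta>"
        using K_eta X by measurable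
      have "ennreal c * emeasure \<theta> X = emeasure \<theta>' X"
        using X by (simp add: \<theta>'_def emeasure_density nn_integral_cmult_indicator)
      also have "\<dots> = (\<integral>\<^sup>+x. emeasure (K x) X \<partial>\<eta>')"
        unfolding bind' using X measurable_prob_algebraD[OF K]
        by (intro emeasure_bind[where N=borel]) (auto simp: \<eta>'_def cong: measurable_cong_sets)
      also have "\<dots> = ennreal c * (\<integral>\<^sup>+x. emeasure (K x) X \<partial>\<eta>)"
        using m unfolding \<eta>'_def by (simp add: nn_integral_density nn_integral_cmult)
      also have "(\<integral>\<^sup>+x. emeasure (K x) X \<partial>\<eta>) = emeasure (\<eta> \<bind> K) X"
        using K_eta X by (intro emeasure_bind[symmetric]) auto
      finally show "emeasure \<theta> X = emeasure (\<eta> \<bind> K) X"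
        using \<open>0 < c\<close> by (simp add: ennreal_mult_cancel_left)
    qed
    moreover have "AE x in \<eta>'. barycenter K x - x = 0"
    proof (rule eta'.density_zero)
      note ib = integrable_barycenter[OF K eta'.events_eq_borel bind' int'(2)]
        and eb = integral_barycenter[OF K eta'.events_eq_borel bind' int'(2)]
      show "integrable \<eta>' (\<lambda>x. barycenter K x - x)"
        using ib[of UNIV] int' by simp
      fix E assume "E \<in> sets \<eta>'"
      then have E [measurable]: "E \<in> sets borel" by simp
      have intx: "integrable \<eta>' (\<lambda>x. indicator E x * x)"
        using integrable_real_mult_indicator[OF _ int'(1), of E] by (simp add: mult.commute)
      have intp: "integrable \<pi> (\<lambda>p. indicator E (g p) * g' p)"
        if g: "g \<in> borel_measurable \<pi>" "integrable \<pi> g'" for g g' :: "real \<times> real \<Rightarrow> real"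
      proof (rule Bochner_Integration.integrable_bound[OF g(2)])
        show "(\<lambda>p. indicator E (g p) * g' p) \<in> borel_measurable \<pi>" using g by measurable
      qed (auto simp: indicator_def)
      have intfs: "integrable \<pi> fst" "integrable \<pi> snd"
        using integrable_distr[OF fst_snd(1), of "\<lambda>x. x"] integrable_distr[OF fst_snd(2), of "\<lambda>x. x"] int'
        by (simp_all add: couplingsD(4,5)[OF pi])
      have "(\<integral>x\<in>E. barycenter K x - x \<partial>\<eta>') = (\<integral>x. indicator E x * barycenter K x \<partial>\<eta>') - (\<integral>x. indicator E x * x \<partial>\<eta>')"
        using ib[OF E] intx unfolding set_lebesgue_integral_def
        by (subst Bochner_Integration.integral_diff[symmetric]) (auto simp: algebra_simps)
      also have "(\<integral>x. indicator E x * x \<partial>\<eta>') = (\<integral>p. indicator E (fst p) * fst p \<partial>\<pi>)"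
        using integral_distr[OF fst_snd(1), of "\<lambda>x. indicator E x * x :: real"] by (simp add: couplingsD(4)[OF pi])
      also have "(\<integral>x. indicator E x * barycenter K x \<partial>\<eta>') = (\<integral>p. indicator E (fst p) * snd p \<partial>\<pi>)"
        using eb[OF E] disintegration_eq_kernel_product[OF pi KD] by simp
      also have "\<dots> - (\<integral>p. indicator E (fst p) * fst p \<partial>\<pi>) = (\<integral>p. indicator E (fst p) * (snd p - fst p) \<partial>\<pi>)"
        using intp[OF fst_snd(1) intfs(1)] intp[OF fst_snd(1) intfs(2)]
        by (subst Bochner_Integration.integral_diff[symmetric]) (auto simp: algebra_simps)
      finally show "(\<integral>x\<in>E. barycenter K x - x \<partial>\<eta>') = 0" using mart[OF E] by simp
    qed
    then have "AE x in \<eta>. barycenter K x = x"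
      unfolding \<eta>'_def using \<open>0 < c\<close> by (subst (asm) AE_density) auto
    ultimately show thesis using K by (intro that)
  qed
qed

section \<open>Potentials and their points of contact\<close>

lemma integral_excess_tendsto:
  fixes X :: "'a \<Rightarrow> real"
  assumes X: "integrable N X"
  shows "((\<lambda>c. \<integral>x. max (X x - c) 0 \<partial>N) \<longlongrightarrow> 0) at_top"
proof -
  have "((\<lambda>c. \<integral>x. max (X x - c) 0 \<partial>N) \<longlongrightarrow> (\<integral>x. 0 \<partial>N)) at_top"
  proof (rule integral_dominated_convergence_at_top[where w="\<lambda>x. \<bar>X x\<bar>"])
    show "eventually (\<lambda>c. AE x in N. norm (max (X x - c) 0) \<le> \<bar>X x\<bar>) at_top"
      using eventually_ge_at_top[of 0] by eventually_elim (rule AE_I2, auto)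
    show "AE x in N. ((\<lambda>c. max (X x - c) 0) \<longlongrightarrow> 0) at_top"
    proof (rule AE_I2)
      fix x
      have "eventually (\<lambda>c. max (X x - c) 0 = 0) at_top"
        using eventually_ge_at_top[of "X x"] by eventually_elim auto
      then show "((\<lambda>c. max (X x - c) 0) \<longlongrightarrow> 0) at_top" by (rule tendsto_eventually)
    qed
  qed (use X in auto)
  then show ?thesis by simp
qed

context
  fixes \<mu> :: "real measure"
  assumes mu: "\<mu> \<in> finite_first_moment"
begin

interpretation finite_borel_measure \<mu> by (rule finite_first_momentD(5)[OF mu])

lemma integrable_put: "integrable \<mu> (\<lambda>x. max (k - x) 0)"
  and integrable_call: "integrable \<mu> (\<lambda>x. max (x - k) 0)"
  using finite_first_momentD(4)[OF mu] by auto

lemma put_call_parity: "put_pot \<mu> k = call_pot \<mu> k + (k * measure \<mu> UNIV - (\<integral>x. x \<partial>\<mu>))"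
proof -
  have "put_pot \<mu> k = (\<integral>x. max (x - k) 0 + (k - x) \<partial>\<mu>)"
    unfolding put_pot_def by (intro Bochner_Integration.integral_cong) auto
  also have "\<dots> = call_pot \<mu> k + (\<integral>x. k - x \<partial>\<mu>)"
    unfolding call_pot_def using finite_first_momentD(4)[OF mu] by (intro Bochner_Integration.integral_add) auto
  also have "(\<integral>x. k - x \<partial>\<mu>) = k * measure \<mu> UNIV - (\<integral>x. x \<partial>\<mu>)"
    using finite_first_momentD(2,4)[OF mu] by simp
  finally show ?thesis .
qed

lemma put_pot_nonneg: "0 \<le> put_pot \<mu> k" and call_pot_nonneg: "0 \<le> call_pot \<mu> k"
  unfolding put_pot_def call_pot_def by (auto intro!: Bochner_Integration.integral_nonneg)

lemma put_pot_mono: "k \<le> l \<Longrightarrow> put_pot \<mu> k \<le> put_pot \<mu> l"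
  and call_pot_antimono: "k \<le> l \<Longrightarrow> call_pot \<mu> l \<le> call_pot \<mu> k"
  unfolding put_pot_def call_pot_def
  by (auto intro!: integral_mono integrable_put integrable_call)

text \<open>The integrand \<open>(l - x)\<^sup>+ - (k - x)\<^sup>+\<close> lies between \<open>l - k\<close> on \<open>x \<le> k\<close> and \<open>l - k\<close> on \<open>x < l\<close>. This
sandwich yields continuity and both one-sided derivatives of the potential.\<close>

lemma put_pot_increment:
  assumes "k \<le> l"
  shows "(l - k) * measure \<mu> {..k} \<le> put_pot \<mu> l - put_pot \<mu> k"
    and "put_pot \<mu> l - put_pot \<mu> k \<le> (l - k) * measure \<mu> {..<l}"
proof -
  have eq: "put_pot \<mu> l - put_pot \<mu> k = (\<integral>x. max (l - x) 0 - max (k - x) 0 \<partial>\<mu>)"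
    unfolding put_pot_def by (rule Bochner_Integration.integral_diff[symmetric]) (rule integrable_put)+
  have int: "integrable \<mu> (\<lambda>x. max (l - x) 0 - max (k - x) 0)"
    by (intro Bochner_Integration.integrable_diff integrable_put)
  have ind: "integrable \<mu> (\<lambda>x. (l - k) * indicator A x)" if "A \<in> sets borel" for A
    using that by (intro integrable_mult_right integrable_real_indicator) (auto simp: less_top[symmetric])
  have "(l - k) * measure \<mu> {..k} = (\<integral>x. (l - k) * indicator {..k} x \<partial>\<mu>)"
    by (simp add: finite_first_momentD(2)[OF mu])
  also have "\<dots> \<le> (\<integral>x. max (l - x) 0 - max (k - x) 0 \<partial>\<mu>)"
    using assms by (intro integral_mono ind int) (auto simp: indicator_def)
  finally show "(l - k) * measure \<mu> {..k} \<le> put_pot \<mu> l - put_pot \<mu> k" unfolding eq .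
  have "(\<integral>x. max (l - x) 0 - max (k - x) 0 \<partial>\<mu>) \<le> (\<integral>x. (l - k) * indicator {..<l} x \<partial>\<mu>)"
    using assms by (intro integral_mono ind int) (auto simp: indicator_def)
  also have "\<dots> = (l - k) * measure \<mu> {..<l}" by (simp add: finite_first_momentD(2)[OF mu])
  finally show "put_pot \<mu> l - put_pot \<mu> k \<le> (l - k) * measure \<mu> {..<l}" unfolding eq .
qed

lemma put_pot_slope_left:
  "((\<lambda>k. (put_pot \<mu> k - put_pot \<mu> a) / (k - a)) \<longlongrightarrow> measure \<mu> {..<a}) (at_left a)"
proof (rule tendsto_sandwich)
  have "measure \<mu> {..k} \<le> (put_pot \<mu> k - put_pot \<mu> a) / (k - a)"
    "(put_pot \<mu> k - put_pot \<mu> a) / (k - a) \<le> measure \<mu> {..<a}" if "k < a" for k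
    using put_pot_increment[of k a] that
    by (simp_all add: neg_le_divide_eq neg_divide_le_eq) (simp_all add: algebra_simps)
  then show "eventually (\<lambda>k. cdf \<mu> k \<le> (put_pot \<mu> k - put_pot \<mu> a) / (k - a)) (at_left a)"
    "eventually (\<lambda>k. (put_pot \<mu> k - put_pot \<mu> a) / (k - a) \<le> measure \<mu> {..<a}) (at_left a)"
    by (auto simp: eventually_at_filter cdf_def)
qed (use cdf_at_left in auto)

lemma put_pot_slope_right:
  "((\<lambda>k. (put_pot \<mu> k - put_pot \<mu> a) / (k - a)) \<longlongrightarrow> measure \<mu> {..a}) (at_right a)"
proof (rule tendsto_sandwich)
  show "eventually (\<lambda>k. measure \<mu> {..a} \<le> (put_pot \<mu> k - put_pot \<mu> a) / (k - a)) (at_right a)"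
    using put_pot_increment(1)[of a]
    by (auto simp: eventually_at_filter pos_le_divide_eq mult.commute)
  have "put_pot \<mu> k - put_pot \<mu> a \<le> (k - a) * measure \<mu> {..k}" if "a < k" for k
  proof -
    have "(k - a) * measure \<mu> {..<k} \<le> (k - a) * measure \<mu> {..k}"
      using that by (intro mult_left_mono finite_measure_mono) auto
    then show ?thesis using put_pot_increment(2)[of a k] that by linarith
  qed
  then show "eventually (\<lambda>k. (put_pot \<mu> k - put_pot \<mu> a) / (k - a) \<le> cdf \<mu> k) (at_right a)"
    by (auto simp: eventually_at_filter cdf_def pos_divide_le_eq mult.commute)
  show "(cdf \<mu> \<longlongrightarrow> measure \<mu> {..a}) (at_right a)"
    using cdf_is_right_cont[of a] by (simp add: continuous_within cdf_def)
qed auto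

text \<open>The additive constant covers the shifted potential as well.\<close>

lemma left_deriv_put_pot: "left_deriv (\<lambda>k. put_pot \<mu> k + c) a = measure \<mu> {..<a}"
  unfolding left_deriv_def
proof (rule vector_derivative_within)
  show "((\<lambda>k. put_pot \<mu> k + c) has_vector_derivative measure \<mu> {..<a}) (at_left a)"
    using put_pot_slope_left[of a]
    by (simp add: has_real_derivative_iff_has_vector_derivative[symmetric] has_field_derivative_iff)
qed (rule trivial_limit_at_left_real)

lemma right_deriv_put_pot: "right_deriv (\<lambda>k. put_pot \<mu> k + c) a = measure \<mu> {..a}"
  unfolding right_deriv_def
proof (rule vector_derivative_within)
  show "((\<lambda>k. put_pot \<mu> k + c) has_vector_derivative measure \<mu> {..a}) (at_right a)"
    using put_pot_slope_right[of a]
    by (simp add: has_real_derivative_iff_has_vector_derivative[symmetric] has_field_derivative_iff)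
qed (rule trivial_limit_at_right_real)

lemma continuous_put_pot: "continuous_on UNIV (put_pot \<mu>)"
proof (rule lipschitz_on_continuous_on)
  show "(measure \<mu> UNIV)-lipschitz_on UNIV (put_pot \<mu>)"
  proof (rule lipschitz_on_leI)
    fix k l :: real assume "k \<le> l"
    have "put_pot \<mu> l - put_pot \<mu> k \<le> (l - k) * measure \<mu> UNIV"
    proof -
      have "(l - k) * measure \<mu> {..<l} \<le> (l - k) * measure \<mu> UNIV"
        using \<open>k \<le> l\<close> by (intro mult_left_mono finite_measure_mono) auto
      then show ?thesis using put_pot_increment(2)[OF \<open>k \<le> l\<close>] by linarith
    qed
    then show "dist (put_pot \<mu> k) (put_pot \<mu> l) \<le> measure \<mu> UNIV * dist k l"
      using put_pot_mono[OF \<open>k \<le> l\<close>] \<open>k \<le> l\<close> by (simp add: dist_real_def mult.commute)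
  qed simp
qed

lemma call_pot_tendsto: "(call_pot \<mu> \<longlongrightarrow> 0) at_top"
  using integral_excess_tendsto[OF finite_first_momentD(4)[OF mu]] by (simp add: call_pot_def[abs_def])

lemma put_pot_tendsto: "(put_pot \<mu> \<longlongrightarrow> 0) at_bot"
  using integral_excess_tendsto[OF integrable_minus[OF finite_first_momentD(4)[OF mu]]]
  unfolding filterlim_at_bot_mirror put_pot_def by (simp only: minus_diff_commute)

lemma put_pot_right_supported:
  assumes "AE x in \<mu>. z \<le> x" "k \<le> z"
  shows "put_pot \<mu> k = 0"
proof -
  have "put_pot \<mu> k = (\<integral>x. 0 \<partial>\<mu>)" unfolding put_pot_def
    by (rule integral_cong_AE[OF borel_measurable_integrable[OF integrable_put]])
      (use assms in \<open>auto elim: eventually_mono\<close>)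
  then show ?thesis by simp
qed

lemma call_pot_left_supported:
  assumes "AE x in \<mu>. x \<le> z" "z \<le> k"
  shows "call_pot \<mu> k = 0"
proof -
  have "call_pot \<mu> k = (\<integral>x. 0 \<partial>\<mu>)" unfolding call_pot_def
    by (rule integral_cong_AE[OF borel_measurable_integrable[OF integrable_call]])
      (use assms in \<open>auto elim: eventually_mono\<close>)
  then show ?thesis by simp
qed

lemma put_pot_left_supported:
  assumes "AE x in \<mu>. x \<le> z" "z \<le> k"
  shows "put_pot \<mu> k = put_pot \<mu> z + (k - z) * measure \<mu> UNIV"
  using call_pot_left_supported[OF assms] call_pot_left_supported[OF assms(1), of z]
  by (simp add: put_call_parity algebra_simps)

end

text \<open>\<open>shifted_put \<mu> \<nu> - put_pot \<mu>\<close> tends to \<open>p_gap \<mu> \<nu>\<close> at \<open>- \<infinity>\<close> and, by put-call parity, to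
\<open>p_gap \<mu> \<nu> + \<integral>x \<mu>(dx) - \<integral>x \<nu>(dx) = c_gap \<mu> \<nu>\<close> at \<open>\<infinity>\<close>. Both limits are positive, so its infimum 0 is
attained, and the zero set is compact.\<close>

lemma contact_set:
  assumes mu: "\<mu> \<in> finite_first_moment" and nu: "\<nu> \<in> finite_first_moment"
    and mass: "measure \<mu> UNIV = measure \<nu> UNIV" and p: "0 < p_gap \<mu> \<nu>" and c: "0 < c_gap \<mu> \<nu>"
  shows put_pot_le_shifted: "put_pot \<mu> k \<le> shifted_put \<mu> \<nu> k"
    and mean_gap_pos: "0 < p_gap \<mu> \<nu> + (\<integral>x. x \<partial>\<mu>) - (\<integral>x. x \<partial>\<nu>)"
    and x_minus_contact: "shifted_put \<mu> \<nu> (x_minus \<mu> \<nu>) = put_pot \<mu> (x_minus \<mu> \<nu>)"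
    and x_plus_contact: "shifted_put \<mu> \<nu> (x_plus \<mu> \<nu>) = put_pot \<mu> (x_plus \<mu> \<nu>)"
    and x_minus_le_x_plus: "x_minus \<mu> \<nu> \<le> x_plus \<mu> \<nu>"
proof -
  let ?d = "(\<integral>x. x \<partial>\<mu>) - (\<integral>x. x \<partial>\<nu>)"
  have diff: "put_pot \<mu> k - put_pot \<nu> k = call_pot \<mu> k - call_pot \<nu> k - ?d" for k
    using put_call_parity[OF mu, of k] put_call_parity[OF nu, of k] mass by simp
  have bdd: "bdd_above (range (\<lambda>k. put_pot \<mu> k - put_pot \<nu> k))"
  proof (rule bdd_aboveI2)
    fix k :: real
    show "put_pot \<mu> k - put_pot \<nu> k \<le> max (put_pot \<mu> 0) (call_pot \<mu> 0 - ?d)"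
    proof (cases "k \<le> 0")
      case True
      then show ?thesis using put_pot_mono[OF mu True] put_pot_nonneg[OF nu, of k] by simp
    next
      case False
      then show ?thesis using call_pot_antimono[OF mu, of 0 k] call_pot_nonneg[OF nu, of k] diff[of k] by simp
    qed
  qed
  have gap: "put_pot \<mu> k - put_pot \<nu> k \<le> p_gap \<mu> \<nu>" for k
    unfolding p_gap_def by (rule cSUP_upper[OF UNIV_I bdd])
  then show le: "put_pot \<mu> k \<le> shifted_put \<mu> \<nu> k" for k
    by (simp add: shifted_put_def algebra_simps)
  have "c_gap \<mu> \<nu> \<le> p_gap \<mu> \<nu> + ?d"
    unfolding c_gap_def by (rule cSUP_least) (use gap diff in \<open>auto simp: algebra_simps\<close>)
  with c show gap_pos: "0 < p_gap \<mu> \<nu> + (\<integral>x. x \<partial>\<mu>) - (\<integral>x. x \<partial>\<nu>)" by simp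
  define D where "D k = shifted_put \<mu> \<nu> k - put_pot \<mu> k" for k
  have D_nonneg: "0 \<le> D k" for k using le[of k] by (simp add: D_def)
  have contD: "continuous_on S D" for S
    unfolding D_def shifted_put_def
    by (intro continuous_intros continuous_on_subset[OF continuous_put_pot[OF mu]] continuous_on_subset[OF continuous_put_pot[OF nu]]) auto
  obtain e where e: "0 < e" "2 * e \<le> p_gap \<mu> \<nu>" "2 * e \<le> p_gap \<mu> \<nu> + ?d"
    using p gap_pos by (intro that[of "min (p_gap \<mu> \<nu>) (p_gap \<mu> \<nu> + ?d) / 2"]) auto
  have "eventually (\<lambda>k. put_pot \<mu> k < e) at_bot"
    using put_pot_tendsto[OF mu] e(1) by (rule order_tendstoD(2))
  then obtain k1 where k1: "\<And>k. k \<le> k1 \<Longrightarrow> put_pot \<mu> k < e"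
    by (auto simp: eventually_at_bot_linorder)
  have "eventually (\<lambda>k. call_pot \<mu> k < e) at_top"
    using call_pot_tendsto[OF mu] e(1) by (rule order_tendstoD(2))
  then obtain k2 where k2: "\<And>k. k2 \<le> k \<Longrightarrow> call_pot \<mu> k < e"
    by (auto simp: eventually_at_top_linorder)
  have D1: "e \<le> D k" if "k \<le> k1" for k
    using k1[OF that] put_pot_nonneg[OF nu, of k] e
    unfolding D_def shifted_put_def by linarith
  have D2: "e \<le> D k" if "k2 \<le> k" for k
    using k2[OF that] call_pot_nonneg[OF nu, of k] diff[of k] e
    unfolding D_def shifted_put_def by linarith
  have ex: "\<exists>k. D k = 0"
  proof (rule ccontr)
    assume no: "\<nexists>k. D k = 0"
    have "\<exists>x\<in>{k1..max k1 k2}. \<forall>y\<in>{k1..max k1 k2}. D x \<le> D y"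
      by (rule continuous_attains_inf) (use contD in auto)
    then obtain x where x: "\<And>y. y \<in> {k1..max k1 k2} \<Longrightarrow> D x \<le> D y" by blast
    have "0 < D x" using no D_nonneg[of x] by (auto simp: less_le)
    define e' where "e' = min (D x) e"
    have "e' \<le> D k" for k
      using D1[of k] D2[of k] x[of k] unfolding e'_def by (cases "k \<le> k1"; cases "k2 \<le> k") auto
    then have "put_pot \<mu> k - put_pot \<nu> k \<le> p_gap \<mu> \<nu> - e'" for k
      by (simp add: D_def shifted_put_def algebra_simps)
    then have "p_gap \<mu> \<nu> \<le> p_gap \<mu> \<nu> - e'"
      by (subst p_gap_def) (rule cSUP_least; simp)
    moreover have "0 < e'" using \<open>0 < D x\<close> e by (simp add: e'_def)
    ultimately show False by simp
  qed
  define C where "C = {k. shifted_put \<mu> \<nu> k = put_pot \<mu> k}"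
  have C: "C = D -` {0}" by (auto simp: D_def C_def)
  have "closed C" unfolding C using contD by (intro closed_vimage) auto
  moreover have "C \<noteq> {}" using ex unfolding C by auto
  moreover have "k1 < k \<and> k < k2" if "k \<in> C" for k
    using that D1[of k] D2[of k] e unfolding C by (auto simp: not_le[symmetric])
  then have "bdd_below C" "bdd_above C" by (auto intro!: bdd_belowI[of _ k1] bdd_aboveI[of _ k2] less_imp_le)
  ultimately have "x_minus \<mu> \<nu> \<in> C" "x_plus \<mu> \<nu> \<in> C" "x_minus \<mu> \<nu> \<le> x_plus \<mu> \<nu>"
    unfolding x_minus_def x_plus_def C_def[symmetric]
    by (auto intro!: closed_contains_Inf closed_contains_Sup cInf_le_cSup)
  then show "shifted_put \<mu> \<nu> (x_minus \<mu> \<nu>) = put_pot \<mu> (x_minus \<mu> \<nu>)"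
    "shifted_put \<mu> \<nu> (x_plus \<mu> \<nu>) = put_pot \<mu> (x_plus \<mu> \<nu>)" "x_minus \<mu> \<nu> \<le> x_plus \<mu> \<nu>"
    by (simp_all add: C_def)
qed

text \<open>At a point of contact \<open>put_pot \<nu> - put_pot \<mu>\<close> has a minimum, so its left derivative is
nonpositive and its right derivative nonnegative.\<close>

lemma contact_masses:
  assumes mu: "\<mu> \<in> finite_first_moment" and nu: "\<nu> \<in> finite_first_moment"
    and le: "\<And>k. put_pot \<mu> k \<le> put_pot \<nu> k + p" and eq: "put_pot \<mu> z = put_pot \<nu> z + p"
  shows "measure \<nu> {..<z} \<le> measure \<mu> {..<z}" "measure \<mu> {..z} \<le> measure \<nu> {..z}"
proof -
  have le': "put_pot \<mu> k - put_pot \<mu> z \<le> put_pot \<nu> k - put_pot \<nu> z" for k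
    using le[of k] eq by simp
  show "measure \<nu> {..<z} \<le> measure \<mu> {..<z}"
  proof (rule tendsto_le[OF trivial_limit_at_left_real put_pot_slope_left[OF mu] put_pot_slope_left[OF nu]])
    have "(put_pot \<nu> k - put_pot \<nu> z) / (k - z) \<le> (put_pot \<mu> k - put_pot \<mu> z) / (k - z)" if "k < z" for k
      using le'[of k] that by (intro divide_right_mono_neg) auto
    then show "eventually (\<lambda>k. (put_pot \<nu> k - put_pot \<nu> z) / (k - z) \<le> (put_pot \<mu> k - put_pot \<mu> z) / (k - z)) (at_left z)"
      by (auto simp: eventually_at_filter)
  qed
  show "measure \<mu> {..z} \<le> measure \<nu> {..z}"
  proof (rule tendsto_le[OF trivial_limit_at_right_real put_pot_slope_right[OF nu] put_pot_slope_right[OF mu]])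
    have "(put_pot \<mu> k - put_pot \<mu> z) / (k - z) \<le> (put_pot \<nu> k - put_pot \<nu> z) / (k - z)" if "z < k" for k
      using le'[of k] that by (intro divide_right_mono) auto
    then show "eventually (\<lambda>k. (put_pot \<mu> k - put_pot \<mu> z) / (k - z) \<le> (put_pot \<nu> k - put_pot \<nu> z) / (k - z)) (at_right z)"
      by (auto simp: eventually_at_filter)
  qed
qed

lemma measure_atMost_eq: "measure N {..z} = measure N {..<z} + measure N {z}" if "finite_borel_measure N" for N :: "real measure"
proof -
  interpret finite_borel_measure N by fact
  have "measure N ({..<z} \<union> {z}) = measure N {..<z} + measure N {z}"
    by (rule finite_measure_Union) auto
  moreover have "{..z} = {..<z} \<union> {z}" by auto
  ultimately show ?thesis by simp
qed

lemma split3: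
  assumes N: "add_measure (add_measure N1 N2) N0 = N"
    and N1: "N1 \<in> finite_first_moment" and N2: "N2 \<in> finite_first_moment" and N0: "N0 \<in> finite_first_moment"
  shows split3_nn_integral: "f \<in> borel_measurable borel \<Longrightarrow> (\<integral>\<^sup>+x. f x \<partial>N) = (\<integral>\<^sup>+x. f x \<partial>N1) + (\<integral>\<^sup>+x. f x \<partial>N2) + (\<integral>\<^sup>+x. f x \<partial>N0)"
    and split3_put: "put_pot N k = put_pot N1 k + put_pot N2 k + put_pot N0 k"
    and split3_call: "call_pot N k = call_pot N1 k + call_pot N2 k + call_pot N0 k"
    and split3_mass: "measure N UNIV = measure N1 UNIV + measure N2 UNIV + measure N0 UNIV"
proof -
  note s = finite_first_momentD(1)[OF N1] finite_first_momentD(1)[OF N2] finite_first_momentD(1)[OF N0]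
  show "(\<integral>\<^sup>+x. f x \<partial>N) = (\<integral>\<^sup>+x. f x \<partial>N1) + (\<integral>\<^sup>+x. f x \<partial>N2) + (\<integral>\<^sup>+x. f x \<partial>N0)"
    if f: "f \<in> borel_measurable borel" for f
  proof -
    have "f \<in> borel_measurable N1" "f \<in> borel_measurable (add_measure N1 N2)"
      using f s by (simp_all cong: measurable_cong_sets)
    then show ?thesis unfolding N[symmetric] using s by (simp add: nn_integral_add_measure)
  qed
  have int: "(\<integral>x. f x \<partial>N) = (\<integral>x. f x \<partial>N1) + (\<integral>x. f x \<partial>N2) + (\<integral>x. f x \<partial>N0)"
    if f: "integrable N1 f" "integrable N2 f" "integrable N0 f" for f :: "real \<Rightarrow> real"
  proof -
    have "integrable (add_measure N1 N2) f" using f s by (intro integrable_add_measure) simp_all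
    then show ?thesis unfolding N[symmetric] using f s by (simp add: integral_add_measure)
  qed
  show "put_pot N k = put_pot N1 k + put_pot N2 k + put_pot N0 k"
    unfolding put_pot_def using N1 N2 N0 by (intro int integrable_put)
  show "call_pot N k = call_pot N1 k + call_pot N2 k + call_pot N0 k"
    unfolding call_pot_def using N1 N2 N0 by (intro int integrable_call)
  have "emeasure N UNIV = emeasure N1 UNIV + emeasure N2 UNIV + emeasure N0 UNIV"
    unfolding N[symmetric] using s by (simp add: emeasure_add_measure)
  then show "measure N UNIV = measure N1 UNIV + measure N2 UNIV + measure N0 UNIV"
    using finite_first_momentD(3)[OF N1] finite_first_momentD(3)[OF N2] finite_first_momentD(3)[OF N0]
    by (simp add: measure_def finite_measure.emeasure_finite enn2real_plus less_top[symmetric])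
qed

section \<open>Admissible kernels on a half-line\<close>

text \<open>The core of the lower bound. Think of \<open>X\<close> as the starting point, of \<open>T\<close> as the mean target and of
\<open>q\<close> as a put potential to stay below. The modified target \<open>Z = max X (min T c)\<close> cuts \<open>T\<close> off at
the level \<open>c\<close> but never moves down from \<open>X\<close>. Below \<open>c\<close> its put potential is at most the one of
\<open>T\<close>. Above \<open>c\<close> it is the one of \<open>X\<close> minus the constant \<open>\<integral> Z - X\<close>, because \<open>Z = X\<close> wherever \<open>X \<ge> c\<close>,
while elsewhere both are at most \<open>c\<close>. If \<open>c\<close> is chosen such that the constant is \<open>p\<close>, then both
parts are at most \<open>q\<close>, with equality at \<open>a\<close>. Such a level exists since the constant depends
continuously on \<open>c\<close>, is at least \<open>p\<close> at \<open>c = a\<close> and tends to 0 as \<open>c\<close> tends to \<open>- \<infinity>\<close>.\<close>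

lemma squeeze_level:
  fixes X T :: "'a \<Rightarrow> real"
  assumes "finite_measure N" and X: "integrable N X" and T: "integrable N T"
    and Xa: "AE x in N. X x \<le> a" and "0 < p"
    and Tq: "\<And>k. k \<le> a \<Longrightarrow> (\<integral>x. max (k - T x) 0 \<partial>N) \<le> q k"
    and Xq: "\<And>k. k \<le> a \<Longrightarrow> (\<integral>x. max (k - X x) 0 \<partial>N) \<le> q k + p"
    and Xqa: "(\<integral>x. max (a - X x) 0 \<partial>N) = q a + p"
  obtains c where "c \<le> a"
    "\<And>k. k \<le> a \<Longrightarrow> (\<integral>x. max (k - max (X x) (min (T x) c)) 0 \<partial>N) \<le> q k"
    "(\<integral>x. max (a - max (X x) (min (T x) c)) 0 \<partial>N) = q a"
proof -
  interpret finite_measure N by fact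
  have [measurable]: "X \<in> borel_measurable N" "T \<in> borel_measurable N" using X T by auto
  define Z where "Z c x = max (X x) (min (T x) c)" for c x
  have intZ: "integrable N (Z c)" for c unfolding Z_def using X T by auto
  define A where "A c = (\<integral>x. Z c x - X x \<partial>N)" for c
  have put: "(\<integral>x. max (k - X x) 0 \<partial>N) - (\<integral>x. max (k - Z c x) 0 \<partial>N) = A c" if "c \<le> k" for c k
  proof -
    have "(\<integral>x. max (k - X x) 0 \<partial>N) - (\<integral>x. max (k - Z c x) 0 \<partial>N) = (\<integral>x. max (k - X x) 0 - max (k - Z c x) 0 \<partial>N)"
      using X intZ by (intro Bochner_Integration.integral_diff[symmetric]) auto
    also have "\<dots> = A c" unfolding A_def
      using that by (intro Bochner_Integration.integral_cong) (auto simp: Z_def max_def min_def)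
    finally show ?thesis .
  qed
  have low: "(\<integral>x. max (k - Z c x) 0 \<partial>N) \<le> (\<integral>x. max (k - T x) 0 \<partial>N)" if "k \<le> c" for c k
    using intZ[unfolded Z_def] T that by (intro integral_mono) (auto simp: Z_def)
  have Aa: "p \<le> A a"
    using put[of a a] low[of a a] Tq[of a] Xqa by simp
  have "continuous_on UNIV A"
  proof (rule lipschitz_on_continuous_on)
    show "(measure N (space N))-lipschitz_on UNIV A"
    proof (rule lipschitz_onI)
      fix c d :: real
      have "dist (A c) (A d) = \<bar>\<integral>x. Z c x - Z d x \<partial>N\<bar>"
        using intZ X by (simp add: A_def dist_real_def)
      also have "\<dots> \<le> (\<integral>x. \<bar>Z c x - Z d x\<bar> \<partial>N)" by (rule integral_abs_bound)
      also have "\<dots> \<le> (\<integral>x. \<bar>c - d\<bar> \<partial>N)"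
        using intZ by (intro integral_mono) (auto, auto simp: Z_def max_def min_def)
      finally show "dist (A c) (A d) \<le> measure N (space N) * dist c d" by (simp add: dist_real_def)
    qed simp
  qed
  moreover obtain b where "b \<le> a" "A b \<le> p"
  proof -
    have "((\<lambda>c. \<integral>x. max (- c - X x) 0 \<partial>N) \<longlongrightarrow> 0) at_top"
      using integral_excess_tendsto[OF integrable_minus[OF X]] by (simp only: minus_diff_commute)
    then have "eventually (\<lambda>c. (\<integral>x. max (- c - X x) 0 \<partial>N) < p) at_top"
      using \<open>0 < p\<close> by (intro order_tendstoD(2)) auto
    then have "eventually (\<lambda>c. (\<integral>x. max (- c - X x) 0 \<partial>N) < p \<and> - c \<le> a) at_top"
      using eventually_ge_at_top[of "- a"] by eventually_elim auto
    then have "\<exists>c. (\<integral>x. max (- c - X x) 0 \<partial>N) < p \<and> - c \<le> a"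
      by (rule eventually_happens'[OF trivial_limit_at_top_linorder])
    then obtain c where c: "(\<integral>x. max (- c - X x) 0 \<partial>N) < p" "- c \<le> a" by blast
    have "A (- c) \<le> (\<integral>x. max (- c - X x) 0 \<partial>N)"
      unfolding A_def using intZ[unfolded Z_def] X by (intro integral_mono) (auto simp: Z_def)
    with c show thesis by (intro that[of "- c"]) auto
  qed
  ultimately obtain c where c: "c \<le> a" "A c = p"
    using IVT'[of A b p a] Aa by (meson atLeastAtMost_iff continuous_on_subset subset_UNIV)
  show thesis
  proof
    show "c \<le> a" by fact
    show "(\<integral>x. max (k - max (X x) (min (T x) c)) 0 \<partial>N) \<le> q k" if "k \<le> a" for k
    proof (cases "k \<le> c")
      case True
      then show ?thesis using low[of k c] Tq[OF that] by (simp add: Z_def)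
    next
      case False
      then show ?thesis using put[of c k] Xq[OF that] c(2) by (simp add: Z_def)
    qed
    show "(\<integral>x. max (a - max (X x) (min (T x) c)) 0 \<partial>N) = q a"
      using put[OF c(1)] Xqa c(2) by (simp add: Z_def)
  qed
qed

text \<open>With the target \<open>T' = s * Z\<close> from \<open>squeeze_level\<close>, the law of \<open>T'\<close> under \<open>\<eta>\<close> precedes \<open>\<theta>\<close> in convex
order, and a martingale kernel from this law to \<open>\<theta>\<close> has barycenter \<open>T' x\<close> when started from
\<open>T' x\<close>. The sign \<open>s\<close> treats the two halves of the line together: for \<open>s = - 1\<close> the line is
reflected, and \<open>\<integral>max (k - s * y) 0\<close> is a call potential.\<close>

lemma one_sided_kernel:
  fixes s \<alpha> p :: real and T :: "real \<Rightarrow> real"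
  assumes s: "s = 1 \<or> s = - 1" and eta: "\<eta> \<in> finite_first_moment" and theta: "\<theta> \<in> finite_first_moment"
    and mass: "measure \<eta> UNIV = measure \<theta> UNIV"
    and T: "integrable \<eta> T" "T \<in> borel_measurable borel"
    and le_eta: "AE x in \<eta>. s * x \<le> \<alpha>" and le_theta: "AE y in \<theta>. s * y \<le> \<alpha>" and "0 < p"
    and Tq: "\<And>k. k \<le> \<alpha> \<Longrightarrow> (\<integral>x. max (k - s * T x) 0 \<partial>\<eta>) \<le> (\<integral>y. max (k - s * y) 0 \<partial>\<theta>)"
    and Xq: "\<And>k. k \<le> \<alpha> \<Longrightarrow> (\<integral>x. max (k - s * x) 0 \<partial>\<eta>) \<le> (\<integral>y. max (k - s * y) 0 \<partial>\<theta>) + p"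
    and Xqa: "(\<integral>x. max (\<alpha> - s * x) 0 \<partial>\<eta>) = (\<integral>y. max (\<alpha> - s * y) 0 \<partial>\<theta>) + p"
  obtains K where "K \<in> borel \<rightarrow>\<^sub>M prob_algebra borel" "\<theta> = \<eta> \<bind> K"
    "AE x in \<eta>. s * x \<le> s * barycenter K x \<and> s * barycenter K x \<le> max (s * x) (s * T x)"
proof -
  have [simp, measurable_cong]: "sets \<eta> = sets borel" "sets \<theta> = sets borel"
    and int: "integrable \<eta> (\<lambda>x. x)" "integrable \<theta> (\<lambda>x. x)"
    and fin: "finite_measure \<eta>" "finite_measure \<theta>"
    using eta theta by (auto simp: finite_first_moment_def)
  have [simp]: "space \<eta> = UNIV" "space \<theta> = UNIV"
    using sets_eq_imp_space_eq[of \<eta> borel] sets_eq_imp_space_eq[of \<theta> borel] by simp_all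
  note [measurable] = T(2)
  interpret eta: finite_measure \<eta> by fact
  interpret theta: finite_measure \<theta> by fact
  have ss: "s * (s * x) = x" for x using s by auto
  obtain c where c: "c \<le> \<alpha>"
    and cq: "\<And>k. k \<le> \<alpha> \<Longrightarrow> (\<integral>x. max (k - max (s * x) (min (s * T x) c)) 0 \<partial>\<eta>) \<le> (\<integral>y. max (k - s * y) 0 \<partial>\<theta>)"
    and ca: "(\<integral>x. max (\<alpha> - max (s * x) (min (s * T x) c)) 0 \<partial>\<eta>) = (\<integral>y. max (\<alpha> - s * y) 0 \<partial>\<theta>)"
  proof (rule squeeze_level[where N=\<eta> and X="\<lambda>x. s * x" and T="\<lambda>x. s * T x" and a=\<alpha> and p=p
        and q="\<lambda>k. \<integral>y. max (k - s * y) 0 \<partial>\<theta>"])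
    show "finite_measure \<eta>" "AE x in \<eta>. s * x \<le> \<alpha>" "0 < p" by fact+
    show "integrable \<eta> (\<lambda>x. s * x)" "integrable \<eta> (\<lambda>x. s * T x)" by (intro integrable_mult_right int T)+
  qed (use Tq Xq Xqa in blast)+
  define Z where "Z x = max (s * x) (min (s * T x) c)" for x
  define T' where "T' x = s * Z x" for x
  have [measurable]: "Z \<in> borel_measurable borel" "T' \<in> borel_measurable borel"
    unfolding Z_def T'_def by measurable
  have intZ: "integrable \<eta> Z" unfolding Z_def
    by (intro Bochner_Integration.integrable_max Bochner_Integration.integrable_min integrable_mult_right int T) simp
  have intT': "integrable \<eta> T'" unfolding T'_def using intZ by simp
  have Z_le: "AE x in \<eta>. Z x \<le> \<alpha>" using le_eta by eventually_elim (use c in \<open>auto simp: Z_def\<close>)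
  have sT': "s * T' x = Z x" for x by (simp add: T'_def ss)
  have meanZ: "(\<integral>x. Z x \<partial>\<eta>) = s * (\<integral>y. y \<partial>\<theta>)"
  proof -
    have "(\<integral>x. max (\<alpha> - Z x) 0 \<partial>\<eta>) = (\<integral>x. \<alpha> - Z x \<partial>\<eta>)"
      by (rule integral_cong_AE) (use Z_le in \<open>auto elim: eventually_mono\<close>)
    moreover have "(\<integral>y. max (\<alpha> - s * y) 0 \<partial>\<theta>) = (\<integral>y. \<alpha> - s * y \<partial>\<theta>)"
      by (rule integral_cong_AE) (use le_theta in \<open>auto elim: eventually_mono\<close>)
    ultimately show ?thesis using ca intZ int mass by (simp add: Z_def[symmetric])
  qed
  have q_le: "(\<integral>x. max (k - Z x) 0 \<partial>\<eta>) \<le> (\<integral>y. max (k - s * y) 0 \<partial>\<theta>)" for k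
  proof (cases "k \<le> \<alpha>")
    case True
    then show ?thesis using cq by (simp add: Z_def)
  next
    case False
    have "(\<integral>x. max (k - Z x) 0 \<partial>\<eta>) = (\<integral>x. k - Z x \<partial>\<eta>)"
      by (rule integral_cong_AE) (use Z_le False in \<open>auto elim: eventually_mono\<close>)
    moreover have "(\<integral>y. max (k - s * y) 0 \<partial>\<theta>) = (\<integral>y. k - s * y \<partial>\<theta>)"
      by (rule integral_cong_AE) (use le_theta False in \<open>auto elim: eventually_mono\<close>)
    ultimately show ?thesis using meanZ intZ int mass by simp
  qed
  define \<theta>' where "\<theta>' = distr \<eta> borel T'"
  have T'_eta: "T' \<in> borel_measurable \<eta>" by simp
  have int_theta': "integrable \<theta>' (\<lambda>x. x)"
    unfolding \<theta>'_def using intT' by (simp add: integrable_distr_eq)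
  have theta': "\<theta>' \<in> finite_first_moment"
    using int_theta' eta.finite_measure_distr[OF T'_eta] by (simp add: finite_first_moment_def \<theta>'_def)
  have theta'_int: "(\<integral>x. g x \<partial>\<theta>') = (\<integral>x. g (T' x) \<partial>\<eta>)" if "g \<in> borel_measurable borel" for g :: "real \<Rightarrow> real"
    unfolding \<theta>'_def using that by (simp add: integral_distr)
  have mean': "(\<integral>x. T' x \<partial>\<eta>) = (\<integral>y. y \<partial>\<theta>)"
    unfolding T'_def using meanZ by (simp add: ss)
  have mass': "measure \<theta>' UNIV = measure \<theta> UNIV"
    using mass by (simp add: \<theta>'_def measure_distr)
  obtain K where K: "K \<in> borel \<rightarrow>\<^sub>M prob_algebra borel" "\<theta> = \<theta>' \<bind> K" "AE x in \<theta>'. barycenter K x = x"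
  proof (rule strassen_kernel[OF theta' theta mass'])
    show "(\<integral>x. x \<partial>\<theta>') = (\<integral>y. y \<partial>\<theta>)" using mean' by (simp add: theta'_int)
    fix k
    have put': "put_pot \<theta>' k = (\<integral>x. max (k - T' x) 0 \<partial>\<eta>)" unfolding put_pot_def by (rule theta'_int) simp
    from s show "put_pot \<theta>' k \<le> put_pot \<theta> k"
    proof
      assume "s = 1"
      then show ?thesis using q_le[of k] by (simp add: put' T'_def) (simp add: put_pot_def)
    next
      \<comment> \<open>with equal masses and means, call potentials are ordered as put potentials are\<close>
      assume s1: "s = - 1"
      have "(\<integral>x. max (k - T' x) 0 \<partial>\<eta>) = (\<integral>x. max (- k - Z x) 0 + (k - T' x) \<partial>\<eta>)"
        by (intro Bochner_Integration.integral_cong) (auto simp: T'_def s1)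
      also have "\<dots> = (\<integral>x. max (- k - Z x) 0 \<partial>\<eta>) + (\<integral>x. k - T' x \<partial>\<eta>)"
        using intZ intT' by (intro Bochner_Integration.integral_add) auto
      also have "\<dots> \<le> (\<integral>y. max (- k - s * y) 0 \<partial>\<theta>) + (\<integral>y. k - y \<partial>\<theta>)"
        using q_le[of "- k"] mean' mass intT' int by simp
      also have "\<dots> = (\<integral>y. max (- k - s * y) 0 + (k - y) \<partial>\<theta>)"
        using int by (intro Bochner_Integration.integral_add[symmetric]) auto
      also have "\<dots> = put_pot \<theta> k"
        unfolding put_pot_def by (intro Bochner_Integration.integral_cong) (auto simp: s1)
      finally show ?thesis by (simp add: put')
    qed
  qed auto
  show thesis
  proof
    show K': "(\<lambda>x. K (T' x)) \<in> borel \<rightarrow>\<^sub>M prob_algebra borel"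
      by (rule measurable_compose[OF _ K(1)]) simp
    show "\<theta> = \<eta> \<bind> (\<lambda>x. K (T' x))"
      unfolding K(2) \<theta>'_def using measurable_prob_algebraD[OF K(1)] T'_eta
      by (intro bind_distr[where K=borel]) auto
    have "AE x in \<eta>. barycenter K (T' x) = T' x"
      using K(3) T'_eta measurable_barycenter[OF K(1)] unfolding \<theta>'_def by (subst (asm) AE_distr_iff) auto
    then show "AE x in \<eta>. s * x \<le> s * barycenter (\<lambda>x. K (T' x)) x \<and> s * barycenter (\<lambda>x. K (T' x)) x \<le> max (s * x) (s * T x)"
    proof eventually_elim
      case (elim x)
      then have "s * barycenter (\<lambda>x. K (T' x)) x = Z x" by (simp add: barycenter_def sT')
      then show ?case by (auto simp: Z_def)
    qed
  qed
qed

lemma convex_scale_le: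
  fixes h :: "real \<Rightarrow> real"
  assumes h: "convex_on UNIV h" "\<And>x. 0 \<le> h x" "h 0 = 0" and "0 \<le> t" "t \<le> 1"
  shows "h (t * z) \<le> h z"
proof -
  have "h ((1 - t) *\<^sub>R 0 + t *\<^sub>R z) \<le> (1 - t) * h 0 + t * h z"
    using assms by (intro convex_onD) auto
  also have "\<dots> \<le> h z" using assms by (auto intro: mult_left_le_one_le)
  finally show ?thesis by simp
qed

text \<open>A convex \<open>h\<close> with minimum \<open>h 0 = 0\<close> increases away from 0 on either side, and \<open>x - b\<close> is 0 or lies
between 0 and \<open>x - y\<close>.\<close>

lemma convex_between_le:
  fixes h :: "real \<Rightarrow> real"
  assumes h: "convex_on UNIV h" "\<And>x. 0 \<le> h x" "h 0 = 0" and s: "s = 1 \<or> s = - 1"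
    and b: "s * x \<le> s * b" "s * b \<le> max (s * x) (s * y)"
  shows "h (x - b) \<le> h (x - y)"
proof (cases "x = b")
  case True
  then show ?thesis using h by simp
next
  case False
  with s b have *: "(x < b \<and> b \<le> y) \<or> (y \<le> b \<and> b < x)" by auto
  then have "h ((x - b) / (x - y) * (x - y)) \<le> h (x - y)"
    by (intro convex_scale_le h) (auto simp: divide_simps)
  moreover have "(x - b) / (x - y) * (x - y) = x - b" using * by auto
  ultimately show ?thesis by simp
qed

section \<open>Splitting at two points of contact\<close>

text \<open>The situation of the theorem with two arbitrary points of contact \<open>a \<le> b\<close> in place of the
extreme ones. Below, \<open>lower_part\<close> and \<open>upper_part\<close> are the target measures of the two one-sided
problems, and \<open>middle_part\<close> is what they leave of \<open>\<nu>\<close>.\<close>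

locale put_contact =
  fixes \<mu> \<nu> :: "real measure" and p a b :: real
  assumes mu: "\<mu> \<in> finite_first_moment" and nu: "\<nu> \<in> finite_first_moment"
    and mass: "measure \<mu> UNIV = measure \<nu> UNIV"
    and p_pos: "0 < p" and mean_gap: "0 < p + (\<integral>x. x \<partial>\<mu>) - (\<integral>x. x \<partial>\<nu>)"
    and put_le: "\<And>k. put_pot \<mu> k \<le> put_pot \<nu> k + p"
    and contact_a: "put_pot \<mu> a = put_pot \<nu> a + p" and contact_b: "put_pot \<mu> b = put_pot \<nu> b + p"
    and a_le_b: "a \<le> b"
begin

sublocale mu: finite_borel_measure \<mu> by (rule finite_first_momentD(5)[OF mu])
sublocale nu: finite_borel_measure \<nu> by (rule finite_first_momentD(5)[OF nu])

lemmas mu_sets = finite_first_momentD(1,2)[OF mu]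
lemmas nu_sets = finite_first_momentD(1,2)[OF nu]

definition lower_part :: "real measure" where
  "lower_part = add_atom (restr \<nu> {..<a}) (measure \<mu> {..<a} - measure \<nu> {..<a}) a"

definition upper_part :: "real measure" where
  "upper_part = add_atom (restr \<nu> {b<..}) (measure \<nu> {..b} - measure \<mu> {..b}) b"

definition middle_part :: "real measure" where
  "middle_part = diff_measure \<nu> (add_measure lower_part upper_part)"

lemma sets_parts [simp]: "sets lower_part = sets borel" "sets upper_part = sets borel" "sets middle_part = sets borel"
  by (simp_all add: lower_part_def upper_part_def middle_part_def add_atom_def nu_sets)

lemma emeasure_lower_part:
  "B \<in> sets borel \<Longrightarrow> emeasure lower_part B = emeasure \<nu> ({..<a} \<inter> B) + ennreal (measure \<mu> {..<a} - measure \<nu> {..<a}) * indicator B a"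
  unfolding lower_part_def by (simp add: emeasure_add_atom nu_sets emeasure_restr)

lemma emeasure_upper_part:
  "B \<in> sets borel \<Longrightarrow> emeasure upper_part B = emeasure \<nu> ({b<..} \<inter> B) + ennreal (measure \<nu> {..b} - measure \<mu> {..b}) * indicator B b"
  unfolding upper_part_def by (simp add: emeasure_add_atom nu_sets emeasure_restr)

text \<open>The atoms of the two outer parts can be taken out of \<open>\<nu>\<close>. If \<open>a = b\<close>, both have to fit into the same
atom of \<open>\<nu>\<close>, and what they leave over is the atom of \<open>\<mu>\<close>.\<close>

lemma atoms_le:
  shows "ennreal (measure \<mu> {..<a} - measure \<nu> {..<a}) * indicator B a + ennreal (measure \<nu> {..b} - measure \<mu> {..b}) * indicator B b
    \<le> emeasure \<nu> ({a, b} \<inter> B)"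
proof -
  note ma = contact_masses[OF mu nu put_le contact_a]
  note mb = contact_masses[OF mu nu put_le contact_b]
  have atom_le: "measure \<mu> {..<a} - measure \<nu> {..<a} \<le> measure \<nu> {a}" "measure \<nu> {..b} - measure \<mu> {..b} \<le> measure \<nu> {b}"
    using ma(2) mb(1) measure_atMost_eq[OF mu.finite_borel_measure_axioms, of a] measure_atMost_eq[OF nu.finite_borel_measure_axioms, of a]
      measure_atMost_eq[OF mu.finite_borel_measure_axioms, of b] measure_atMost_eq[OF nu.finite_borel_measure_axioms, of b]
      measure_nonneg[of \<mu> "{a}"] measure_nonneg[of \<mu> "{b}"] by linarith+
  show ?thesis
  proof (cases "a = b")
    case True
    have "ennreal (measure \<mu> {..<a} - measure \<nu> {..<a}) + ennreal (measure \<nu> {..a} - measure \<mu> {..a})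
        = ennreal (measure \<mu> {..<a} - measure \<nu> {..<a} + (measure \<nu> {..a} - measure \<mu> {..a}))"
      using ma by (intro ennreal_plus[symmetric]) auto
    also have "\<dots> \<le> ennreal (measure \<nu> {a})"
      using measure_atMost_eq[OF mu.finite_borel_measure_axioms, of a] measure_atMost_eq[OF nu.finite_borel_measure_axioms, of a]
      by (intro ennreal_leI) (simp add: measure_nonneg)
    finally show ?thesis using True by (cases "a \<in> B") (auto simp: nu.emeasure_eq_measure)
  next
    case False
    have sing: "ennreal (measure \<mu> {..<a} - measure \<nu> {..<a}) * indicator B a \<le> emeasure \<nu> ({a} \<inter> B)"
      "ennreal (measure \<nu> {..b} - measure \<mu> {..b}) * indicator B b \<le> emeasure \<nu> ({b} \<inter> B)"
      using atom_le by (auto simp: indicator_def nu.emeasure_eq_measure intro!: ennreal_leI)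
    have "{z} \<inter> B \<in> sets \<nu>" for z :: real
      by (cases "z \<in> B") (auto simp: nu_sets)
    then have "emeasure \<nu> (({a} \<inter> B) \<union> ({b} \<inter> B)) = emeasure \<nu> ({a} \<inter> B) + emeasure \<nu> ({b} \<inter> B)"
      using False by (intro plus_emeasure[symmetric]) auto
    moreover have "({a} \<inter> B) \<union> ({b} \<inter> B) = {a, b} \<inter> B" by auto
    ultimately show ?thesis using add_mono[OF sing] by simp
  qed
qed

lemma outer_parts_le:
  assumes B: "B \<in> sets borel"
  shows "emeasure (add_measure lower_part upper_part) B \<le> emeasure \<nu> B"
proof -
  have [simp]: "{a, b} \<inter> B \<in> sets borel" using B by (intro sets.Int) auto
  have "emeasure (add_measure lower_part upper_part) B =
     (emeasure \<nu> ({..<a} \<inter> B) + emeasure \<nu> ({b<..} \<inter> B)) +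
     (ennreal (measure \<mu> {..<a} - measure \<nu> {..<a}) * indicator B a + ennreal (measure \<nu> {..b} - measure \<mu> {..b}) * indicator B b)"
    using B by (simp add: emeasure_add_measure emeasure_lower_part emeasure_upper_part ac_simps)
  also have "\<dots> \<le> (emeasure \<nu> ({..<a} \<inter> B) + emeasure \<nu> ({b<..} \<inter> B)) + emeasure \<nu> ({a, b} \<inter> B)"
    by (intro add_left_mono atoms_le)
  also have "\<dots> = emeasure \<nu> ((({..<a} \<inter> B) \<union> ({b<..} \<inter> B)) \<union> ({a, b} \<inter> B))"
  proof (rule emeasure_Un3)
    show "{..<a} \<inter> B \<in> sets \<nu>" "{b<..} \<inter> B \<in> sets \<nu>" "{a, b} \<inter> B \<in> sets \<nu>"
      unfolding nu_sets by (intro sets.Int B; simp)+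
    show "({..<a} \<inter> B) \<inter> ({b<..} \<inter> B) = {}" "(({..<a} \<inter> B) \<union> ({b<..} \<inter> B)) \<inter> ({a, b} \<inter> B) = {}"
      using a_le_b by force+
  qed
  also have "\<dots> \<le> emeasure \<nu> B"
    using B by (intro emeasure_mono) (auto simp: nu_sets)
  finally show ?thesis .
qed

lemma lower_part_le: "B \<in> sets borel \<Longrightarrow> emeasure lower_part B \<le> emeasure \<nu> B"
  and upper_part_le: "B \<in> sets borel \<Longrightarrow> emeasure upper_part B \<le> emeasure \<nu> B"
proof -
  assume "B \<in> sets borel"
  then have *: "emeasure lower_part B + emeasure upper_part B \<le> emeasure \<nu> B"
    using outer_parts_le[of B] by (simp add: emeasure_add_measure)
  show "emeasure lower_part B \<le> emeasure \<nu> B" by (rule order_trans[OF _ *]) simp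
  show "emeasure upper_part B \<le> emeasure \<nu> B" by (rule order_trans[OF _ *]) simp
qed

lemma lower_part: "lower_part \<in> finite_first_moment" and upper_part: "upper_part \<in> finite_first_moment"
  by (rule finite_first_moment_mono[OF nu]; simp add: lower_part_le upper_part_le)+

lemma emeasure_middle_part:
  assumes B: "B \<in> sets borel"
  shows "emeasure middle_part B + emeasure (add_measure lower_part upper_part) B = emeasure \<nu> B"
    and "emeasure middle_part B \<le> emeasure \<nu> B"
proof -
  have outer: "add_measure lower_part upper_part \<in> finite_first_moment"
    by (rule finite_first_moment_mono[OF nu]) (simp_all add: outer_parts_le)
  have "emeasure middle_part B = emeasure \<nu> B - emeasure (add_measure lower_part upper_part) B"
    unfolding middle_part_def using B outer_parts_le finite_first_momentD(3)[OF outer] nu.finite_measure_axioms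
    by (subst emeasure_diff_measure) (auto simp: nu_sets)
  then show "emeasure middle_part B + emeasure (add_measure lower_part upper_part) B = emeasure \<nu> B"
    using outer_parts_le[OF B] by (simp add: diff_add_cancel_ennreal)
  then show "emeasure middle_part B \<le> emeasure \<nu> B" by (metis le_iff_add)
qed

lemma middle_part: "middle_part \<in> finite_first_moment"
  by (rule finite_first_moment_mono[OF nu]) (simp_all add: emeasure_middle_part)

lemma restr_first_moment: "A \<in> sets borel \<Longrightarrow> restr \<mu> A \<in> finite_first_moment"
  by (rule finite_first_moment_mono[OF mu]) (auto simp: mu_sets emeasure_restr intro!: emeasure_mono)

lemma nu_split: "add_measure (add_measure lower_part upper_part) middle_part = \<nu>"
proof (rule measure_eqI)
  fix B assume "B \<in> sets (add_measure (add_measure lower_part upper_part) middle_part)"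
  then have B: "B \<in> sets borel" by simp
  then show "emeasure (add_measure (add_measure lower_part upper_part) middle_part) B = emeasure \<nu> B"
    using emeasure_middle_part(1)[OF B] by (simp add: emeasure_add_measure ac_simps)
qed (simp add: nu_sets)

lemma mu_split: "add_measure (add_measure (restr \<mu> {..<a}) (restr \<mu> {b<..})) (restr \<mu> {a..b}) = \<mu>"
proof (rule measure_eqI)
  fix B assume "B \<in> sets (add_measure (add_measure (restr \<mu> {..<a}) (restr \<mu> {b<..})) (restr \<mu> {a..b}))"
  then have B: "B \<in> sets borel" by (simp add: mu_sets)
  have "emeasure \<mu> ({..<a} \<inter> B) + emeasure \<mu> ({b<..} \<inter> B) + emeasure \<mu> ({a..b} \<inter> B)
      = emeasure \<mu> ((({..<a} \<inter> B) \<union> ({b<..} \<inter> B)) \<union> ({a..b} \<inter> B))"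
  proof (rule emeasure_Un3)
    show "{..<a} \<inter> B \<in> sets \<mu>" "{b<..} \<inter> B \<in> sets \<mu>" "{a..b} \<inter> B \<in> sets \<mu>"
      unfolding mu_sets by (intro sets.Int B; simp)+
    show "({..<a} \<inter> B) \<inter> ({b<..} \<inter> B) = {}" "(({..<a} \<inter> B) \<union> ({b<..} \<inter> B)) \<inter> ({a..b} \<inter> B) = {}"
      using a_le_b by force+
  qed
  also have "(({..<a} \<inter> B) \<union> ({b<..} \<inter> B)) \<union> ({a..b} \<inter> B) = B" using a_le_b by auto
  finally show "emeasure (add_measure (add_measure (restr \<mu> {..<a}) (restr \<mu> {b<..})) (restr \<mu> {a..b})) B = emeasure \<mu> B"
    using B by (simp add: emeasure_add_measure mu_sets emeasure_restr)
qed simp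

lemmas nu_split3 = split3[OF nu_split lower_part upper_part middle_part]
lemmas mu_split3 = split3[OF mu_split restr_first_moment restr_first_moment restr_first_moment, simplified]

text \<open>The atoms are made to balance the masses; this is where equal total mass enters on the upper
side.\<close>

lemma mass_lower: "measure lower_part UNIV = measure (restr \<mu> {..<a}) UNIV"
proof -
  have "emeasure lower_part UNIV = ennreal (measure \<nu> {..<a}) + ennreal (measure \<mu> {..<a} - measure \<nu> {..<a})"
    by (simp add: emeasure_lower_part nu.emeasure_eq_measure)
  also have "\<dots> = ennreal (measure \<mu> {..<a})"
    using contact_masses(1)[OF mu nu put_le contact_a] by (subst ennreal_plus[symmetric]) auto
  also have "\<dots> = emeasure (restr \<mu> {..<a}) UNIV"
    by (simp add: emeasure_restr mu_sets mu.emeasure_eq_measure)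
  finally show ?thesis by (simp add: measure_def)
qed

lemma mass_upper: "measure upper_part UNIV = measure (restr \<mu> {b<..}) UNIV"
proof -
  have compl: "measure N {b<..} = measure N UNIV - measure N {..b}"
    if "finite_borel_measure N" "space N = UNIV" for N :: "real measure"
  proof -
    interpret finite_borel_measure N by fact
    have "{b<..} = space N - {..b}" using that by auto
    then show ?thesis using finite_measure_compl[of "{..b}"] sets_M[of "{..b}"] that(2) by simp
  qed
  have "emeasure upper_part UNIV = ennreal (measure \<nu> {b<..}) + ennreal (measure \<nu> {..b} - measure \<mu> {..b})"
    by (simp add: emeasure_upper_part nu.emeasure_eq_measure)
  also have "\<dots> = ennreal (measure \<nu> {b<..} + (measure \<nu> {..b} - measure \<mu> {..b}))"
    using contact_masses(2)[OF mu nu put_le contact_b] by (intro ennreal_plus[symmetric]) auto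
  also have "measure \<nu> {b<..} + (measure \<nu> {..b} - measure \<mu> {..b}) = measure \<mu> {b<..}"
    using compl[OF mu.finite_borel_measure_axioms mu_sets(2)]
      compl[OF nu.finite_borel_measure_axioms nu_sets(2)] mass by simp
  also have "\<dots> = emeasure (restr \<mu> {b<..}) UNIV"
    by (simp add: emeasure_restr mu_sets mu.emeasure_eq_measure)
  finally show ?thesis by (simp add: measure_def)
qed

lemma mass_middle: "measure middle_part UNIV = measure (restr \<mu> {a..b}) UNIV"
  using nu_split3(4) mu_split3(4) mass_lower mass_upper mass by simp

lemma AE_lower: "AE y in lower_part. y \<le> a"
proof (rule AE_le_of_emeasure_zero)
  have "{..<a} \<inter> {a<..} = {}" by auto
  then show "emeasure lower_part {a<..} = 0" by (simp add: emeasure_lower_part)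
qed simp

lemma AE_upper: "AE y in upper_part. b \<le> y"
proof (rule AE_le_of_emeasure_zero)
  have "{b<..} \<inter> {..<b} = {}" by auto
  then show "emeasure upper_part {..<b} = 0" by (simp add: emeasure_upper_part)
qed simp

lemma AE_middle: "AE y in middle_part. a \<le> y" "AE y in middle_part. y \<le> b"
proof -
  have lt: "emeasure lower_part {..<a} = emeasure \<nu> {..<a}" by (simp add: emeasure_lower_part)
  have gt: "emeasure upper_part {b<..} = emeasure \<nu> {b<..}" by (simp add: emeasure_upper_part)
  have z: "emeasure middle_part B = 0"
    if B: "B \<in> sets borel" and le: "emeasure \<nu> B \<le> emeasure (add_measure lower_part upper_part) B" for B
  proof -
    have "emeasure \<nu> B = emeasure (add_measure lower_part upper_part) B"
      using le outer_parts_le[OF B] by (rule antisym)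
    then have "emeasure \<nu> B + emeasure middle_part B = emeasure \<nu> B + 0"
      using emeasure_middle_part(1)[OF B] by (simp add: add.commute)
    then show ?thesis using nu.emeasure_finite[of B] by (subst (asm) ennreal_add_left_cancel) auto
  qed
  show "AE y in middle_part. a \<le> y"
    by (rule AE_le_of_emeasure_zero, simp, rule z) (simp_all add: emeasure_add_measure lt)
  show "AE y in middle_part. y \<le> b"
    by (rule AE_le_of_emeasure_zero, simp, rule z) (simp_all add: emeasure_add_measure gt)
qed

lemma AE_mu_parts: "AE x in restr \<mu> {..<a}. x \<le> a" "AE x in restr \<mu> {b<..}. b \<le> x"
   "AE x in restr \<mu> {a..b}. a \<le> x" "AE x in restr \<mu> {a..b}. x \<le> b"
  by (auto simp: AE_restr mu_sets)

text \<open>On the left of \<open>a\<close> the other two parts have no put potential, and on the right of \<open>b\<close> no call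
potential. So the outer parts inherit their potentials from \<open>\<mu>\<close> and \<open>\<nu>\<close>.\<close>

lemma put_lower: "k \<le> a \<Longrightarrow> put_pot lower_part k = put_pot \<nu> k"
  using nu_split3(2)[of k] put_pot_right_supported[OF upper_part AE_upper, of k]
    put_pot_right_supported[OF middle_part AE_middle(1), of k] a_le_b by simp

lemma call_upper: "b \<le> k \<Longrightarrow> call_pot upper_part k = call_pot \<nu> k"
  using nu_split3(3)[of k] call_pot_left_supported[OF lower_part AE_lower, of k]
    call_pot_left_supported[OF middle_part AE_middle(2), of k] a_le_b by simp

lemma put_mu_lower: "k \<le> a \<Longrightarrow> put_pot (restr \<mu> {..<a}) k = put_pot \<mu> k"
  using mu_split3(2)[of k] put_pot_right_supported[OF restr_first_moment AE_mu_parts(2), of k]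
    put_pot_right_supported[OF restr_first_moment AE_mu_parts(3), of k] a_le_b by simp

lemma call_mu_upper: "b \<le> k \<Longrightarrow> call_pot (restr \<mu> {b<..}) k = call_pot \<mu> k"
  using mu_split3(3)[of k] call_pot_left_supported[OF restr_first_moment AE_mu_parts(1), of k]
    call_pot_left_supported[OF restr_first_moment AE_mu_parts(4), of k] a_le_b by simp

lemma put_middle:
  assumes "a \<le> k" "k \<le> b"
  shows "put_pot middle_part k = put_pot \<nu> k - put_pot \<nu> a - (k - a) * measure (restr \<mu> {..<a}) UNIV"
    and "put_pot (restr \<mu> {a..b}) k = put_pot \<mu> k - put_pot \<mu> a - (k - a) * measure (restr \<mu> {..<a}) UNIV"
  using assms nu_split3(2)[of k] put_pot_right_supported[OF upper_part AE_upper, of k]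
    put_pot_left_supported[OF lower_part AE_lower, of k] put_lower[of a] mass_lower
    mu_split3(2)[of k] put_pot_right_supported[OF restr_first_moment AE_mu_parts(2), of k]
    put_pot_left_supported[OF restr_first_moment AE_mu_parts(1), of k] put_mu_lower[of a] by simp_all

text \<open>Between two points of contact, \<open>put_pot \<mu>\<close> and \<open>put_pot \<nu> + p\<close> lose the same affine function to the outer
parts, so \<open>put_pot \<mu> \<le> put_pot \<nu> + p\<close> becomes the convex order of the middle parts. Equality at \<open>b\<close> means equal
means. Hence the middle part of \<open>\<mu>\<close> is transported to that of \<open>\<nu>\<close> by a martingale kernel.\<close>

lemma middle_kernel:
  obtains K where "K \<in> borel \<rightarrow>\<^sub>M prob_algebra borel" "middle_part = restr \<mu> {a..b} \<bind> K"
    "AE x in restr \<mu> {a..b}. barycenter K x = x"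
proof (rule strassen_kernel[OF restr_first_moment middle_part mass_middle[symmetric]])
  let ?\<mu> = "restr \<mu> {a..b}"
  have r: "?\<mu> \<in> finite_first_moment" by (rule restr_first_moment) simp
  have le: "put_pot ?\<mu> k \<le> put_pot middle_part k" if "a \<le> k" "k \<le> b" for k
    using put_middle[OF that] put_le[of k] contact_a by simp
  have eq: "put_pot ?\<mu> b = put_pot middle_part b"
    using put_middle[of b] contact_b contact_a a_le_b by simp
  then show "(\<integral>x. x \<partial>?\<mu>) = (\<integral>x. x \<partial>middle_part)"
    using put_call_parity[OF r, of b] put_call_parity[OF middle_part, of b] mass_middle
      call_pot_left_supported[OF r AE_mu_parts(4), of b] call_pot_left_supported[OF middle_part AE_middle(2), of b] by simp
  fix k
  consider "k \<le> a" | "a \<le> k" "k \<le> b" | "b \<le> k" by linarith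
  then show "put_pot ?\<mu> k \<le> put_pot middle_part k"
  proof cases
    case 1
    then show ?thesis using put_pot_right_supported[OF r AE_mu_parts(3) 1] put_pot_nonneg[OF middle_part] by simp
  next
    case 3
    then show ?thesis using put_pot_left_supported[OF r AE_mu_parts(4) 3] put_pot_left_supported[OF middle_part AE_middle(2) 3]
       eq mass_middle by simp
  qed (rule le)
qed (use that in auto)

end

section \<open>Weak transport costs\<close>

lemma le_INF_add_INF_ennreal:
  fixes f :: "'a \<Rightarrow> ennreal" and g :: "'b \<Rightarrow> ennreal"
  assumes "\<And>x y. x \<in> A \<Longrightarrow> y \<in> B \<Longrightarrow> c \<le> f x + g y"
  shows "c \<le> (INF x\<in>A. f x) + (INF y\<in>B. g y)"
proof -
  have *: "c \<le> z + (INF y\<in>S. k y)" if "\<And>y. y \<in> S \<Longrightarrow> c \<le> z + k y" for z :: ennreal and k :: "'c \<Rightarrow> ennreal" and S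
  proof (cases "z = top")
    case False
    have "c - z \<le> (INF y\<in>S. k y)"
      using that False by (intro INF_greatest) (auto simp: ennreal_minus_le_iff)
    then show ?thesis using False by (simp add: ennreal_minus_le_iff)
  qed simp
  have "c \<le> (INF y\<in>B. g y) + (INF x\<in>A. f x)"
  proof (rule *)
    fix x assume "x \<in> A"
    then have "c \<le> f x + (INF y\<in>B. g y)" using assms by (intro *)
    then show "c \<le> (INF y\<in>B. g y) + f x" by (simp add: add.commute)
  qed
  then show ?thesis by (simp add: add.commute)
qed

lemma borel_measurable_convex:
  fixes h :: "real \<Rightarrow> real"
  assumes "convex_on UNIV h"
  shows "h \<in> borel_measurable borel"
  by (intro borel_measurable_continuous_onI convex_on_continuous assms) simp

definition kernels :: "real measure \<Rightarrow> real measure \<Rightarrow> (real \<Rightarrow> real measure) set" where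
  "kernels \<eta> \<theta> = {K \<in> borel \<rightarrow>\<^sub>M prob_algebra borel. \<eta> \<bind> K = \<theta>}"

definition kernel_cost :: "(real \<Rightarrow> real) \<Rightarrow> real measure \<Rightarrow> (real \<Rightarrow> real measure) \<Rightarrow> ennreal" where
  "kernel_cost h \<eta> K = (\<integral>\<^sup>+x. ennreal (h (x - barycenter K x)) \<partial>\<eta>)"

lemma
  assumes K: "K \<in> kernels \<eta> \<theta>" and sets_eta: "sets \<eta> = sets borel"
  shows kernel_product_coupling: "kernel_product \<eta> K \<in> couplings \<eta> \<theta>"
    and kernel_product_sub: "AE x in \<eta>. x \<le> barycenter K x \<Longrightarrow> kernel_product \<eta> K \<in> couplings_sub \<eta> \<theta>"
    and kernel_product_sup: "AE x in \<eta>. barycenter K x \<le> x \<Longrightarrow> kernel_product \<eta> K \<in> couplings_sup \<eta> \<theta>"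
    and INF_weak_cost_le: "kernel_product \<eta> K \<in> S \<Longrightarrow> (INF \<pi>\<in>S. weak_cost h \<eta> \<pi>) \<le> kernel_cost h \<eta> K"
proof -
  have K': "K \<in> borel \<rightarrow>\<^sub>M prob_algebra borel" "\<eta> \<bind> K = \<theta>" using K by (auto simp: kernels_def)
  note c = coupling_of_kernel[OF K'(1) sets_eta, unfolded K'(2)]
  show "kernel_product \<eta> K \<in> couplings \<eta> \<theta>" by (rule c)
  show "AE x in \<eta>. x \<le> barycenter K x \<Longrightarrow> kernel_product \<eta> K \<in> couplings_sub \<eta> \<theta>"
    "AE x in \<eta>. barycenter K x \<le> x \<Longrightarrow> kernel_product \<eta> K \<in> couplings_sup \<eta> \<theta>"
    using c by (auto simp: couplings_sub_def couplings_sup_def)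
  have "weak_cost h \<eta> (kernel_product \<eta> K) \<le> kernel_cost h \<eta> K"
    unfolding weak_cost_def kernel_cost_def by (rule INF_lower[OF c(2)])
  then show "kernel_product \<eta> K \<in> S \<Longrightarrow> (INF \<pi>\<in>S. weak_cost h \<eta> \<pi>) \<le> kernel_cost h \<eta> K"
    by (rule INF_lower2[rotated])
qed

lemma weak_transport_eq_INF_kernels:
  assumes "sets \<eta> = sets borel"
  shows "weak_transport h \<eta> \<theta> = (INF K\<in>kernels \<eta> \<theta>. kernel_cost h \<eta> K)"
proof (rule antisym)
  show "weak_transport h \<eta> \<theta> \<le> (INF K\<in>kernels \<eta> \<theta>. kernel_cost h \<eta> K)"
    unfolding weak_transport_def
    using assms by (intro INF_greatest INF_weak_cost_le kernel_product_coupling)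
  show "(INF K\<in>kernels \<eta> \<theta>. kernel_cost h \<eta> K) \<le> weak_transport h \<eta> \<theta>"
    unfolding weak_transport_def weak_cost_def
  proof (intro INF_greatest)
    fix \<pi> K assume *: "\<pi> \<in> couplings \<eta> \<theta>" "K \<in> disintegrations \<eta> \<pi>"
    have "K \<in> kernels \<eta> \<theta>"
      using second_marginal_bind[OF *] disintegrationsD(1)[OF *(2)] by (simp add: kernels_def)
    then show "(INF K\<in>kernels \<eta> \<theta>. kernel_cost h \<eta> K) \<le> (\<integral>\<^sup>+x. ennreal (h (x - barycenter K x)) \<partial>\<eta>)"
      unfolding kernel_cost_def[symmetric] by (rule INF_lower)
  qed
qed

lemma kernel_cost_mono:
  assumes h: "convex_on UNIV h" "\<And>x. 0 \<le> h x" "h 0 = 0" and s: "s = 1 \<or> s = - 1"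
    and "AE x in \<eta>. s * x \<le> s * barycenter L x \<and> s * barycenter L x \<le> max (s * x) (s * barycenter K x)"
  shows "kernel_cost h \<eta> L \<le> kernel_cost h \<eta> K"
  unfolding kernel_cost_def
proof (rule nn_integral_mono_AE)
  show "AE x in \<eta>. ennreal (h (x - barycenter L x)) \<le> ennreal (h (x - barycenter K x))"
    using assms(5) by eventually_elim (intro ennreal_leI convex_between_le[OF h s]; simp)
qed

lemma measurable_cost:
  assumes "convex_on UNIV h" "K \<in> borel \<rightarrow>\<^sub>M prob_algebra borel"
  shows "(\<lambda>x. ennreal (h (x - barycenter K x))) \<in> borel_measurable borel"
proof -
  have [measurable]: "h \<in> borel_measurable borel" "barycenter K \<in> borel_measurable borel"
    using borel_measurable_convex[OF assms(1)] measurable_barycenter[OF assms(2)] .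
  show ?thesis by measurable
qed

context put_contact
begin

lemma restricted_jensen:
  assumes K: "K \<in> kernels \<mu> \<nu>" and A: "A \<in> sets borel"
  shows "(\<integral>x. max (c + s * barycenter K x) 0 \<partial>restr \<mu> A) \<le> (\<integral>y. max (c + s * y) 0 \<partial>\<nu>)"
    and "integrable (restr \<mu> A) (barycenter K)"
proof -
  have K': "K \<in> borel \<rightarrow>\<^sub>M prob_algebra borel" "\<nu> = \<mu> \<bind> K" using K by (auto simp: kernels_def)
  note ctx = K'(1) mu_sets(1) K'(2) finite_first_momentD(4)[OF nu]
  have [measurable]: "barycenter K \<in> borel_measurable borel" by (rule measurable_barycenter[OF K'(1)])
  have int: "integrable \<mu> (barycenter K)" by (rule integrable_barycenter_UNIV[OF ctx])
  then show "integrable (restr \<mu> A) (barycenter K)" using A by (intro integrable_restr mu_sets) auto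
  have "integrable \<mu> (\<lambda>x. max (c + s * barycenter K x) 0)"
    using int by (intro Bochner_Integration.integrable_max Bochner_Integration.integrable_add integrable_mult_right) auto
  then have "(\<integral>x. max (c + s * barycenter K x) 0 \<partial>restr \<mu> A) \<le> (\<integral>x. max (c + s * barycenter K x) 0 \<partial>\<mu>)"
    using A by (intro integral_restr_le mu_sets) auto
  also have "\<dots> \<le> (\<integral>y. max (c + s * y) 0 \<partial>\<nu>)"
    by (rule barycenter_jensen[OF ctx mu.finite_measure_axioms])
  finally show "(\<integral>x. max (c + s * barycenter K x) 0 \<partial>restr \<mu> A) \<le> (\<integral>y. max (c + s * y) 0 \<partial>\<nu>)" .
qed

lemma call_le: "call_pot \<mu> k \<le> call_pot \<nu> k + (p + (\<integral>x. x \<partial>\<mu>) - (\<integral>x. x \<partial>\<nu>))"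
  using put_le[of k] put_call_parity[OF mu, of k] put_call_parity[OF nu, of k] mass by simp

lemma call_contact_b: "call_pot \<mu> b = call_pot \<nu> b + (p + (\<integral>x. x \<partial>\<mu>) - (\<integral>x. x \<partial>\<nu>))"
  using contact_b put_call_parity[OF mu, of b] put_call_parity[OF nu, of b] mass by simp

text \<open>The potentials of \<open>lower_part\<close> and of \<open>\<nu>\<close> agree on the left of \<open>a\<close>, so the law of the barycenter of \<open>K\<close>
restricted to \<open>{..<a}\<close> has a put potential below the one of \<open>lower_part\<close> there, and
\<open>one_sided_kernel\<close> applies.\<close>

lemma lower_kernel:
  assumes K: "K \<in> kernels \<mu> \<nu>"
  obtains L where "L \<in> kernels (restr \<mu> {..<a}) lower_part"
    "AE x in restr \<mu> {..<a}. x \<le> barycenter L x \<and> barycenter L x \<le> max x (barycenter K x)"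
proof -
  let ?\<eta> = "restr \<mu> {..<a}"
  have K': "K \<in> borel \<rightarrow>\<^sub>M prob_algebra borel" using K by (auto simp: kernels_def)
  obtain L where L: "L \<in> borel \<rightarrow>\<^sub>M prob_algebra borel" "lower_part = ?\<eta> \<bind> L"
    "AE x in ?\<eta>. 1 * x \<le> 1 * barycenter L x \<and> 1 * barycenter L x \<le> max (1 * x) (1 * barycenter K x)"
  proof (rule one_sided_kernel[where s=1 and \<eta>="?\<eta>" and \<theta>=lower_part and T="barycenter K" and \<alpha>=a and p=p])
    show "?\<eta> \<in> finite_first_moment" "lower_part \<in> finite_first_moment"
      by (simp_all add: restr_first_moment lower_part)
    show "measure ?\<eta> UNIV = measure lower_part UNIV" by (simp add: mass_lower)
    show "integrable ?\<eta> (barycenter K)" by (rule restricted_jensen(2)[OF K]) simp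
    show "barycenter K \<in> borel_measurable borel" by (rule measurable_barycenter[OF K'])
    show "AE x in ?\<eta>. 1 * x \<le> a" "AE x in lower_part. 1 * x \<le> a"
      using AE_mu_parts(1) AE_lower by simp_all
    show "(\<integral>x. max (k - 1 * barycenter K x) 0 \<partial>?\<eta>) \<le> (\<integral>y. max (k - 1 * y) 0 \<partial>lower_part)" if "k \<le> a" for k
      using restricted_jensen(1)[OF K, of "{..<a}" k "-1"] put_lower[OF that] by (simp add: put_pot_def)
    show "(\<integral>x. max (k - 1 * x) 0 \<partial>?\<eta>) \<le> (\<integral>y. max (k - 1 * y) 0 \<partial>lower_part) + p" if "k \<le> a" for k
      using put_le[of k] put_lower[OF that] put_mu_lower[OF that] by (simp add: put_pot_def)
    show "(\<integral>x. max (a - 1 * x) 0 \<partial>?\<eta>) = (\<integral>y. max (a - 1 * y) 0 \<partial>lower_part) + p"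
      using contact_a put_lower[of a] put_mu_lower[of a] by (simp add: put_pot_def)
  qed (use p_pos in auto)
  then show thesis by (intro that[of L]) (simp_all add: kernels_def)
qed

text \<open>The mirror image, with call potentials; by put-call parity the gap between them is
\<open>p + \<integral>x \<mu>(dx) - \<integral>x \<nu>(dx)\<close> instead of \<open>p\<close>.\<close>

lemma upper_kernel:
  assumes K: "K \<in> kernels \<mu> \<nu>"
  obtains L where "L \<in> kernels (restr \<mu> {b<..}) upper_part"
    "AE x in restr \<mu> {b<..}. - x \<le> - barycenter L x \<and> - barycenter L x \<le> max (- x) (- barycenter K x)"
proof -
  let ?\<eta> = "restr \<mu> {b<..}"
  have K': "K \<in> borel \<rightarrow>\<^sub>M prob_algebra borel" using K by (auto simp: kernels_def)
  have call: "call_pot N (- k) = (\<integral>x. max (k + x) 0 \<partial>N)" for N k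
    unfolding call_pot_def by (simp add: add.commute)
  obtain L where L: "L \<in> borel \<rightarrow>\<^sub>M prob_algebra borel" "upper_part = ?\<eta> \<bind> L"
    "AE x in ?\<eta>. - 1 * x \<le> - 1 * barycenter L x \<and> - 1 * barycenter L x \<le> max (- 1 * x) (- 1 * barycenter K x)"
  proof (rule one_sided_kernel[where s="-1" and \<eta>="?\<eta>" and \<theta>=upper_part and T="barycenter K" and \<alpha>="- b"
        and p="p + (\<integral>x. x \<partial>\<mu>) - (\<integral>x. x \<partial>\<nu>)"])
    show "?\<eta> \<in> finite_first_moment" "upper_part \<in> finite_first_moment"
      by (simp_all add: restr_first_moment upper_part)
    show "measure ?\<eta> UNIV = measure upper_part UNIV" by (simp add: mass_upper)
    show "integrable ?\<eta> (barycenter K)" by (rule restricted_jensen(2)[OF K]) simp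
    show "barycenter K \<in> borel_measurable borel" by (rule measurable_barycenter[OF K'])
    show "AE x in ?\<eta>. - 1 * x \<le> - b" "AE x in upper_part. - 1 * x \<le> - b"
      using AE_mu_parts(2) AE_upper by simp_all
    show "(\<integral>x. max (k - - 1 * barycenter K x) 0 \<partial>?\<eta>) \<le> (\<integral>y. max (k - - 1 * y) 0 \<partial>upper_part)" if "k \<le> - b" for k
      using restricted_jensen(1)[OF K, of "{b<..}" k "1"] call_upper[of "- k"] that by (simp add: call)
    show "(\<integral>x. max (k - - 1 * x) 0 \<partial>?\<eta>) \<le> (\<integral>y. max (k - - 1 * y) 0 \<partial>upper_part) + (p + (\<integral>x. x \<partial>\<mu>) - (\<integral>x. x \<partial>\<nu>))"
      if "k \<le> - b" for k
      using call_le[of "- k"] call_upper[of "- k"] call_mu_upper[of "- k"] that by (simp add: call)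
    show "(\<integral>x. max (- b - - 1 * x) 0 \<partial>?\<eta>) = (\<integral>y. max (- b - - 1 * y) 0 \<partial>upper_part) + (p + (\<integral>x. x \<partial>\<mu>) - (\<integral>x. x \<partial>\<nu>))"
      using call_contact_b call_upper[of b] call_mu_upper[of b] call[of _ "- b"] by simp
  qed (use mean_gap in auto)
  then show thesis by (intro that[of L]) (simp_all add: kernels_def)
qed

text \<open>A kernel from \<open>\<mu>\<close> to \<open>\<nu>\<close> yields admissible kernels for both one-sided problems that cost no more on
their half-lines; the cost between \<open>a\<close> and \<open>b\<close> is dropped.\<close>

lemma lower_bound:
  assumes h: "convex_on UNIV h" "\<And>x. 0 \<le> h x" "h 0 = 0"
  shows "(INF \<pi>\<in>couplings_sub (restr \<mu> {..<a}) lower_part. weak_cost h (restr \<mu> {..<a}) \<pi>) +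
      (INF \<pi>\<in>couplings_sup (restr \<mu> {b<..}) upper_part. weak_cost h (restr \<mu> {b<..}) \<pi>) \<le> weak_transport h \<mu> \<nu>"
  unfolding weak_transport_eq_INF_kernels[OF mu_sets(1)]
proof (rule INF_greatest)
  fix K assume K: "K \<in> kernels \<mu> \<nu>"
  then have K': "K \<in> borel \<rightarrow>\<^sub>M prob_algebra borel" by (auto simp: kernels_def)
  obtain L1 where L1: "L1 \<in> kernels (restr \<mu> {..<a}) lower_part"
    "AE x in restr \<mu> {..<a}. x \<le> barycenter L1 x \<and> barycenter L1 x \<le> max x (barycenter K x)"
    by (rule lower_kernel[OF K])
  obtain L2 where L2: "L2 \<in> kernels (restr \<mu> {b<..}) upper_part"
    "AE x in restr \<mu> {b<..}. - x \<le> - barycenter L2 x \<and> - barycenter L2 x \<le> max (- x) (- barycenter K x)"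
    by (rule upper_kernel[OF K])
  have "(INF \<pi>\<in>couplings_sub (restr \<mu> {..<a}) lower_part. weak_cost h (restr \<mu> {..<a}) \<pi>) \<le> kernel_cost h (restr \<mu> {..<a}) L1"
    using L1 by (intro INF_weak_cost_le kernel_product_sub) (auto simp: mu_sets elim: eventually_mono)
  also have "\<dots> \<le> kernel_cost h (restr \<mu> {..<a}) K"
    using L1(2) by (intro kernel_cost_mono[where s=1] h) auto
  finally have 1: "(INF \<pi>\<in>couplings_sub (restr \<mu> {..<a}) lower_part. weak_cost h (restr \<mu> {..<a}) \<pi>) \<le> kernel_cost h (restr \<mu> {..<a}) K" .
  have "(INF \<pi>\<in>couplings_sup (restr \<mu> {b<..}) upper_part. weak_cost h (restr \<mu> {b<..}) \<pi>) \<le> kernel_cost h (restr \<mu> {b<..}) L2"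
    using L2 by (intro INF_weak_cost_le kernel_product_sup) (auto simp: mu_sets elim: eventually_mono)
  also have "\<dots> \<le> kernel_cost h (restr \<mu> {b<..}) K"
    using L2(2) by (intro kernel_cost_mono[where s="-1"] h) auto
  finally have 2: "(INF \<pi>\<in>couplings_sup (restr \<mu> {b<..}) upper_part. weak_cost h (restr \<mu> {b<..}) \<pi>) \<le> kernel_cost h (restr \<mu> {b<..}) K" .
  have "kernel_cost h \<mu> K = kernel_cost h (restr \<mu> {..<a}) K + kernel_cost h (restr \<mu> {b<..}) K + kernel_cost h (restr \<mu> {a..b}) K"
    unfolding kernel_cost_def by (rule mu_split3(1)[OF measurable_cost[OF h(1) K']])
  then have "kernel_cost h (restr \<mu> {..<a}) K + kernel_cost h (restr \<mu> {b<..}) K \<le> kernel_cost h \<mu> K" by simp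
  then show "(INF \<pi>\<in>couplings_sub (restr \<mu> {..<a}) lower_part. weak_cost h (restr \<mu> {..<a}) \<pi>) +
      (INF \<pi>\<in>couplings_sup (restr \<mu> {b<..}) upper_part. weak_cost h (restr \<mu> {b<..}) \<pi>) \<le> kernel_cost h \<mu> K"
    using add_mono[OF 1 2] by (rule order_trans[rotated])
qed

text \<open>Kernels for the outer parts are glued with the martingale kernel in the middle, which costs
nothing.\<close>

lemma upper_bound:
  assumes h: "convex_on UNIV h" "\<And>x. 0 \<le> h x" "h 0 = 0"
  shows "weak_transport h \<mu> \<nu> \<le> weak_transport h (restr \<mu> {..<a}) lower_part + weak_transport h (restr \<mu> {b<..}) upper_part"
proof -
  have sets_r: "sets (restr \<mu> A) = sets borel" for A by (simp add: mu_sets)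
  obtain K0 where K0: "K0 \<in> borel \<rightarrow>\<^sub>M prob_algebra borel" "middle_part = restr \<mu> {a..b} \<bind> K0"
    "AE x in restr \<mu> {a..b}. barycenter K0 x = x"
    by (rule middle_kernel)
  have "weak_transport h \<mu> \<nu> \<le> kernel_cost h (restr \<mu> {..<a}) K1 + kernel_cost h (restr \<mu> {b<..}) K2"
    if "K1 \<in> kernels (restr \<mu> {..<a}) lower_part" "K2 \<in> kernels (restr \<mu> {b<..}) upper_part" for K1 K2
  proof -
    have K12: "K1 \<in> borel \<rightarrow>\<^sub>M prob_algebra borel" "lower_part = restr \<mu> {..<a} \<bind> K1"
      "K2 \<in> borel \<rightarrow>\<^sub>M prob_algebra borel" "upper_part = restr \<mu> {b<..} \<bind> K2"
      using that by (auto simp: kernels_def)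
    define K where "K x = (if x < a then K1 x else if b < x then K2 x else K0 x)" for x
    have K: "K \<in> borel \<rightarrow>\<^sub>M prob_algebra borel"
      unfolding K_def using K12 K0 by (intro measurable_If) auto
    have AE_K: "AE x in restr \<mu> {..<a}. K x = K1 x" "AE x in restr \<mu> {b<..}. K x = K2 x" "AE x in restr \<mu> {a..b}. K x = K0 x"
      using a_le_b by (auto simp: AE_restr mu_sets K_def intro!: AE_I2)
    have split: "(\<integral>\<^sup>+x. G (K x) x \<partial>\<mu>) = (\<integral>\<^sup>+x. G (K1 x) x \<partial>restr \<mu> {..<a}) + (\<integral>\<^sup>+x. G (K2 x) x \<partial>restr \<mu> {b<..}) + (\<integral>\<^sup>+x. G (K0 x) x \<partial>restr \<mu> {a..b})"
      if "(\<lambda>x. G (K x) x) \<in> borel_measurable borel" for G :: "real measure \<Rightarrow> real \<Rightarrow> ennreal"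
    proof -
      have "(\<integral>\<^sup>+x. G (K x) x \<partial>restr \<mu> {..<a}) = (\<integral>\<^sup>+x. G (K1 x) x \<partial>restr \<mu> {..<a})"
        "(\<integral>\<^sup>+x. G (K x) x \<partial>restr \<mu> {b<..}) = (\<integral>\<^sup>+x. G (K2 x) x \<partial>restr \<mu> {b<..})"
        "(\<integral>\<^sup>+x. G (K x) x \<partial>restr \<mu> {a..b}) = (\<integral>\<^sup>+x. G (K0 x) x \<partial>restr \<mu> {a..b})"
        using AE_K by (auto intro!: nn_integral_cong_AE elim!: eventually_mono)
      then show ?thesis using mu_split3(1)[OF that] by simp
    qed
    have bind_em: "emeasure (N \<bind> L) B = (\<integral>\<^sup>+x. emeasure (L x) B \<partial>N)"
      if "L \<in> borel \<rightarrow>\<^sub>M prob_algebra borel" "sets N = sets borel" "B \<in> sets borel"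
      for N :: "real measure" and L :: "real \<Rightarrow> real measure" and B
      using measurable_prob_algebraD[OF that(1)] that(2,3) sets_eq_imp_space_eq[OF that(2)]
      by (intro emeasure_bind[where N=borel]) (simp_all cong: measurable_cong_sets)
    have "\<mu> \<bind> K = \<nu>"
    proof (rule measure_eqI)
      show sets_bind: "sets (\<mu> \<bind> K) = sets \<nu>"
        using prob_kernelD(2)[OF K] by (subst sets_bind[where N=borel]) (auto simp: mu_sets nu_sets)
      fix B assume "B \<in> sets (\<mu> \<bind> K)"
      then have B: "B \<in> sets borel" unfolding sets_bind nu_sets .
      have m: "(\<lambda>x. emeasure (K x) B) \<in> borel_measurable borel"
        using measurable_prob_algebraD[OF K] B by (rule measurable_emeasure_kernel)
      have "emeasure (\<mu> \<bind> K) B = emeasure lower_part B + emeasure upper_part B + emeasure middle_part B"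
        using split[of "\<lambda>M _. emeasure M B"] m B K12 K0 K by (simp add: bind_em sets_r mu_sets)
      also have "\<dots> = emeasure \<nu> B"
        using B emeasure_middle_part(1)[OF B] by (simp add: emeasure_add_measure ac_simps)
      finally show "emeasure (\<mu> \<bind> K) B = emeasure \<nu> B" .
    qed
    then have "K \<in> kernels \<mu> \<nu>" using K by (simp add: kernels_def)
    then have "weak_transport h \<mu> \<nu> \<le> kernel_cost h \<mu> K"
      unfolding weak_transport_eq_INF_kernels[OF mu_sets(1)] by (rule INF_lower)
    also have "\<dots> = kernel_cost h (restr \<mu> {..<a}) K1 + kernel_cost h (restr \<mu> {b<..}) K2 + kernel_cost h (restr \<mu> {a..b}) K0"
      using split[of "\<lambda>M x. ennreal (h (x - (\<integral>y. y \<partial>M)))"] measurable_cost[OF h(1) K]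
      by (simp add: kernel_cost_def barycenter_def)
    also have "kernel_cost h (restr \<mu> {a..b}) K0 = 0"
    proof -
      have "kernel_cost h (restr \<mu> {a..b}) K0 = (\<integral>\<^sup>+x. 0 \<partial>restr \<mu> {a..b})"
        unfolding kernel_cost_def by (rule nn_integral_cong_AE) (use K0(3) in eventually_elim, simp add: h(3))
      then show ?thesis by simp
    qed
    finally show ?thesis by simp
  qed
  then show ?thesis
    unfolding weak_transport_eq_INF_kernels[OF sets_r] by (rule le_INF_add_INF_ennreal)
qed

end

theorem corollary3p2:
  fixes \<mu> \<nu> :: "real measure" and h :: "real \<Rightarrow> real"
  assumes "\<mu> \<in> finite_first_moment" and "\<nu> \<in> finite_first_moment"
    and "measure \<mu> UNIV = measure \<nu> UNIV"
    and "min (p_gap \<mu> \<nu>) (c_gap \<mu> \<nu>) > 0"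
    and "convex_on UNIV h" and "\<And>x. h x \<ge> 0" and "h 0 = 0"
  shows "weak_transport h \<mu> \<nu> =
           weak_transport h (eta_minus \<mu> \<nu>) (chi_minus \<mu> \<nu>) +
           weak_transport h (eta_plus \<mu> \<nu>) (chi_plus \<mu> \<nu>) \<and>
         weak_transport h (eta_minus \<mu> \<nu>) (chi_minus \<mu> \<nu>) +
           weak_transport h (eta_plus \<mu> \<nu>) (chi_plus \<mu> \<nu>) =
         (INF \<pi> \<in> couplings_sub (eta_minus \<mu> \<nu>) (chi_minus \<mu> \<nu>). weak_cost h (eta_minus \<mu> \<nu>) \<pi>) +
         (INF \<pi> \<in> couplings_sup (eta_plus \<mu> \<nu>) (chi_plus \<mu> \<nu>). weak_cost h (eta_plus \<mu> \<nu>) \<pi>)"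
proof -
  have pos: "0 < p_gap \<mu> \<nu>" "0 < c_gap \<mu> \<nu>" using assms(4) by auto
  note contact = contact_set[OF assms(1-3) pos]
  interpret put_contact \<mu> \<nu> "p_gap \<mu> \<nu>" "x_minus \<mu> \<nu>" "x_plus \<mu> \<nu>"
    by unfold_locales (use assms contact pos in \<open>simp_all add: shifted_put_def\<close>)
  have eta: "eta_minus \<mu> \<nu> = restr \<mu> {..<x_minus \<mu> \<nu>}" "eta_plus \<mu> \<nu> = restr \<mu> {x_plus \<mu> \<nu><..}"
    by (simp_all add: eta_minus_def eta_plus_def)
  have left: "left_deriv (put_pot \<mu>) z = measure \<mu> {..<z}" and right: "right_deriv (put_pot \<mu>) z = measure \<mu> {..z}"
    and left': "left_deriv (shifted_put \<mu> \<nu>) z = measure \<nu> {..<z}" and right': "right_deriv (shifted_put \<mu> \<nu>) z = measure \<nu> {..z}" for z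
    using left_deriv_put_pot[OF mu, of 0 z] right_deriv_put_pot[OF mu, of 0 z]
      left_deriv_put_pot[OF nu, of "p_gap \<mu> \<nu>" z] right_deriv_put_pot[OF nu, of "p_gap \<mu> \<nu>" z]
    by (simp_all add: shifted_put_def[abs_def])
  have chi: "chi_minus \<mu> \<nu> = lower_part" "chi_plus \<mu> \<nu> = upper_part"
    by (simp_all add: chi_minus_def chi_plus_def lower_part_def upper_part_def Delta_minus_def Delta_plus_def left right left' right')
  let ?S = "(INF \<pi> \<in> couplings_sub (eta_minus \<mu> \<nu>) (chi_minus \<mu> \<nu>). weak_cost h (eta_minus \<mu> \<nu>) \<pi>) +
         (INF \<pi> \<in> couplings_sup (eta_plus \<mu> \<nu>) (chi_plus \<mu> \<nu>). weak_cost h (eta_plus \<mu> \<nu>) \<pi>)"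
  let ?W = "weak_transport h (eta_minus \<mu> \<nu>) (chi_minus \<mu> \<nu>) + weak_transport h (eta_plus \<mu> \<nu>) (chi_plus \<mu> \<nu>)"
  have 1: "?S \<le> weak_transport h \<mu> \<nu>" unfolding eta chi by (rule lower_bound) (fact assms)+
  have 2: "weak_transport h \<mu> \<nu> \<le> ?W" unfolding eta chi by (rule upper_bound) (fact assms)+
  have 3: "?W \<le> ?S" unfolding weak_transport_def
    by (intro add_mono INF_superset_mono) (auto simp: couplings_sub_def couplings_sup_def)
  show ?thesis using 1 2 3 by (metis antisym order_trans)
qed

end
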